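(* Let $a_1,a_2,a_3$ be pairwise coprime positive integers, let $M=\Sigma(a_1,a_2,a_3)$ be the Brieskorn homology 3-sphere, and let $\rho:\pi_1M\to SL(2;\mathbb{C})$ be an irreducible representation. If $\rho$ is not conjugate in $SL(2;\mathbb{C})$ to a representation with image in $SU(2)$, then there exists a unique euler class $eu\in E$ such that the induced $SL(2;\mathbb{R})$-representation $\rho_{eu}$ is conjugate in $SL(2;\mathbb{C})$ to $\rho$.
   Context: $\Sigma(a_1,a_2,a_3)=\{(z_1,z_2,z_3)\in\mathbb{C}^3 : z_1^{a_1}+z_2^{a_2}+z_3^{a_3}=0,\ |z_1|^2+|z_2|^2+|z_3|^2=1\}$, and $\Gamma(a_1,a_2,a_3)=\langle x,y,z\mid x^{a_1}=y^{a_2}=z^{a_3}=xyz=1\rangle$ is the orbifold fundamental group of its base orbifold $S^2(a_1,a_2,a_3)$. Put $a=a_1a_2a_3$ and choose integers $b,b_1,b_2,b_3$ with $a(b+b_1/a_1+b_2/a_2+b_3/a_3)=1$. Then $\pi_1\Sigma(a_1,a_2,a_3)=\langle x,y,z,h\mid h\text{ central},\ x^{a_1}=h^{-b_1},\ y^{a_2}=h^{-b_2},\ z^{a_3}=h^{-b_3},\ xyz=h^{b}\rangle$. $\widetilde{PSL}(2;\mathbb{R})$ is the universal cover of $PSL(2;\mathbb{R})$, acting on $\mathbb{R}$, the universal cover of $\mathbb{R}P^1=\mathbb{R}/\mathbb{Z}$. Its center is $\langle \mathrm{sh}(1)\rangle\cong\mathbb{Z}$, where $\mathrm{sh}(r):t\mapsto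 t+r$. The projection $\widetilde{PSL}(2;\mathbb{R})\to SL(2;\mathbb{R})$ has kernel $\langle\mathrm{sh}(2)\rangle$ and sends $\mathrm{sh}(1)$ to $-I$. Euler classes. $H^2(\Gamma(a_1,a_2,a_3);\mathbb{Z})$ is identified with the abelian group $\langle x_0,x_1,x_2,x_3\mid a_ix_i=x_0\ (i=1,2,3)\rangle$. For a homomorphism $f:\Gamma(a_1,a_2,a_3)\to PSL(2;\mathbb{R})$, $eu(f)=\beta x_0+\beta_1x_1+\beta_2x_2+\beta_3x_3$ means that the pull-back along $f$ of the central extension $0\to\mathbb{Z}\to\widetilde{PSL}(2;\mathbb{R})\to PSL(2;\mathbb{R})\to1$ is $\widetilde\Gamma(a_1,a_2,a_3)=\langle x,y,z,h\mid h\text{ central},\ x^{a_1}=h^{-\beta_1},\ y^{a_2}=h^{-\beta_2},\ z^{a_3}=h^{-\beta_3},\ xyz=h^{\beta}\rangle$, with $h\mapsto\mathrm{sh}(1)$. $E$ is the set of classes $eu=\beta x_0+\beta_1x_1+\beta_2x_2+\beta_3x_3$ with $\beta=-1$, $0<\beta_i<a_i$ ($i=1,2,3$) and $\beta_1/a_1+\beta_2/a_2+\beta_3/a_3<1$. By a theorem of Jankins and Neumann every $eu\in E$ equals $eu(f)$ for some $f$. The representation $\rho_{eu}$. For $eu\in E$ take $f$ with $eu(f)=eu$. The group $\widetilde\Gamma(a_1,a_2,a_3)$ is $\pi_1\overline M$ for the Seifert fibered space $\overline M=M(0;(1,\beta),(a_1,\beta_1),(a_2,\beta_2),(a_3,\beta_3))$,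 whose euler number is $e(\overline M)=-(\beta+\sum_i\beta_i/a_i)\neq0$. Composing $\widetilde\Gamma(a_1,a_2,a_3)\to\widetilde{PSL}(2;\mathbb{R})$ with the projection to $SL(2;\mathbb{R})$ gives $\overline\rho:\pi_1\overline M\to SL(2;\mathbb{R})$. $\Sigma(a_1,a_2,a_3)$ is the universal abelian cover of $\overline M$, of degree $a|e(\overline M)|=|H_1(\overline M;\mathbb{Z})|$. Let $p:\pi_1\Sigma(a_1,a_2,a_3)\to\pi_1\overline M$ be the induced homomorphism (injective, with image the commutator subgroup, sending $h$ to $h^{a|e(\overline M)|}$). Then $\rho_{eu}=p^*\overline\rho=\overline\rho\circ p$, considered up to conjugation in $SL(2;\mathbb{C})$. *)

theory Defs
  imports
    "HOL-Analysis.Determinants"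
    "HOL-Algebra.Generated_Groups"
    "HOL-Algebra.Free_Abelian_Groups"
begin

section \<open>Groups given by generators and relations\<close>

text \<open>A letter is a generator (flag \<^const>\<open>False\<close>) or the inverse of a generator (flag
  \<^const>\<open>True\<close>). The type of generators is exactly the generating set.\<close>

type_synonym 'g word = "('g \<times> bool) list"

definition pow_word :: "'g \<Rightarrow> int \<Rightarrow> 'g word" where
  "pow_word g k = replicate (nat \<bar>k\<bar>) (g, k < 0)"

inductive word_eq :: "('g word \<times> 'g word) set \<Rightarrow> 'g word \<Rightarrow> 'g word \<Rightarrow> bool"
  for R :: "('g word \<times> 'g word) set" where
  refl: "word_eq R u u"
| sym: "word_eq R u v \<Longrightarrow> word_eq R v u"
| trans: "word_eq R u v \<Longrightarrow> word_eq R v w \<Longrightarrow> word_eq R u w"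
| cancel: "word_eq R (u @ [(g, e), (g, \<not> e)] @ v) (u @ v)"
| rel: "(l, r) \<in> R \<Longrightarrow> word_eq R (u @ l @ v) (u @ r @ v)"

definition word_class :: "('g word \<times> 'g word) set \<Rightarrow> 'g word \<Rightarrow> 'g word set" where
  "word_class R w = {v. word_eq R w v}"

definition presented_group :: "('g word \<times> 'g word) set \<Rightarrow> 'g word set monoid" where
  "presented_group R =
     \<lparr>carrier = range (word_class R),
      monoid.mult = (\<lambda>A B. \<Union>u\<in>A. \<Union>v\<in>B. word_class R (u @ v)),
      one = word_class R []\<rparr>"

lemma word_class_eq_iff: "word_class R u = word_class R v \<longleftrightarrow> word_eq R u v"
proof
  assume "word_class R u = word_class R v"
  moreover have "v \<in> word_class R v" by (simp add: word_class_def word_eq.refl)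
  ultimately have "v \<in> word_class R u" by (rule ssubst)
  then show "word_eq R u v" by (simp add: word_class_def)
next
  assume uv: "word_eq R u v"
  have "word_eq R u w \<longleftrightarrow> word_eq R v w" for w
    using word_eq.trans[OF uv] word_eq.trans[OF word_eq.sym[OF uv]] by (rule iffI[rotated])
  then show "word_class R u = word_class R v" unfolding word_class_def by (rule Collect_cong)
qed

lemma word_eq_context:
  assumes "word_eq R u u'"
  shows "word_eq R (x @ u @ y) (x @ u' @ y)"
  using assms
proof (induction rule: word_eq.induct)
  case (refl u)
  show ?case by (rule word_eq.refl)
next
  case (sym u v)
  from sym.IH show ?case by (rule word_eq.sym)
next
  case (trans u v w)
  from trans.IH show ?case by (rule word_eq.trans)
next
  case (cancel u g e v)
  then show ?case using word_eq.cancel[of R "x @ u" g e "v @ y"] by simp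
next
  case (rel l r u v)
  then show ?case using word_eq.rel[of l r R "x @ u" "v @ y"] by simp
qed

lemma word_eq_append:
  assumes "word_eq R u u'" "word_eq R v v'"
  shows "word_eq R (u @ v) (u' @ v')"
proof (rule word_eq.trans)
  show "word_eq R (u @ v) (u' @ v)" using word_eq_context[OF assms(1), of "[]" v] by simp
  show "word_eq R (u' @ v) (u' @ v')" using word_eq_context[OF assms(2), of u' "[]"] by simp
qed

lemma word_class_mult:
  "word_class R u \<otimes>\<^bsub>presented_group R\<^esub> word_class R v = word_class R (u @ v)"
proof -
  have eq: "word_class R (u' @ v') = word_class R (u @ v)"
    if "u' \<in> word_class R u" "v' \<in> word_class R v" for u' v'
  proof -
    have "word_eq R u u'" "word_eq R v v'" using that by (simp_all add: word_class_def)
    then have "word_eq R (u @ v) (u' @ v')" by (rule word_eq_append)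
    then show ?thesis unfolding word_class_eq_iff by (rule word_eq.sym)
  qed
  have "(\<Union>u'\<in>word_class R u. \<Union>v'\<in>word_class R v. word_class R (u' @ v')) =
        (\<Union>u'\<in>word_class R u. \<Union>v'\<in>word_class R v. word_class R (u @ v))"
    by (intro SUP_cong HOL.refl eq)
  also have "\<dots> = word_class R (u @ v)"
  proof -
    have "w \<in> word_class R w" for w by (simp add: word_class_def word_eq.refl)
    then have "word_class R w \<noteq> {}" for w by (metis empty_iff)
    then show ?thesis by simp
  qed
  finally show ?thesis by (simp add: presented_group_def)
qed

lemma word_eq_inverse: "word_eq R (rev (map (apsnd Not) w) @ w) []"
proof (induction w)
  case Nil
  show ?case by (simp add: word_eq.refl)
next
  case (Cons x w)
  obtain g e where x: "x = (g, e)" by (cases x)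
  have "word_eq R (rev (map (apsnd Not) w) @ [(g, \<not> e), (g, \<not> \<not> e)] @ w)
                  (rev (map (apsnd Not) w) @ w)"
    by (rule word_eq.cancel)
  from word_eq.trans[OF this Cons.IH] show ?case by (simp add: x)
qed

lemma carrier_presented_group: "carrier (presented_group R) = range (word_class R)"
  and one_presented_group: "\<one>\<^bsub>presented_group R\<^esub> = word_class R []"
  by (simp_all add: presented_group_def)

lemma group_presented_group: "group (presented_group R)"
proof (rule groupI, unfold carrier_presented_group one_presented_group)
  fix x assume "x \<in> range (word_class R)"
  then obtain w where w: "x = word_class R w" by blast
  have "word_class R (rev (map (apsnd Not) w)) \<otimes>\<^bsub>presented_group R\<^esub> x = word_class R []"
    unfolding w word_class_mult word_class_eq_iff by (rule word_eq_inverse)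
  then show "\<exists>y\<in>range (word_class R). y \<otimes>\<^bsub>presented_group R\<^esub> x = word_class R []"
    by blast
next
  fix x y assume "x \<in> range (word_class R)" "y \<in> range (word_class R)"
  then show "x \<otimes>\<^bsub>presented_group R\<^esub> y \<in> range (word_class R)"
    by (elim rangeE) (simp add: word_class_mult)
next
  fix x y z
  assume "x \<in> range (word_class R)" "y \<in> range (word_class R)" "z \<in> range (word_class R)"
  then show "x \<otimes>\<^bsub>presented_group R\<^esub> y \<otimes>\<^bsub>presented_group R\<^esub> z =
             x \<otimes>\<^bsub>presented_group R\<^esub> (y \<otimes>\<^bsub>presented_group R\<^esub> z)"
    by (elim rangeE) (simp add: word_class_mult)
next
  fix x assume "x \<in> range (word_class R)"
  then show "word_class R [] \<otimes>\<^bsub>presented_group R\<^esub> x = x"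
    by (elim rangeE) (simp add: word_class_mult)
qed (rule rangeI)


section \<open>Triangle groups and Seifert groups\<close>

datatype tri_gen = Tx | Ty | Tz

definition triangle_rels :: "nat \<Rightarrow> nat \<Rightarrow> nat \<Rightarrow> (tri_gen word \<times> tri_gen word) set" where
  "triangle_rels a1 a2 a3 =
     {(pow_word Tx (int a1), []), (pow_word Ty (int a2), []), (pow_word Tz (int a3), []),
      (pow_word Tx 1 @ pow_word Ty 1 @ pow_word Tz 1, [])}"

definition triangle_group :: "nat \<Rightarrow> nat \<Rightarrow> nat \<Rightarrow> tri_gen word set monoid" where
  "triangle_group a1 a2 a3 = presented_group (triangle_rels a1 a2 a3)"

definition tri_elem :: "nat \<Rightarrow> nat \<Rightarrow> nat \<Rightarrow> tri_gen \<Rightarrow> tri_gen word set" where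
  "tri_elem a1 a2 a3 g = word_class (triangle_rels a1 a2 a3) (pow_word g 1)"

datatype seif_gen = Sx | Sy | Sz | Sh

text \<open>The integers \<open>(\<beta>, \<beta>\<^sub>1, \<beta>\<^sub>2, \<beta>\<^sub>3)\<close> are passed as one tuple. For \<open>a\<^sub>i \<ge> 1\<close>,
  \<open>seifert_group a\<^sub>1 a\<^sub>2 a\<^sub>3 (\<beta>, \<beta>\<^sub>1, \<beta>\<^sub>2, \<beta>\<^sub>3)\<close> is the fundamental group of the Seifert
  fibered space \<open>M(0; (1,\<beta>), (a\<^sub>1,\<beta>\<^sub>1), (a\<^sub>2,\<beta>\<^sub>2), (a\<^sub>3,\<beta>\<^sub>3))\<close>.\<close>

fun seifert_rels ::
  "nat \<Rightarrow> nat \<Rightarrow> nat \<Rightarrow> int \<times> int \<times> int \<times> int \<Rightarrow> (seif_gen word \<times> seif_gen word) set" where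
  "seifert_rels a1 a2 a3 (\<beta>, \<beta>1, \<beta>2, \<beta>3) =
     {(pow_word g 1 @ pow_word Sh 1, pow_word Sh 1 @ pow_word g 1) | g. True} \<union>
     {(pow_word Sx (int a1), pow_word Sh (- \<beta>1)),
      (pow_word Sy (int a2), pow_word Sh (- \<beta>2)),
      (pow_word Sz (int a3), pow_word Sh (- \<beta>3)),
      (pow_word Sx 1 @ pow_word Sy 1 @ pow_word Sz 1, pow_word Sh \<beta>)}"

definition seifert_group ::
  "nat \<Rightarrow> nat \<Rightarrow> nat \<Rightarrow> int \<times> int \<times> int \<times> int \<Rightarrow> seif_gen word set monoid" where
  "seifert_group a1 a2 a3 B = presented_group (seifert_rels a1 a2 a3 B)"

definition seif_elem ::
  "nat \<Rightarrow> nat \<Rightarrow> nat \<Rightarrow> int \<times> int \<times> int \<times> int \<Rightarrow> seif_gen \<Rightarrow> seif_gen word set" where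
  "seif_elem a1 a2 a3 B g = word_class (seifert_rels a1 a2 a3 B) (pow_word g 1)"

fun seifert_euler_number :: "nat \<Rightarrow> nat \<Rightarrow> nat \<Rightarrow> int \<times> int \<times> int \<times> int \<Rightarrow> rat" where
  "seifert_euler_number a1 a2 a3 (\<beta>, \<beta>1, \<beta>2, \<beta>3) =
     - (of_int \<beta> + of_int \<beta>1 / of_nat a1 + of_int \<beta>2 / of_nat a2 + of_int \<beta>3 / of_nat a3)"

text \<open>The fundamental group of the Brieskorn homology sphere \<open>\<Sigma>(a\<^sub>1,a\<^sub>2,a\<^sub>3)\<close>, in its standard
  presentation. The integers \<open>b, b\<^sub>1, b\<^sub>2, b\<^sub>3\<close> are any choice with
  \<open>a\<^sub>1 a\<^sub>2 a\<^sub>3 (b + b\<^sub>1/a\<^sub>1 + b\<^sub>2/a\<^sub>2 + b\<^sub>3/a\<^sub>3) = 1\<close>.\<close>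

definition brieskorn_data ::
  "nat \<Rightarrow> nat \<Rightarrow> nat \<Rightarrow> int \<times> int \<times> int \<times> int \<Rightarrow> bool" where
  "brieskorn_data a1 a2 a3 = (\<lambda>(b, b1, b2, b3).
     of_nat (a1 * a2 * a3) *
       (of_int b + of_int b1 / of_nat a1 + of_int b2 / of_nat a2 + of_int b3 / of_nat a3)
     = (1 :: rat))"

abbreviation pi1_brieskorn ::
  "nat \<Rightarrow> nat \<Rightarrow> nat \<Rightarrow> int \<times> int \<times> int \<times> int \<Rightarrow> seif_gen word set monoid" where
  "pi1_brieskorn \<equiv> seifert_group"


section \<open>Matrix groups and representations\<close>

definition SL2 :: "('a::field ^ 2 ^ 2) monoid" where
  "SL2 = \<lparr>carrier = {A. det A = 1}, monoid.mult = (**), one = mat 1\<rparr>"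

definition SU2 :: "(complex ^ 2 ^ 2) set" where
  "SU2 = {A. det A = 1 \<and> A ** map_matrix cnj (transpose A) = mat 1}"

definition PSL2R :: "(real ^ 2 ^ 2) set monoid" where
  "PSL2R = SL2 Mod {mat 1, - mat 1}"

definition conjugate_reps ::
  "('g, 'b) monoid_scheme \<Rightarrow> ('g \<Rightarrow> complex ^ 2 ^ 2) \<Rightarrow> ('g \<Rightarrow> complex ^ 2 ^ 2) \<Rightarrow> bool" where
  "conjugate_reps G \<rho> \<sigma> \<longleftrightarrow>
     (\<exists>P\<in>carrier SL2. \<forall>g\<in>carrier G. \<sigma> g = P ** \<rho> g ** matrix_inv P)"

definition irreducible_rep ::
  "('g, 'b) monoid_scheme \<Rightarrow> ('g \<Rightarrow> complex ^ 2 ^ 2) \<Rightarrow> bool" where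
  "irreducible_rep G \<rho> \<longleftrightarrow>
     (\<forall>V. vec.subspace V \<and> (\<forall>g\<in>carrier G. \<forall>v\<in>V. \<rho> g *v v \<in> V) \<longrightarrow> V = {0} \<or> V = UNIV)"


section \<open>The universal cover of PSL(2,R)\<close>

text \<open>The point \<open>t\<close> of \<open>\<real>/\<int> = \<real>P\<^sup>1\<close> is the line spanned by \<open>dir t\<close>. The universal cover of
  \<open>PSL(2,\<real>)\<close> consists of the continuous lifts to \<open>\<real>\<close> of the projective action of matrices in
  \<open>SL(2,\<real>)\<close>. A continuous lift of the action of \<open>A\<close> on lines satisfies
  \<open>A (dir t) = c (dir (g t))\<close> with \<open>c \<noteq> 0\<close> of constant sign, so exactly one of the two matrices
  \<open>A\<close>, \<open>- A\<close> satisfies it with \<open>c > 0\<close>; this is the image of \<open>g\<close> in \<open>SL(2,\<real>)\<close>. In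
  particular \<open>sh 1\<close> is sent to \<open>- I\<close>.\<close>

definition dir :: "real \<Rightarrow> real ^ 2" where
  "dir t = vector [cos (pi * t), sin (pi * t)]"

definition lifts_matrix :: "(real \<Rightarrow> real) \<Rightarrow> real ^ 2 ^ 2 \<Rightarrow> bool" where
  "lifts_matrix g A \<longleftrightarrow> continuous_on UNIV g \<and> (\<forall>t. \<exists>c>0. A *v dir t = c *\<^sub>R dir (g t))"

definition PSL2R_cover :: "(real \<Rightarrow> real) monoid" where
  "PSL2R_cover =
     \<lparr>carrier = {g. \<exists>A\<in>carrier SL2. lifts_matrix g A}, monoid.mult = (\<circ>), one = id\<rparr>"

definition sh :: "real \<Rightarrow> real \<Rightarrow> real" where
  "sh r = (\<lambda>t. t + r)"

definition to_SL2R :: "(real \<Rightarrow> real) \<Rightarrow> real ^ 2 ^ 2" where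
  "to_SL2R g = (THE A. A \<in> carrier SL2 \<and> lifts_matrix g A)"

definition to_PSL2R :: "(real \<Rightarrow> real) \<Rightarrow> (real ^ 2 ^ 2) set" where
  "to_PSL2R g = {mat 1, - mat 1} #>\<^bsub>SL2\<^esub> to_SL2R g"


section \<open>Euler classes\<close>

text \<open>\<open>H\<^sup>2(\<Gamma>(a\<^sub>1,a\<^sub>2,a\<^sub>3); \<int>)\<close> as the abelian group on \<open>x\<^sub>0, x\<^sub>1, x\<^sub>2, x\<^sub>3\<close> with relations
  \<open>a\<^sub>i x\<^sub>i = x\<^sub>0\<close>: the free abelian group on \<open>{0,1,2,3}\<close> modulo the subgroup generated by the
  elements \<open>a\<^sub>i x\<^sub>i - x\<^sub>0\<close>. Its elements are cosets.\<close>

definition H2_rels :: "nat \<Rightarrow> nat \<Rightarrow> nat \<Rightarrow> (nat \<Rightarrow>\<^sub>0 int) set" where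
  "H2_rels a1 a2 a3 = generate (free_Abelian_group {0..3})
     {frag_cmul (int a1) (frag_of 1) - frag_of 0,
      frag_cmul (int a2) (frag_of 2) - frag_of 0,
      frag_cmul (int a3) (frag_of 3) - frag_of 0}"

definition H2 :: "nat \<Rightarrow> nat \<Rightarrow> nat \<Rightarrow> (nat \<Rightarrow>\<^sub>0 int) set monoid" where
  "H2 a1 a2 a3 = free_Abelian_group {0..3} Mod H2_rels a1 a2 a3"

fun H2_class ::
  "nat \<Rightarrow> nat \<Rightarrow> nat \<Rightarrow> int \<times> int \<times> int \<times> int \<Rightarrow> (nat \<Rightarrow>\<^sub>0 int) set" where
  "H2_class a1 a2 a3 (\<beta>, \<beta>1, \<beta>2, \<beta>3) =
     H2_rels a1 a2 a3 #>\<^bsub>free_Abelian_group {0..3}\<^esub>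
       (frag_cmul \<beta> (frag_of 0) + frag_cmul \<beta>1 (frag_of 1) +
        frag_cmul \<beta>2 (frag_of 2) + frag_cmul \<beta>3 (frag_of 3))"

definition E_classes :: "nat \<Rightarrow> nat \<Rightarrow> nat \<Rightarrow> (nat \<Rightarrow>\<^sub>0 int) set set" where
  "E_classes a1 a2 a3 =
     {eu \<in> carrier (H2 a1 a2 a3). \<exists>\<beta> \<beta>1 \<beta>2 \<beta>3.
        eu = H2_class a1 a2 a3 (\<beta>, \<beta>1, \<beta>2, \<beta>3) \<and> \<beta> = -1 \<and>
        0 < \<beta>1 \<and> \<beta>1 < int a1 \<and> 0 < \<beta>2 \<and> \<beta>2 < int a2 \<and> 0 < \<beta>3 \<and> \<beta>3 < int a3 \<and>
        of_int \<beta>1 / of_nat a1 + of_int \<beta>2 / of_nat a2 + of_int \<beta>3 / of_nat a3 < (1 :: rat)}"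

definition pullback_extension ::
  "nat \<Rightarrow> nat \<Rightarrow> nat \<Rightarrow> (tri_gen word set \<Rightarrow> (real ^ 2 ^ 2) set) \<Rightarrow>
   (tri_gen word set \<times> (real \<Rightarrow> real)) monoid" where
  "pullback_extension a1 a2 a3 f =
     (triangle_group a1 a2 a3 \<times>\<times> PSL2R_cover)
       \<lparr>carrier := {(\<gamma>, g). \<gamma> \<in> carrier (triangle_group a1 a2 a3) \<and>
                             g \<in> carrier PSL2R_cover \<and> f \<gamma> = to_PSL2R g}\<rparr>"

text \<open>\<open>\<psi>\<close> identifies the Seifert group with invariants \<open>B = (\<beta>, \<beta>\<^sub>1, \<beta>\<^sub>2, \<beta>\<^sub>3)\<close> with the pull-back
  along \<open>f\<close> of the central extension \<open>0 \<rightarrow> \<int> \<rightarrow> PSL2R_cover \<rightarrow> PSL2R \<rightarrow> 1\<close>, as an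
  extension of the triangle group, with \<open>h\<close> going to \<open>sh 1\<close>. A class is the Euler class of \<open>f\<close>
  iff such a \<open>\<psi>\<close> exists for invariants \<open>B\<close> representing it.\<close>

definition euler_identification ::
  "nat \<Rightarrow> nat \<Rightarrow> nat \<Rightarrow> (tri_gen word set \<Rightarrow> (real ^ 2 ^ 2) set) \<Rightarrow> int \<times> int \<times> int \<times> int \<Rightarrow>
   (seif_gen word set \<Rightarrow> tri_gen word set \<times> (real \<Rightarrow> real)) \<Rightarrow> bool" where
  "euler_identification a1 a2 a3 f B \<psi> \<longleftrightarrow>
     \<psi> \<in> iso (seifert_group a1 a2 a3 B) (pullback_extension a1 a2 a3 f) \<and>
     fst (\<psi> (seif_elem a1 a2 a3 B Sx)) = tri_elem a1 a2 a3 Tx \<and>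
     fst (\<psi> (seif_elem a1 a2 a3 B Sy)) = tri_elem a1 a2 a3 Ty \<and>
     fst (\<psi> (seif_elem a1 a2 a3 B Sz)) = tri_elem a1 a2 a3 Tz \<and>
     \<psi> (seif_elem a1 a2 a3 B Sh) = (\<one>\<^bsub>triangle_group a1 a2 a3\<^esub>, sh 1)"


section \<open>The induced representations\<close>

text \<open>The homomorphism induced by the universal abelian cover of the Seifert fibered space with
  invariants \<open>B\<close>. Its degree \<open>a |e|\<close> is an integer, so the floor only changes its type.\<close>

definition abelian_cover_hom ::
  "nat \<Rightarrow> nat \<Rightarrow> nat \<Rightarrow> int \<times> int \<times> int \<times> int \<Rightarrow> int \<times> int \<times> int \<times> int \<Rightarrow>
   (seif_gen word set \<Rightarrow> seif_gen word set) \<Rightarrow> bool" where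
  "abelian_cover_hom a1 a2 a3 b B p \<longleftrightarrow>
     p \<in> hom (pi1_brieskorn a1 a2 a3 b) (seifert_group a1 a2 a3 B) \<and>
     inj_on p (carrier (pi1_brieskorn a1 a2 a3 b)) \<and>
     p ` carrier (pi1_brieskorn a1 a2 a3 b) =
       derived (seifert_group a1 a2 a3 B) (carrier (seifert_group a1 a2 a3 B)) \<and>
     p (seif_elem a1 a2 a3 b Sh) =
       seif_elem a1 a2 a3 B Sh [^]\<^bsub>seifert_group a1 a2 a3 B\<^esub>
         \<lfloor>of_nat (a1 * a2 * a3) * \<bar>seifert_euler_number a1 a2 a3 B\<bar>\<rfloor>"

text \<open>The representation induced by a class \<open>eu\<close> is only determined up to conjugation (it depends
  on \<open>f\<close> and on base points), hence the relation: \<open>\<rho>\<close> is one of its representatives.\<close>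

definition induced_rep ::
  "nat \<Rightarrow> nat \<Rightarrow> nat \<Rightarrow> int \<times> int \<times> int \<times> int \<Rightarrow> (nat \<Rightarrow>\<^sub>0 int) set \<Rightarrow>
   (seif_gen word set \<Rightarrow> complex ^ 2 ^ 2) \<Rightarrow> bool" where
  "induced_rep a1 a2 a3 b eu \<rho> \<longleftrightarrow>
     (\<exists>B f \<psi> p.
        eu = H2_class a1 a2 a3 B \<and>
        f \<in> hom (triangle_group a1 a2 a3) PSL2R \<and>
        euler_identification a1 a2 a3 f B \<psi> \<and>
        abelian_cover_hom a1 a2 a3 b B p \<and>
        (\<forall>g\<in>carrier (pi1_brieskorn a1 a2 a3 b).
           \<rho> g = map_matrix complex_of_real (to_SL2R (snd (\<psi> (p g))))))"

end

theory Submission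
  imports Defs "HOL-Analysis.Further_Topology"
begin

text \<open>
  Let \<open>\<rho>\<close> be irreducible. By Schur's lemma the fibre \<open>h\<close> acts as \<open>\<plusminus>1\<close>, so the images \<open>X, Y, Z\<close> of
  the generators have finite order modulo the centre and satisfy \<open>X Y Z = \<plusminus>1\<close>. Their traces are
  therefore real, of the form \<open>2 cos (\<pi> m / a\<^sub>i)\<close> (\<open>torsion_trace\<close>). A pair of matrices without a
  common eigenvector is determined up to conjugation by the traces of \<open>X\<close>, \<open>Y\<close> and \<open>X Y\<close>
  (\<open>conj_by_traces\<close>), and if these are real, it is either unitary or the angles satisfy the
  inequality \<open>(sin A sin B)\<^sup>2 < (cos A cos B + cos C)\<^sup>2\<close> (\<open>real_traces_cases\<close>). After changing signs
  this is the condition that the three angles add up to less than \<open>\<pi>\<close> (\<open>sign_normalization\<close>). The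
  angles are then \<open>\<pi> \<beta>\<^sub>i / a\<^sub>i\<close> with \<open>\<beta>\<^sub>1 / a\<^sub>1 + \<beta>\<^sub>2 / a\<^sub>2 + \<beta>\<^sub>3 / a\<^sub>3 < 1\<close>, and the class
  \<open>- x\<^sub>0 + \<beta>\<^sub>1 x\<^sub>1 + \<beta>\<^sub>2 x\<^sub>2 + \<beta>\<^sub>3 x\<^sub>3\<close> is the one that is sought.

  To see that this class induces \<open>\<rho>\<close>, three elements with rotation numbers \<open>- \<beta>\<^sub>i / a\<^sub>i\<close> and product
  \<open>sh (- 1)\<close> are constructed in the universal cover from a hyperbolic triangle
  (\<open>triangle_representation\<close>). They define a homomorphism of the Seifert group of the class, which
  identifies that group with the pull-back of the central extension
  (\<open>euler_identification_exists\<close>). The homomorphism of the abelian cover is written down on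
  generators as \<open>x \<mapsto> x\<^sup>-\<^sup>1 h\<^sup>k\<close>, \<open>y \<mapsto> y\<^sup>-\<^sup>1 h\<^sup>l\<close>, \<open>h \<mapsto> h\<^sup>d\<close>; the inverses are forced since the two Euler
  numbers have opposite signs and \<open>h\<close> goes to a positive power (\<open>abelian_cover_exists\<close>). The
  induced representation has the traces of \<open>\<rho>\<close> up to signs, so a conjugate of it agrees with \<open>\<rho>\<close>
  up to signs. As the fundamental group of a homology sphere is perfect, the signs are trivial
  (\<open>perfect_hom_eqI\<close>).

  Uniqueness has to cope with all possible choices of \<open>f\<close>, \<open>\<psi>\<close> and \<open>p\<close>. An element of the
  universal cover with a shift as a power is conjugate to a shift, so it is enough to know that
  \<open>p\<close> maps \<open>h\<close> to \<open>h\<^sup>d\<close>: an induced representation has traces \<open>2 cos (\<pi> b\<^sub>i d / a\<^sub>i)\<close> at the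
  generators and \<open>2 cos (\<pi> d)\<close> at the fibre (\<open>induced_rep_trace\<close>). These numbers determine the
  \<open>\<beta>\<^sub>i\<close> by congruences modulo \<open>2 a\<^sub>i\<close> and the inequality for their sum (\<open>invariants_determined\<close>).
\<close>

section \<open>Two-by-two matrices\<close>

definition mat22 :: "'a::zero \<Rightarrow> 'a \<Rightarrow> 'a \<Rightarrow> 'a \<Rightarrow> 'a ^ 2 ^ 2" where
  "mat22 a b c d = vector [vector [a, b], vector [c, d]]"

lemma mat22_nth [simp]:
  "mat22 a b c d $ 1 $ 1 = a" "mat22 a b c d $ 1 $ 2 = b"
  "mat22 a b c d $ 2 $ 1 = c" "mat22 a b c d $ 2 $ 2 = d"
  by (simp_all add: mat22_def)

lemma mat22_eq_iff [simp]:
  "mat22 a b c d = mat22 a' b' c' d' \<longleftrightarrow> a = a' \<and> b = b' \<and> c = c' \<and> d = d'"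
  by (auto simp: vec_eq_iff forall_2)

lemma mat22_cases [cases type]:
  obtains a b c d where "A = mat22 a b c d"
proof
  show "A = mat22 (A $ 1 $ 1) (A $ 1 $ 2) (A $ 2 $ 1) (A $ 2 $ 2)"
    by (simp add: vec_eq_iff forall_2)
qed

lemma mat22_mult [simp]:
  fixes a :: "'a::semiring_1"
  shows "mat22 a b c d ** mat22 a' b' c' d' =
    mat22 (a * a' + b * c') (a * b' + b * d') (c * a' + d * c') (c * b' + d * d')"
  by (simp add: matrix_matrix_mult_def vec_eq_iff forall_2 sum_2)

lemma mat22_mult_vec [simp]:
  fixes a :: "'a::semiring_1"
  shows "mat22 a b c d *v vector [x, y] = vector [a * x + b * y, c * x + d * y]"
  by (simp add: matrix_vector_mult_def vec_eq_iff forall_2 sum_2)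

lemma mat22_det [simp]: "det (mat22 a b c d) = a * d - b * c"
  by (simp add: det_2)

lemma mat22_trace [simp]: "trace (mat22 a b c d) = a + d"
  by (simp add: trace_def sum_2)

lemma mat22_one: "mat 1 = mat22 1 0 0 1"
  by (simp add: vec_eq_iff forall_2 mat_def)

lemma mat22_uminus [simp]:
  fixes a :: "'a::group_add"
  shows "- mat22 a b c d = mat22 (- a) (- b) (- c) (- d)"
  by (simp add: vec_eq_iff forall_2)

lemma mat22_map [simp]: "map_matrix f (mat22 a b c d) = mat22 (f a) (f b) (f c) (f d)"
  by (simp add: vec_eq_iff forall_2)

lemma mat22_transpose [simp]: "transpose (mat22 a b c d) = mat22 a c b d"
  by (simp add: vec_eq_iff forall_2 transpose_def)

lemma vec2_cases:
  obtains x y where "v = (vector [x, y] :: 'a::zero ^ 2)"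
proof
  show "v = vector [v $ 1, v $ 2]"
    by (simp add: vec_eq_iff forall_2)
qed

lemma vec2_eq_0_iff: "(vector [x, y] :: 'a::zero ^ 2) = 0 \<longleftrightarrow> x = 0 \<and> y = 0"
  by (simp add: vec_eq_iff forall_2)

lemma vec2_smult: "k *s (vector [x, y] :: 'a::semiring_1 ^ 2) = vector [k * x, k * y]"
  by (simp add: vec_eq_iff forall_2)

lemma matrix_inv_eqI:
  fixes A B :: "'a::field ^ 'n ^ 'n"
  assumes "A ** B = mat 1"
  shows "matrix_inv A = B"
proof -
  have "B ** A = mat 1" using assms matrix_left_right_inverse by blast
  with assms have "\<exists>C. A ** C = mat 1 \<and> C ** A = mat 1" by blast
  from someI_ex[OF this] have "matrix_inv A ** A = mat 1" by (simp add: matrix_inv_def)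
  then have "matrix_inv A ** (A ** B) = B"
    by (simp add: matrix_mul_assoc)
  with assms show ?thesis by simp
qed

lemma mat22_inv:
  fixes a :: "'a::field"
  assumes "a * d - b * c = 1"
  shows "matrix_inv (mat22 a b c d) = mat22 d (- b) (- c) a"
  by (rule matrix_inv_eqI) (use assms in \<open>simp add: mat22_one algebra_simps\<close>)

lemma SL2_simps [simp]:
  "A \<in> carrier SL2 \<longleftrightarrow> det A = 1" "A \<otimes>\<^bsub>SL2\<^esub> B = A ** B" "\<one>\<^bsub>SL2\<^esub> = mat 1"
  by (simp_all add: SL2_def)

lemma SL2_matrix_inv:
  fixes A :: "'a::field ^ 'n ^ 'n"
  assumes "det A = 1"
  shows "A ** matrix_inv A = mat 1" "matrix_inv A ** A = mat 1" "det (matrix_inv A) = 1"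
    "matrix_inv (matrix_inv A) = A"
proof -
  have "invertible A" using assms by (simp add: invertible_det_nz)
  then have "\<exists>B. A ** B = mat 1 \<and> B ** A = mat 1" by (simp add: invertible_def)
  from someI_ex[OF this] show 1: "A ** matrix_inv A = mat 1" "matrix_inv A ** A = mat 1"
    by (simp_all add: matrix_inv_def)
  from arg_cong[OF 1(1), of det] show "det (matrix_inv A) = 1" by (simp add: det_mul assms)
  from 1(2) show "matrix_inv (matrix_inv A) = A" by (rule matrix_inv_eqI)
qed

lemma group_SL2: "group SL2"
proof (rule groupI)
  fix A :: "'a ^ 2 ^ 2" assume "A \<in> carrier SL2"
  then show "\<exists>B\<in>carrier SL2. B \<otimes>\<^bsub>SL2\<^esub> A = \<one>\<^bsub>SL2\<^esub>"
    by (intro bexI[of _ "matrix_inv A"]) (auto simp: SL2_matrix_inv)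
qed (auto simp: det_mul matrix_mul_assoc)

lemma inv_SL2: "det A = 1 \<Longrightarrow> inv\<^bsub>SL2\<^esub> A = matrix_inv A"
  using group.inv_equality[OF group_SL2, of "matrix_inv A" A] by (simp add: SL2_matrix_inv)

lemma mat_neg_one_mult [simp]:
  fixes A :: "'a::ring_1 ^ 'n ^ 'n"
  shows "(- mat 1) ** A = - A" "A ** (- mat 1) = - A"
  by (auto simp: vec_eq_iff matrix_matrix_mult_def mat_def if_distrib[of uminus] if_distribR
      if_distrib[of "\<lambda>x. x * _"] if_distrib[of "\<lambda>x. _ * x"] sum.delta sum.delta' cong: if_cong)

lemma matrix_uminus_mult [simp]:
  fixes A B :: "'a::ring_1 ^ 'n ^ 'n"
  shows "(- A) ** B = - (A ** B)" "A ** (- B) = - (A ** B)"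
  by (auto simp: vec_eq_iff matrix_matrix_mult_def sum_negf)

lemma matrix_vector_uminus_left:
  fixes A :: "'a::ring_1 ^ 'n ^ 'm"
  shows "(- A) *v v = - (A *v v)"
  by (simp add: vec_eq_iff matrix_vector_mult_def sum_negf)

lemma det_uminus_2 [simp]: "det (- A :: 'a::comm_ring_1 ^ 2 ^ 2) = det A"
  by (simp add: det_2)

lemma trace_uminus [simp]: "trace (- A :: 'a::comm_ring_1 ^ 'n ^ 'n) = - trace A"
  by (simp add: trace_def sum_negf)

lemma trace_conj:
  fixes A :: "'a::field ^ 2 ^ 2"
  assumes "det P = 1"
  shows "trace (P ** A ** matrix_inv P) = trace A"
  by (metis SL2_matrix_inv(2) assms matrix_mul_assoc matrix_mul_lid trace_mul_sym)

lemma trace_inv: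
  fixes A :: "'a::field ^ 2 ^ 2"
  assumes "det A = 1"
  shows "trace (matrix_inv A) = trace A"
  using assms by (cases A) (simp add: mat22_inv)

section \<open>Torsion modulo the centre\<close>

lemma complex_eigenvalue:
  fixes t :: complex
  obtains u where "u \<noteq> 0" "t = u + 1 / u"
proof -
  define u where "u = (t + csqrt (t\<^sup>2 - 4)) / 2"
  have "2 * u = t + csqrt (t\<^sup>2 - 4)" by (simp add: u_def)
  then have "(2 * u - t)\<^sup>2 = t\<^sup>2 - 4" by simp
  then have "4 * (u * (t - u)) = 4 * 1" by (simp add: power2_eq_square algebra_simps)
  then have eq: "u * (t - u) = 1" by simp
  then have "u \<noteq> 0" by auto
  moreover from this have "t = u + 1 / u" using eq by (simp add: field_simps)
  ultimately show thesis by (rule that)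
qed

lemma eigenvector_exists:
  fixes A :: "'a::field ^ 2 ^ 2"
  assumes "det A = 1" "trace A = u + 1 / u" "u \<noteq> 0"
  obtains v where "v \<noteq> 0" "A *v v = u *s v"
proof (cases A)
  case (1 a b c d)
  from assms have "(a + d) * u = u * u + 1" by (simp add: 1 field_simps)
  moreover have "a * d - b * c = 1" using assms(1) by (simp add: 1)
  ultimately have char: "(a - u) * (d - u) = b * c"
    by (simp add: algebra_simps)
  have char': "c * b + d * (u - a) = u * (u - a)"
    using char by (simp add: algebra_simps)
  show thesis
  proof (cases "a - u = 0 \<and> b = 0")
    case True
    show thesis
    proof (cases "d - u = 0 \<and> c = 0")
      case True
      with \<open>a - u = 0 \<and> b = 0\<close> show thesis
        by (intro that[of "vector [1, 0]"]) (auto simp: 1 vec2_eq_0_iff vec2_smult)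
    next
      case False
      then show thesis using True
        by (intro that[of "vector [u - d, c]"])
          (auto simp: 1 vec2_eq_0_iff vec2_smult algebra_simps)
    qed
  next
    case False
    have "A *v vector [b, u - a] = u *s vector [b, u - a]"
      using char' by (simp add: 1 vec2_smult) (simp add: algebra_simps)
    with False show thesis
      by (intro that[of "vector [b, u - a]"]) (auto simp: vec2_eq_0_iff)
  qed
qed

lemma eigenvector_pow:
  fixes A :: "'a::field ^ 2 ^ 2"
  assumes "A *v v = u *s v"
  shows "(A [^]\<^bsub>SL2\<^esub> (n::nat)) *v v = u ^ n *s v"
  by (induction n)
    (simp_all add: assms matrix_vector_mul_assoc[symmetric] vector_scalar_commute
      vector_smult_assoc mult.commute)

text \<open>With a double eigenvalue \<open>u = \<plusminus>1\<close>, Cayley--Hamilton makes \<open>N = A - u\<close> square to zero, so the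
  power is \<open>u\<^sup>n + n u\<^sup>n\<^sup>-\<^sup>1 N\<close>. The exponent is a successor only to avoid negative powers of \<open>u\<close>.\<close>

lemma unipotent_pow:
  fixes a :: "'a::field"
  assumes "a * d - b * c = 1" "a + d = 2 * u" "u * u = 1"
  shows "mat22 a b c d [^]\<^bsub>SL2\<^esub> (Suc n) =
    mat22 (u ^ Suc n + of_nat (Suc n) * u ^ n * (a - u)) (of_nat (Suc n) * u ^ n * b)
      (of_nat (Suc n) * u ^ n * c) (u ^ Suc n + of_nat (Suc n) * u ^ n * (d - u))"
proof (induction n)
  case 0
  show ?case by (simp add: mat22_one)
next
  case (Suc n)
  have d: "d = 2 * u - a" using assms(2) by (simp add: algebra_simps)
  have bc: "b * c = - ((a - u) * (a - u))"
    using assms(1,3) unfolding d by (simp add: algebra_simps)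
  have cb: "c * b = - ((a - u) * (a - u))"
    using bc by (simp add: mult.commute)
  define k where "k = (of_nat (Suc n) :: 'a)"
  define w where "w = u ^ n"
  have "mat22 a b c d [^]\<^bsub>SL2\<^esub> Suc (Suc n) = mat22 a b c d [^]\<^bsub>SL2\<^esub> Suc n ** mat22 a b c d"
    by simp
  also have "\<dots> = mat22 (w * u + k * w * (a - u)) (k * w * b)
      (k * w * c) (w * u + k * w * (d - u)) ** mat22 a b c d"
    unfolding Suc k_def w_def by (simp add: mult.commute)
  also have "\<dots> = mat22 (w * u * u + (k + 1) * (w * u) * (a - u)) ((k + 1) * (w * u) * b)
      ((k + 1) * (w * u) * c) (w * u * u + (k + 1) * (w * u) * (d - u))"
  proof -
    have 1: "(w * u + k * w * (a - u)) * a + k * w * (b * c) = w * u * u + (k + 1) * (w * u) * (a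
        - u)"
      unfolding bc by (simp add: algebra_simps)
    have 2: "k * w * (c * b) + (w * u + k * w * (d - u)) * d = w * u * u + (k + 1) * (w * u) * (d
        - u)"
      unfolding cb d by (simp add: algebra_simps)
    show ?thesis using 1 2 by (simp add: d algebra_simps)
  qed
  finally show ?case by (simp add: k_def w_def mult.commute mult.left_commute add.commute)
qed

text \<open>If the two eigenvalues agree, the linearly growing nilpotent part in \<open>unipotent_pow\<close> has to
  vanish, which leaves only \<open>\<plusminus>1\<close>. Otherwise an eigenvalue is a root of unity of order dividing
  \<open>2n\<close>, different from \<open>\<plusminus>1\<close>, and the trace is twice its real part.\<close>

lemma torsion_trace:
  fixes A :: "complex ^ 2 ^ 2"
  assumes det: "det A = 1" and n: "n > 0" and tors: "A [^]\<^bsub>SL2\<^esub> n \<in> {mat 1, - mat 1}"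
    and nontriv: "A \<noteq> mat 1" "A \<noteq> - mat 1"
  obtains m where "0 < m" "m < n" "trace A = of_real (2 * cos (pi * real m / real n))"
proof -
  obtain u where u: "u \<noteq> 0" "trace A = u + 1 / u" by (rule complex_eigenvalue)
  obtain n' where n': "n = Suc n'" using n by (cases n) auto
  have u1: "u * u \<noteq> 1"
  proof
    assume uu: "u * u = 1"
    obtain a b c d where A: "A = mat22 a b c d" by (rule mat22_cases)
    have "1 / u = u" using u(1) uu by (simp add: field_simps)
    then have tr: "a + d = 2 * u" using u(2) by (simp add: A)
    have ad: "a * d - b * c = 1" using det by (simp add: A)
    obtain e where "mat22 a b c d [^]\<^bsub>SL2\<^esub> Suc n' = mat22 e 0 0 e"
      using tors unfolding A n' mat22_one mat22_uminus minus_zero by blast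
    note e = this[unfolded unipotent_pow[OF ad tr uu] mat22_eq_iff]
    have "of_nat n * u ^ n' * (a - u) = of_nat n * u ^ n' * (d - u)"
      using e n' by (metis add_left_cancel)
    with e have "of_nat n * u ^ n' * b = 0 \<and> of_nat n * u ^ n' * c = 0 \<and>
        of_nat n * u ^ n' * (a - u) = of_nat n * u ^ n' * (d - u)"
      unfolding n' by blast
    then have "b = 0" "c = 0" "a = d" using n u by auto
    then have "a = u" "d = u" using tr by auto
    moreover have "u = 1 \<or> u = -1" using uu by (simp add: square_eq_1_iff)
    ultimately show False using nontriv \<open>b = 0\<close> \<open>c = 0\<close> by (auto simp: A mat22_one)
  qed
  obtain v where v: "v \<noteq> 0" "A *v v = u *s v"
    using eigenvector_exists[OF det u(2,1)] by metis
  have "u ^ n *s v = v \<or> u ^ n *s v = - v"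
    using eigenvector_pow[OF v(2), of n] tors by (auto simp: matrix_vector_uminus_left)
  then have "u ^ n = 1 \<or> u ^ n = -1"
    using v(1) by (metis vector_mul_rcancel vector_sneg_minus1 vector_smult_lid)
  then have u2n: "u ^ (2 * n) = 1" by (auto simp: power_mult power2_eq_square mult.commute[of 2])
  have "cmod u ^ (2 * n) = 1" using u2n by (metis norm_one norm_power)
  then have nu: "cmod u = 1" using n power_eq_imp_eq_base[of "cmod u" "2 * n" 1] by simp
  define \<alpha> where "\<alpha> = arccos (Re u)"
  have Re: "\<bar>Re u\<bar> \<le> 1" using abs_Re_le_cmod[of u] nu by simp
  have \<alpha>: "0 \<le> \<alpha>" "\<alpha> \<le> pi" "cos \<alpha> = Re u"
    using Re by (auto simp: \<alpha>_def arccos_lbound arccos_ubound)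
  have "(Re u)\<^sup>2 + (Im u)\<^sup>2 = 1" using nu by (metis cmod_power2 one_power2)
  then have "(sin \<alpha>)\<^sup>2 = (Im u)\<^sup>2" using \<alpha>(3) sin_cos_squared_add[of \<alpha>] by simp
  then have "Im u = sin \<alpha> \<or> Im u = - sin \<alpha>" by (auto simp: power2_eq_iff)
  then have ucis: "u = cis \<alpha> \<or> u = cis (- \<alpha>)" using \<alpha>(3) by (auto simp: complex_eq_iff)
  then have "cis (real (2 * n) * \<alpha>) = 1 \<or> cis (real (2 * n) * (- \<alpha>)) = 1"
    unfolding Complex.DeMoivre[symmetric] using ucis u2n by blast
  then have "cos (real (2 * n) * \<alpha>) = 1"
    by (auto simp only: complex_eq_iff cis.sel cos_minus mult_minus_right one_complex.sel)
  then obtain j :: int where "real (2 * n) * \<alpha> = of_int j * 2 * pi"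
    using cos_one_2pi_int by blast
  then have j: "\<alpha> = pi * of_int j / real n" using n by (simp add: field_simps)
  have "j \<ge> 0"
    using \<alpha>(1) n pi_gt_zero unfolding j by (auto simp: zero_le_divide_iff zero_le_mult_iff)
  moreover have "j \<le> n"
    using \<alpha>(2) n unfolding j by (simp add: field_simps)
  moreover have "j \<noteq> 0"
  proof
    assume "j = 0" then show False using u1 ucis j by simp
  qed
  moreover have "j \<noteq> int n"
  proof
    assume "j = int n" then have "\<alpha> = pi" using j n by simp
    then show False using u1 ucis by (auto simp: cis.ctr complex_eq_iff)
  qed
  moreover have "trace A = of_real (2 * cos \<alpha>)"
    using ucis unfolding u(2) by (auto simp: complex_eq_iff Re_divide Im_divide)
  ultimately show thesis using that[of "nat j"] by (simp add: j nat_less_iff)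
qed

section \<open>Pairs of matrices and their traces\<close>

lemma eigenbasis:
  fixes X :: "'a::field ^ 2 ^ 2"
  assumes "det X = 1" "trace X = u + 1 / u" "u \<noteq> 0" "u * u \<noteq> 1"
  obtains S where "det S \<noteq> 0" "X ** S = S ** mat22 u 0 0 (1 / u)"
proof -
  obtain v where v: "v \<noteq> 0" "X *v v = u *s v" using eigenvector_exists[OF assms(1-3)] by metis
  obtain w where w: "w \<noteq> 0" "X *v w = (1 / u) *s w"
    using eigenvector_exists[OF assms(1), of "1 / u"] assms(2,3) by (auto simp: add.commute)
  obtain v1 v2 w1 w2 where vw: "v = vector [v1, v2]" "w = vector [w1, w2]"
    by (metis vec2_cases)
  obtain a b c d where X: "X = mat22 a b c d" by (rule mat22_cases)
  have ev: "a * v1 + b * v2 = u * v1" "c * v1 + d * v2 = u * v2"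
    using v(2) by (auto simp: X vw vec2_smult vec_eq_iff forall_2)
  have ew: "a * w1 + b * w2 = w1 / u" "c * w1 + d * w2 = w2 / u"
    using w(2) by (auto simp: X vw vec2_smult vec_eq_iff forall_2)
  define S where "S = mat22 v1 w1 v2 w2"
  have "X ** S = S ** mat22 u 0 0 (1 / u)"
    using ev ew by (simp add: X S_def mult.commute)
  moreover have "v1 * w2 - w1 * v2 \<noteq> 0"
  proof
    assume eq: "v1 * w2 - w1 * v2 = 0"
    \<comment> \<open>Parallel eigenvectors force the two eigenvalues to agree.\<close>
    obtain l where l: "w = l *s v"
    proof (cases "v1 = 0")
      case True
      then have "v2 \<noteq> 0" "w1 = 0" using eq v(1) by (auto simp: vw vec2_eq_0_iff)
      with True show thesis by (intro that[of "w2 / v2"]) (simp add: vw vec2_smult)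
    next
      case False
      then show thesis using eq
        by (intro that[of "w1 / v1"]) (simp add: vw vec2_smult vec_eq_iff forall_2 field_simps)
    qed
    have "X *v (l *s v) = u *s (l *s v)"
      by (simp add: vector_scalar_commute v(2) mult.commute)
    then have "(1 / u) *s w = u *s w" by (metis l w(2))
    then have "1 / u = u" using w(1) by (simp add: vector_mul_rcancel)
    then show False using assms(3,4) by (simp add: field_simps)
  qed
  ultimately show thesis by (intro that[of S]) (simp_all add: S_def)
qed

text \<open>In an eigenbasis of \<open>X\<close> the diagonal \<open>(p, s)\<close> of \<open>Y\<close> solves the linear system given by the
  two traces \<open>p + s\<close> and \<open>u p + s / u\<close>, which is regular because \<open>u\<close> and \<open>1 / u\<close> differ. The
  determinant then fixes the product of the two other entries.\<close>

lemma normal_form: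
  fixes X Y :: "'a::field ^ 2 ^ 2"
  assumes "det X = 1" "trace X = u + 1 / u" "u \<noteq> 0" "u * u \<noteq> 1"
    and "det Y = 1" "trace Y = p + s" "trace (X ** Y) = u * p + s / u"
  obtains S q r where "det S \<noteq> 0" "X ** S = S ** mat22 u 0 0 (1 / u)"
    "Y ** S = S ** mat22 p q r s" "q * r = p * s - 1"
proof -
  obtain S where S: "det S \<noteq> 0" "X ** S = S ** mat22 u 0 0 (1 / u)"
    using eigenbasis[OF assms(1-4)] by metis
  have "invertible S" using S(1) by (simp add: invertible_det_nz)
  then obtain T where T: "S ** T = mat 1" "T ** S = mat 1" unfolding invertible_def by blast
  define M where "M = T ** Y ** S"
  have YS: "Y ** S = S ** M" by (simp add: M_def matrix_mul_assoc T)
  obtain p' q r s' where M: "M = mat22 p' q r s'" by (rule mat22_cases)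
  have "det T * det S = 1" using arg_cong[OF T(2), of det] by (simp add: det_mul)
  then have "det M = 1" by (simp add: M_def det_mul assms(5) mult.commute)
  have "trace M = trace Y"
    by (metis M_def T(1) matrix_mul_assoc matrix_mul_rid trace_mul_sym)
  then have 1: "p' + s' = p + s" by (simp add: M assms(6))
  have "X ** Y ** S = S ** (mat22 u 0 0 (1 / u) ** M)"
    by (metis S(2) YS matrix_mul_assoc)
  then have "T ** (X ** Y) ** S = mat22 u 0 0 (1 / u) ** M"
    by (metis T(2) matrix_mul_assoc matrix_mul_lid)
  then have "trace (X ** Y) = trace (mat22 u 0 0 (1 / u) ** M)"
    by (metis T(1) matrix_mul_assoc matrix_mul_rid trace_mul_sym)
  then have "u * p' + s' / u = u * p + s / u" by (simp add: M assms(7))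
  then have "u * u * (p' - p) + (s' - s) = 0" using assms(3) by (simp add: field_simps)
  moreover have s': "s' - s = - (p' - p)" using 1 by (simp add: algebra_simps)
  ultimately have "(u * u - 1) * (p' - p) = 0" by (simp add: algebra_simps)
  then have "p' = p" using assms(4) by simp
  moreover from this have "s' = s" using s' by simp
  ultimately show thesis using \<open>det M = 1\<close> S YS
    by (intro that[of S q r]) (auto simp: M algebra_simps)
qed

text \<open>The eigenvectors of \<open>X\<close> can still be scaled: one scaling makes the upper right entry of \<open>Y\<close>
  equal to \<open>1\<close> and the other one makes the base change unimodular. The condition \<open>p s \<noteq> 1\<close> says
  that neither off-diagonal entry is zero.\<close>

lemma normal_form_SL2:
  fixes X Y :: "complex ^ 2 ^ 2"
  assumes "det X = 1" "trace X = u + 1 / u" "u \<noteq> 0" "u * u \<noteq> 1"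
    and "det Y = 1" "trace Y = p + s" "trace (X ** Y) = u * p + s / u" "p * s \<noteq> 1"
  obtains S where "det S = 1" "X ** S = S ** mat22 u 0 0 (1 / u)"
    "Y ** S = S ** mat22 p 1 (p * s - 1) s"
proof -
  obtain S q r where S: "det S \<noteq> 0" "X ** S = S ** mat22 u 0 0 (1 / u)"
    "Y ** S = S ** mat22 p q r s" and qr: "q * r = p * s - 1"
    using normal_form[OF assms(1-7)] by metis
  have q: "q \<noteq> 0" using qr assms(8) by auto
  define \<delta> where "\<delta> = csqrt (1 / (q * det S))"
  have \<delta>: "\<delta> * \<delta> * q * det S = 1"
    using q S(1) by (simp add: \<delta>_def flip: power2_eq_square)
  define D where "D = mat22 (q * \<delta>) 0 0 \<delta>"
  have D: "mat22 u 0 0 (1 / u) ** D = D ** mat22 u 0 0 (1 / u)"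
    "mat22 p q r s ** D = D ** mat22 p 1 (p * s - 1) s"
    unfolding D_def by (auto simp: qr[symmetric])
  have "det (S ** D) = 1" using \<delta> by (simp add: det_mul D_def mult.commute mult.left_commute)
  moreover have "X ** (S ** D) = S ** D ** mat22 u 0 0 (1 / u)"
    by (metis S(2) D(1) matrix_mul_assoc)
  moreover have "Y ** (S ** D) = S ** D ** mat22 p 1 (p * s - 1) s"
    by (metis S(3) D(2) matrix_mul_assoc)
  ultimately show thesis by (rule that)
qed

lemma conj_eqI:
  fixes P :: "'a::field ^ 'n ^ 'n"
  assumes "det P = 1" "X' ** P = P ** X"
  shows "X' = P ** X ** matrix_inv P"
  by (metis SL2_matrix_inv(1) assms matrix_mul_assoc matrix_mul_rid)

text \<open>The normal form depends on the traces only, so two such pairs are conjugate through it.\<close>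

lemma conj_by_traces:
  fixes X Y X' Y' :: "complex ^ 2 ^ 2"
  assumes "u \<noteq> 0" "u * u \<noteq> 1" "p * s \<noteq> 1"
    and "det X = 1" "trace X = u + 1 / u"
    and "det Y = 1" "trace Y = p + s" "trace (X ** Y) = u * p + s / u"
    and "det X' = 1" "trace X' = u + 1 / u"
    and "det Y' = 1" "trace Y' = p + s" "trace (X' ** Y') = u * p + s / u"
  obtains P where "det P = 1" "X' = P ** X ** matrix_inv P" "Y' = P ** Y ** matrix_inv P"
proof -
  obtain S where S: "det S = 1" "X ** S = S ** mat22 u 0 0 (1 / u)"
    "Y ** S = S ** mat22 p 1 (p * s - 1) s"
    using normal_form_SL2[of X u Y p s] assms by metis
  obtain S' where S': "det S' = 1" "X' ** S' = S' ** mat22 u 0 0 (1 / u)"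
    "Y' ** S' = S' ** mat22 p 1 (p * s - 1) s"
    using normal_form_SL2[of X' u Y' p s] assms by metis
  note inv = SL2_matrix_inv[OF S(1)]
  define P where "P = S' ** matrix_inv S"
  have P: "det P = 1" by (simp add: P_def det_mul S' inv)
  have swap: "Z' ** P = P ** Z" if "Z ** S = S ** N" "Z' ** S' = S' ** N" for Z Z' N
  proof -
    have "matrix_inv S ** Z = N ** matrix_inv S"
      by (metis that(1) inv(1,2) matrix_mul_assoc matrix_mul_lid matrix_mul_rid)
    then show ?thesis unfolding P_def by (metis that(2) matrix_mul_assoc)
  qed
  from conj_eqI[OF P swap[OF S(2) S'(2)]] conj_eqI[OF P swap[OF S(3) S'(3)]] P
  show thesis by (intro that)
qed

text \<open>For \<open>p s = 1\<close> one off-diagonal entry of the normal form is zero, so one of the eigenvectors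
  of \<open>X\<close> is an eigenvector of \<open>Y\<close>.\<close>

lemma common_eigenvector:
  fixes X Y :: "'a::field ^ 2 ^ 2"
  assumes "det X = 1" "trace X = u + 1 / u" "u \<noteq> 0" "u * u \<noteq> 1"
    and "det Y = 1" "trace Y = p + s" "trace (X ** Y) = u * p + s / u" "p * s = 1"
  obtains v \<kappa> \<mu> where "v \<noteq> 0" "X *v v = \<kappa> *s v" "Y *v v = \<mu> *s v"
proof -
  obtain S q r where S: "det S \<noteq> 0" "X ** S = S ** mat22 u 0 0 (1 / u)"
    "Y ** S = S ** mat22 p q r s" and qr: "q * r = 0"
    using normal_form[OF assms(1-7)] assms(8) by (metis diff_self)
  have nz: "S *v e \<noteq> 0" if "e \<noteq> 0" for e
  proof
    assume "S *v e = 0"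
    moreover have "invertible S" using S(1) by (simp add: invertible_det_nz)
    ultimately show False using that by (metis invertible_def matrix_vector_mul_assoc
        matrix_vector_mul_lid matrix_vector_mult_0_right)
  qed
  have push: "Z *v (S *v e) = k *s (S *v e)" if "Z ** S = S ** N" "N *v e = k *s e" for Z N e k
    by (metis that matrix_vector_mul_assoc vector_scalar_commute)
  show thesis
  proof (cases "r = 0")
    case True
    show thesis
    proof (rule that)
      show "S *v vector [1, 0] \<noteq> 0" by (rule nz) (simp add: vec2_eq_0_iff)
      show "X *v (S *v vector [1, 0]) = u *s (S *v vector [1, 0])"
        by (rule push[OF S(2)]) (simp add: vec2_smult)
      show "Y *v (S *v vector [1, 0]) = p *s (S *v vector [1, 0])"
        by (rule push[OF S(3)]) (simp add: vec2_smult True)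
    qed
  next
    case False
    then have "q = 0" using qr by simp
    show thesis
    proof (rule that)
      show "S *v vector [0, 1] \<noteq> 0" by (rule nz) (simp add: vec2_eq_0_iff)
      show "X *v (S *v vector [0, 1]) = (1 / u) *s (S *v vector [0, 1])"
        by (rule push[OF S(2)]) (simp add: vec2_smult)
      show "Y *v (S *v vector [0, 1]) = s *s (S *v vector [0, 1])"
        by (rule push[OF S(3)]) (simp add: vec2_smult \<open>q = 0\<close>)
    qed
  qed
qed

section \<open>Pairs of elliptic matrices with real traces\<close>

text \<open>This is the inequality that makes a hyperbolic triangle with angles \<open>A, B, C\<close> possible: by
  the cosine law, \<open>(cos A cos B + cos C) / (sin A sin B)\<close> is the hyperbolic cosine of a side.\<close>

lemma angle_sum_less_pi:
  fixes A B C :: real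
  assumes "0 \<le> A + B" "0 \<le> C" "A + B + C < pi"
  shows "sin A * sin B < cos A * cos B + cos C"
proof -
  have "cos (pi - (A + B)) < cos C" using assms by (intro cos_monotone_0_pi) simp_all
  then show ?thesis by (simp add: cos_add cos_diff)
qed

text \<open>The converse of the preceding lemma, up to replacing two of the three angles by their
  supplements. By the addition formulas the hypothesis compares \<open>cos C\<close> with the cosine of
  \<open>\<pi> - (A + B)\<close> or of \<open>\<pi> - (A - B)\<close>, and monotonicity of the cosine turns this into an inequality
  between the angles.\<close>

lemma cosine_region:
  fixes A B C :: real
  assumes "0 < A" "A < pi" "0 < B" "B < pi" "0 < C" "C < pi"
    and "(sin A * sin B)\<^sup>2 < (cos A * cos B + cos C)\<^sup>2"
  shows "A + B + C < pi \<or> (pi - A) + (pi - B) + C < pi \<or>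
    (pi - A) + B + (pi - C) < pi \<or> A + (pi - B) + (pi - C) < pi"
proof -
  have "sin A > 0" "sin B > 0" using assms by (auto intro: sin_gt_zero)
  then have pos: "sin A * sin B > 0" by simp
  have less: "x < y" if "cos y < cos x" "0 \<le> x" "x \<le> pi" "0 \<le> y" "y \<le> pi" for x y :: real
    using that by (simp add: cos_mono_less_eq)
  have "sin A * sin B < \<bar>cos A * cos B + cos C\<bar>"
    by (rule power2_less_imp_less) (use assms(7) in simp_all)
  then consider "sin A * sin B < cos A * cos B + cos C" |
      "cos A * cos B + cos C < - (sin A * sin B)"
    by linarith
  then show ?thesis
  proof cases
    case 1
    then have gt: "cos (pi - (A + B)) < cos C" "cos (A + B - pi) < cos C"
      by (simp_all add: cos_add cos_diff)
    show ?thesis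
    proof (cases "A + B \<le> pi")
      case True
      with less[OF gt(1)] assms show ?thesis by simp
    next
      case False
      with less[OF gt(2)] assms show ?thesis by simp
    qed
  next
    case 2
    then have gt: "cos C < cos (pi - (A - B))" "cos C < cos (pi - (B - A))"
      by (simp_all add: cos_diff algebra_simps)
    show ?thesis
    proof (cases "B \<le> A")
      case True
      with less[OF gt(1)] assms show ?thesis by simp
    next
      case False
      with less[OF gt(2)] assms show ?thesis by simp
    qed
  qed
qed

text \<open>The upper left entry of \<open>Y\<close> in an eigenbasis of \<open>X\<close>, if the traces of \<open>X\<close>, \<open>Y\<close> and \<open>X Y\<close> are
  \<open>2 cos A\<close>, \<open>2 cos B\<close> and \<open>- 2 cos C\<close>; the lower right entry is its conjugate.\<close>

definition diag_entry :: "real \<Rightarrow> real \<Rightarrow> real \<Rightarrow> complex" where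
  "diag_entry A B C = Complex (cos B) ((cos A * cos B + cos C) / sin A)"

lemma cis_eigenvalue:
  assumes "sin A \<noteq> 0"
  shows "cis A \<noteq> 0" "cis A * cis A \<noteq> 1" "complex_of_real (2 * cos A) = cis A + 1 / cis A"
proof -
  show "cis A \<noteq> 0" by simp
  show "cis A * cis A \<noteq> 1"
  proof
    assume eq: "cis A * cis A = 1"
    then have "cis A = 1 \<or> cis A = -1" by (simp add: square_eq_1_iff)
    then have "Im (cis A) = 0"
      by (auto simp: complex_eq_iff)
    then show False using assms by simp
  qed
  show "complex_of_real (2 * cos A) = cis A + 1 / cis A"
    by (simp add: divide_inverse cis_cnj complex_eq_iff)
qed

lemma diag_entry:
  assumes "sin A \<noteq> 0"
  shows "complex_of_real (2 * cos B) = diag_entry A B C + cnj (diag_entry A B C)"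
    and "complex_of_real (- 2 * cos C) = cis A * diag_entry A B C + cnj (diag_entry A B C) / cis A"
    and "diag_entry A B C * cnj (diag_entry A B C) =
      of_real (1 + ((cos A * cos B + cos C)\<^sup>2 - (sin A * sin B)\<^sup>2) / (sin A)\<^sup>2)"
proof -
  have div: "z / cis A = z * cnj (cis A)" for z by (simp add: divide_inverse cis_cnj)
  show "complex_of_real (2 * cos B) = diag_entry A B C + cnj (diag_entry A B C)"
    by (simp add: complex_eq_iff diag_entry_def)
  show "complex_of_real (- 2 * cos C) = cis A * diag_entry A B C + cnj (diag_entry A B C) / cis A"
    unfolding div using assms by (simp add: complex_eq_iff diag_entry_def field_simps)
  have "(cos B)\<^sup>2 = 1 - (sin B)\<^sup>2" by (simp add: cos_squared_eq)
  then show "diag_entry A B C * cnj (diag_entry A B C) =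
      of_real (1 + ((cos A * cos B + cos C)\<^sup>2 - (sin A * sin B)\<^sup>2) / (sin A)\<^sup>2)"
    unfolding complex_mult_cnj using assms
    by (simp add: diag_entry_def power_divide power_mult_distrib diff_divide_distrib)
qed

text \<open>In the normal form over an eigenbasis of \<open>X\<close> the diagonal of \<open>Y\<close> is \<open>p\<close> and its conjugate,
  so the product of the off-diagonal entries is the real number \<open>|p|\<^sup>2 - 1\<close>. If it is zero, there
  is a common eigenvector. If it is negative, the entries can be chosen as \<open>q\<close> and \<open>- q\<close> with \<open>q\<close>
  real, which gives a unitary pair with the same traces. Only the positive case remains.\<close>

lemma real_traces_cases:
  fixes X Y :: "complex ^ 2 ^ 2" and A B C :: real
  assumes "0 < A" "A < pi" "0 < B" "B < pi" "0 < C" "C < pi"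
    and X: "det X = 1" "trace X = of_real (2 * cos A)"
    and Y: "det Y = 1" "trace Y = of_real (2 * cos B)"
    and XY: "trace (X ** Y) = of_real (- 2 * cos C)"
  shows "(\<exists>v \<kappa> \<mu>. v \<noteq> 0 \<and> X *v v = \<kappa> *s v \<and> Y *v v = \<mu> *s v) \<or>
    (\<exists>P. det P = 1 \<and> P ** X ** matrix_inv P \<in> SU2 \<and> P ** Y ** matrix_inv P \<in> SU2) \<or>
    (sin A * sin B)\<^sup>2 < (cos A * cos B + cos C)\<^sup>2"
proof -
  define u where "u = cis A"
  define p where "p = diag_entry A B C"
  define K where "K = (cos A * cos B + cos C)\<^sup>2 - (sin A * sin B)\<^sup>2"
  have sA: "sin A > 0" using assms by (intro sin_gt_zero)
  then have "sin A \<noteq> 0" by simp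
  note tp = cis_eigenvalue[OF this, folded u_def]
    diag_entry[OF this, where B = B and C = C, folded u_def p_def K_def]
  consider "K = 0" | "K < 0" | "K > 0" by linarith
  then show ?thesis
  proof cases
    case 1
    obtain v \<kappa> \<mu> where "v \<noteq> 0" "X *v v = \<kappa> *s v" "Y *v v = \<mu> *s v"
    proof (rule common_eigenvector[of X u Y p "cnj p"])
      show "p * cnj p = 1" using tp(6) 1 by simp
    qed (use X Y XY tp in simp_all)
    then show ?thesis by blast
  next
    case 2
    then have "K / (sin A)\<^sup>2 < 0" using sA by (simp add: divide_neg_pos)
    then have lt: "1 + K / (sin A)\<^sup>2 < 1" by simp
    define q where "q = sqrt (1 - (1 + K / (sin A)\<^sup>2))"
    have qq: "q * q = 1 - (1 + K / (sin A)\<^sup>2)"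
      unfolding q_def real_sqrt_mult_self using lt by (intro abs_of_nonneg) simp
    have "complex_of_real (1 + K / (sin A)\<^sup>2 + q * q) = 1" unfolding qq by simp
    then have det: "p * cnj p + of_real q * of_real q = 1"
      unfolding tp(6) of_real_mult[symmetric] of_real_add[symmetric] .
    have uu: "u * cnj u = 1" by (simp add: u_def cis_cnj cis_mult)
    then have inv: "1 / u = cnj u" using tp(1) by (simp add: field_simps)
    have div: "cnj u * cnj p = cnj p / u" unfolding inv[symmetric] by simp
    define X' where "X' = mat22 u 0 0 (cnj u)"
    define Y' where "Y' = mat22 p (of_real q) (- of_real q) (cnj p)"
    have "X' \<in> SU2" using uu by (simp add: SU2_def X'_def mat22_one mult.commute)
    moreover have "Y' \<in> SU2" using det by (simp add: SU2_def Y'_def mat22_one mult.commute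
        add.commute)
    moreover obtain P where "det P = 1" "X' = P ** X ** matrix_inv P" "Y' = P ** Y ** matrix_inv P"
    proof (rule conj_by_traces[of u p "cnj p" X Y X' Y'])
      show "p * cnj p \<noteq> 1"
      proof
        assume "p * cnj p = 1"
        then have "1 + K / (sin A)\<^sup>2 = 1" unfolding tp(6) by (metis of_real_eq_1_iff)
        with lt show False by simp
      qed
    qed (use X Y XY tp det uu inv div in \<open>simp_all add: X'_def Y'_def\<close>)
    ultimately show ?thesis by blast
  next
    case 3
    then show ?thesis by (simp add: K_def)
  qed
qed

lemma conj_by_real_traces:
  fixes X Y X' Y' :: "complex ^ 2 ^ 2"
  assumes "sin A \<noteq> 0" "(sin A * sin B)\<^sup>2 < (cos A * cos B + cos C)\<^sup>2"
    and X: "det X = 1" "trace X = of_real (2 * cos A)"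
    and Y: "det Y = 1" "trace Y = of_real (2 * cos B)" "trace (X ** Y) = of_real (- 2 * cos C)"
    and X': "det X' = 1" "trace X' = of_real (2 * cos A)"
    and Y': "det Y' = 1" "trace Y' = of_real (2 * cos B)" "trace (X' ** Y') = of_real (- 2 * cos C)"
  obtains P where "det P = 1" "X' = P ** X ** matrix_inv P" "Y' = P ** Y ** matrix_inv P"
proof -
  note tp = cis_eigenvalue[OF assms(1)] diag_entry[OF assms(1), where B = B and C = C]
  have "((cos A * cos B + cos C)\<^sup>2 - (sin A * sin B)\<^sup>2) / (sin A)\<^sup>2 > 0"
    using assms(1,2) by simp
  then have "diag_entry A B C * cnj (diag_entry A B C) \<noteq> 1"
    unfolding tp(6) of_real_eq_1_iff by linarith
  from conj_by_traces[OF tp(1,2) this] X Y X' Y' tp(3-5) that show thesis by metis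
qed

section \<open>Lifts of projective transformations to the line\<close>

lemma dir_nth: "dir t $ 1 = cos (pi * t)" "dir t $ 2 = sin (pi * t)"
  by (simp_all add: dir_def)

lemma dir_nonzero: "dir t \<noteq> 0"
proof
  assume "dir t = 0"
  then have "cos (pi * t) = 0" "sin (pi * t) = 0" by (metis dir_nth zero_index)+
  then show False using sin_cos_squared_add[of "pi * t"] by simp
qed

lemma dir_eq_pos:
  assumes "c > 0" "c' > 0" "c *\<^sub>R dir s = c' *\<^sub>R dir t"
  obtains m :: int where "s = t + 2 * of_int m"
proof -
  have cs: "c * cos (pi * s) = c' * cos (pi * t)" "c * sin (pi * s) = c' * sin (pi * t)"
    using arg_cong[OF assms(3), of "\<lambda>v. v $ 1"] arg_cong[OF assms(3), of "\<lambda>v. v $ 2"]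
    by (simp_all add: dir_nth)
  have sq: "(a * cos x)\<^sup>2 + (a * sin x)\<^sup>2 = a\<^sup>2" for a x :: real
    by (simp add: power_mult_distrib flip: distrib_left)
  have "c\<^sup>2 = c'\<^sup>2" using sq[of c "pi * s"] sq[of c' "pi * t"] cs by simp
  then have "c = c'" using assms(1,2) by (simp add: power2_eq_iff_nonneg)
  then have "sin (pi * s) = sin (pi * t) \<and> cos (pi * s) = cos (pi * t)"
    using cs assms(1) by simp
  then obtain m :: int where "pi * s = pi * t + 2 * pi * of_int m"
    by (metis sin_cos_eq_iff)
  then have "pi * s = pi * (t + 2 * of_int m)" by (simp add: algebra_simps)
  then show thesis using that by simp
qed

abbreviation rot :: "real \<Rightarrow> real ^ 2 ^ 2" where
  "rot \<theta> \<equiv> mat22 (cos \<theta>) (- sin \<theta>) (sin \<theta>) (cos \<theta>)"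

lemma det_rot: "det (rot \<theta>) = 1"
  by (simp flip: power2_eq_square)

lemma lifts_sh: "lifts_matrix (sh r) (rot (pi * r))"
  unfolding lifts_matrix_def
proof (intro conjI allI exI)
  show "continuous_on UNIV (sh r)" unfolding sh_def by (intro continuous_intros)
  fix t
  show "rot (pi * r) *v dir t = 1 *\<^sub>R dir (sh r t)"
    by (simp add: dir_def sh_def distrib_left cos_add sin_add algebra_simps)
qed simp

lemma lifts_comp:
  assumes "lifts_matrix g A" "lifts_matrix h B"
  shows "lifts_matrix (g \<circ> h) (A ** B)"
  unfolding lifts_matrix_def
proof (intro conjI allI)
  show "continuous_on UNIV (g \<circ> h)"
    using assms by (metis lifts_matrix_def continuous_on_compose continuous_on_subset subset_UNIV)
  fix t
  obtain c where c: "c > 0" "B *v dir t = c *\<^sub>R dir (h t)"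
    using assms(2) by (auto simp: lifts_matrix_def)
  obtain c' where c': "c' > 0" "A *v dir (h t) = c' *\<^sub>R dir (g (h t))"
    using assms(1) by (auto simp: lifts_matrix_def)
  have "(A ** B) *v dir t = A *v (c *\<^sub>R dir (h t))"
    by (simp only: c(2) flip: matrix_vector_mul_assoc)
  also have "\<dots> = (c * c') *\<^sub>R dir ((g \<circ> h) t)"
    by (simp only: matrix_vector_mult_scaleR c'(2) scaleR_scaleR o_def)
  finally show "\<exists>c>0. (A ** B) *v dir t = c *\<^sub>R dir ((g \<circ> h) t)"
    using c(1) c'(1) by (intro exI[of _ "c * c'"]) simp
qed

text \<open>The curve \<open>t \<mapsto> A (dir t)\<close> avoids the origin of the plane, so it has a continuous logarithm;
  its imaginary part is the lift.\<close>

lemma lifts_exists: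
  fixes A :: "real ^ 2 ^ 2"
  assumes "det A = 1"
  obtains g where "lifts_matrix g A"
proof -
  obtain B where B: "B ** A = mat 1" using SL2_matrix_inv(2)[OF assms] by blast
  define f where "f t = Complex ((A *v dir t) $ 1) ((A *v dir t) $ 2)" for t
  have f: "f t = of_real (A $ 1 $ 1 * cos (pi * t) + A $ 1 $ 2 * sin (pi * t)) +
      \<i> * of_real (A $ 2 $ 1 * cos (pi * t) + A $ 2 $ 2 * sin (pi * t))" for t
    by (simp add: f_def matrix_vector_mult_def sum_2 dir_nth complex_eq_iff)
  have "continuous_on UNIV f" unfolding f by (intro continuous_intros)
  moreover have "contractible (UNIV :: real set)" by (simp add: convex_imp_contractible)
  moreover have "f t \<noteq> 0" for t
  proof
    assume "f t = 0"
    then have "A *v dir t = 0" by (simp add: f_def complex_eq_iff vec_eq_iff forall_2)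
    then have "(B ** A) *v dir t = 0" by (simp flip: matrix_vector_mul_assoc)
    then show False using B dir_nonzero by simp
  qed
  ultimately obtain l where l: "continuous_on UNIV l" "\<And>t. f t = exp (l t)"
    using continuous_logarithm_on_contractible[of UNIV f] by auto
  define g where "g t = Im (l t) / pi" for t
  have "lifts_matrix g A"
    unfolding lifts_matrix_def
  proof (intro conjI allI exI)
    show "continuous_on UNIV g" unfolding g_def by (intro continuous_intros l(1)) simp
    fix t
    show "exp (Re (l t)) > 0" by simp
    have "Re (f t) = exp (Re (l t)) * cos (Im (l t))" "Im (f t) = exp (Re (l t)) * sin (Im (l t))"
      unfolding l(2) by (simp_all add: Re_exp Im_exp)
    then show "A *v dir t = exp (Re (l t)) *\<^sub>R dir (g t)"
      by (simp add: f_def vec_eq_iff forall_2 dir_nth g_def)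
  qed
  then show thesis by (rule that)
qed

text \<open>Two lifts of the same matrix differ pointwise by an even integer, hence by a constant one.\<close>

lemma lifts_unique:
  assumes "lifts_matrix g A" "lifts_matrix h A"
  obtains m :: int where "g = sh (2 * of_int m) \<circ> h"
proof -
  define f where "f t = (g t - h t) / 2" for t
  have int: "\<exists>m::int. f t = of_int m" for t
  proof -
    obtain c c' where "c > 0" "A *v dir t = c *\<^sub>R dir (g t)" "c' > 0" "A *v dir t = c' *\<^sub>R dir (h t)"
      using assms unfolding lifts_matrix_def by blast
    then obtain m :: int where "g t = h t + 2 * of_int m" using dir_eq_pos by metis
    then show ?thesis by (intro exI[of _ m]) (simp add: f_def)
  qed
  have "f constant_on UNIV"
  proof (rule continuous_discrete_range_constant)
    show "continuous_on UNIV f"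
      using assms unfolding lifts_matrix_def f_def by (intro continuous_intros) auto
    fix t
    show "\<exists>e>0. \<forall>s. s \<in> UNIV \<and> f s \<noteq> f t \<longrightarrow> e \<le> norm (f s - f t)"
    proof (intro exI[of _ 1] conjI allI impI)
      fix s assume "s \<in> UNIV \<and> f s \<noteq> f t"
      moreover obtain m n :: int where mn: "f s = of_int m" "f t = of_int n" using int by metis
      ultimately have "m \<noteq> n" by auto
      then have "1 \<le> \<bar>m - n\<bar>" by simp
      then have "1 \<le> \<bar>real_of_int (m - n)\<bar>" by linarith
      then show "1 \<le> norm (f s - f t)" by (simp add: mn)
    qed simp
  qed simp
  then obtain d where d: "\<And>t. f t = d" by (auto simp: constant_on_def)
  obtain m :: int where "d = of_int m" using int d by metis
  then have "f t = of_int m" for t using d by simp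
  then have "g = sh (2 * of_int m) \<circ> h" by (auto simp: fun_eq_iff f_def sh_def field_simps)
  then show thesis by (rule that)
qed

text \<open>Two matrices with the same lift differ by a matrix that maps every direction to a positive
  multiple of itself. The directions of the axes and of the diagonal show that it is a positive
  scalar, and the determinant makes it trivial.\<close>

lemma lifted_matrix_unique:
  assumes "lifts_matrix g A" "lifts_matrix g B" "det A = 1" "det B = 1"
  shows "A = B"
proof -
  define N where "N = matrix_inv B ** A"
  have BN: "B ** N = A" by (simp add: N_def matrix_mul_assoc SL2_matrix_inv assms(4))
  have "\<exists>k>0. N *v dir t = k *\<^sub>R dir t" for t
  proof -
    obtain c where c: "c > 0" "A *v dir t = c *\<^sub>R dir (g t)"
      using assms(1) by (auto simp: lifts_matrix_def)
    obtain c' where c': "c' > 0" "B *v dir t = c' *\<^sub>R dir (g t)"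
      using assms(2) by (auto simp: lifts_matrix_def)
    have "A *v dir t = (c / c') *\<^sub>R (B *v dir t)" using c c' by simp
    then have "N *v dir t = (c / c') *\<^sub>R (matrix_inv B *v (B *v dir t))"
      unfolding N_def by (simp add: matrix_vector_mult_scaleR flip: matrix_vector_mul_assoc)
    also have "matrix_inv B *v (B *v dir t) = dir t"
      by (simp add: matrix_vector_mul_assoc SL2_matrix_inv assms(4))
    finally show ?thesis using c(1) c'(1) by (intro exI[of _ "c / c'"]) simp
  qed
  then have eig: "\<exists>k>0. N *v dir t = k *\<^sub>R dir t" for t .
  obtain a b c d where N: "N = mat22 a b c d" by (rule mat22_cases)
  have c0: "c = 0" "a > 0"
    using eig[of 0] by (auto simp: N dir_def vec_eq_iff forall_2)
  have b0: "b = 0"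
    using eig[of "1/2"] by (auto simp: N dir_def vec_eq_iff forall_2)
  have "a = d"
    using eig[of "1/4"] by (auto simp: N dir_def vec_eq_iff forall_2 c0 b0 cos_45 sin_45)
  moreover have "det N = 1" by (simp add: N_def det_mul SL2_matrix_inv assms)
  ultimately have "a * a = 1" by (simp add: N c0 b0)
  then have "a = 1" using c0 by (simp add: square_eq_1_iff)
  then have "N = mat 1" using \<open>a = d\<close> by (simp add: N c0 b0 mat22_one)
  with BN show ?thesis by simp
qed

lemma to_SL2R_eqI:
  assumes "lifts_matrix g A" "det A = 1"
  shows "to_SL2R g = A"
  unfolding to_SL2R_def using assms by (intro the_equality) (auto intro: lifted_matrix_unique)

lemma carrier_cover: "g \<in> carrier PSL2R_cover \<longleftrightarrow> (\<exists>A. det A = 1 \<and> lifts_matrix g A)"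
  by (auto simp: PSL2R_cover_def)

lemma mult_cover [simp]: "g \<otimes>\<^bsub>PSL2R_cover\<^esub> h = g \<circ> h" "\<one>\<^bsub>PSL2R_cover\<^esub> = id"
  by (simp_all add: PSL2R_cover_def)

lemma to_SL2R:
  assumes "g \<in> carrier PSL2R_cover"
  shows "det (to_SL2R g) = 1" "lifts_matrix g (to_SL2R g)"
  using assms by (auto simp: carrier_cover dest: to_SL2R_eqI)

lemma sh_in_cover [simp]: "sh r \<in> carrier PSL2R_cover"
  and to_SL2R_sh: "to_SL2R (sh r) = rot (pi * r)"
  using lifts_sh det_rot by (auto simp: carrier_cover simp del: mat22_det intro!: to_SL2R_eqI)

lemma sh_add: "sh r \<circ> sh s = sh (r + s)" and sh_0: "sh 0 = id"
  by (auto simp: sh_def)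

text \<open>A lift of the inverse matrix is an inverse up to an even shift, which is then removed.\<close>

lemma group_cover: "group PSL2R_cover"
proof (rule groupI)
  fix g assume "g \<in> carrier PSL2R_cover"
  note g = to_SL2R[OF this]
  define B where "B = matrix_inv (to_SL2R g)"
  obtain h where h: "lifts_matrix h B"
    using lifts_exists SL2_matrix_inv(3)[OF g(1)] unfolding B_def by metis
  have "lifts_matrix (h \<circ> g) (mat 1)"
    using lifts_comp[OF h g(2)] by (simp add: B_def SL2_matrix_inv g(1))
  moreover have "lifts_matrix id (mat 1)" using lifts_sh[of 0] by (simp add: sh_0 mat22_one)
  ultimately obtain m :: int where m: "h \<circ> g = sh (2 * of_int m) \<circ> id" by (rule lifts_unique)
  have "rot (pi * (- 2 * of_int m)) = mat 1"
    by (simp add: mat22_one) (metis cos_int_2pin sin_int_2pin mult.commute mult.left_commute)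
  then have "lifts_matrix (sh (- 2 * of_int m) \<circ> h) B"
    using lifts_comp[OF lifts_sh[of "- 2 * of_int m"] h] by simp
  then have "sh (- 2 * of_int m) \<circ> h \<in> carrier PSL2R_cover"
    using SL2_matrix_inv(3)[OF g(1)] by (auto simp: carrier_cover B_def)
  moreover have "(sh (- 2 * of_int m) \<circ> h) \<circ> g = id"
    unfolding comp_assoc m by (simp add: sh_add sh_0)
  ultimately show "\<exists>h\<in>carrier PSL2R_cover. h \<otimes>\<^bsub>PSL2R_cover\<^esub> g = \<one>\<^bsub>PSL2R_cover\<^esub>"
    by auto
next
  show "\<one>\<^bsub>PSL2R_cover\<^esub> \<in> carrier PSL2R_cover"
    using sh_in_cover[of 0] by (simp add: sh_0)
next
  fix g h assume "g \<in> carrier PSL2R_cover" "h \<in> carrier PSL2R_cover"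
  then obtain A B where "det A = 1" "det B = 1" "lifts_matrix g A" "lifts_matrix h B"
    by (auto simp: carrier_cover)
  then have "det (A ** B) = 1" "lifts_matrix (g \<circ> h) (A ** B)"
    by (auto simp: det_mul intro: lifts_comp)
  then show "g \<otimes>\<^bsub>PSL2R_cover\<^esub> h \<in> carrier PSL2R_cover"
    unfolding mult_cover carrier_cover by blast
qed (simp_all add: comp_assoc)

lemma group_homI:
  assumes "group G" "group H" "F \<in> hom G H"
  shows "group_hom G H F"
  using assms by (simp add: group_hom_def group_hom_axioms_def)

lemma to_SL2R_hom: "to_SL2R \<in> hom PSL2R_cover SL2"
proof (rule homI)
  fix g h assume "g \<in> carrier PSL2R_cover" "h \<in> carrier PSL2R_cover"
  then show "to_SL2R (g \<otimes>\<^bsub>PSL2R_cover\<^esub> h) = to_SL2R g \<otimes>\<^bsub>SL2\<^esub> to_SL2R h"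
    by (auto intro!: to_SL2R_eqI lifts_comp simp: det_mul to_SL2R)
qed (simp add: to_SL2R)

lemma same_SL2R:
  assumes "g \<in> carrier PSL2R_cover" "h \<in> carrier PSL2R_cover" "to_SL2R g = to_SL2R h"
  obtains m :: int where "g = sh (2 * of_int m) \<circ> h"
  using lifts_unique[OF to_SL2R(2)[OF assms(1)]] to_SL2R(2)[OF assms(2)] assms(3) by metis

lemma to_SL2R_surj:
  assumes "det A = 1"
  obtains g where "g \<in> carrier PSL2R_cover" "to_SL2R g = A"
  using lifts_exists[OF assms] to_SL2R_eqI assms by (metis carrier_cover)

lemma rot_int: "rot (pi * of_int k) = (if even k then mat 1 else - mat 1)"
  by (auto simp: mat22_one cos_npi_int sin_npi_int)

section \<open>Monotonicity and the centre\<close>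

lemma sh_int_commute:
  assumes "lifts_matrix g A"
  obtains m :: int where "\<And>t. g (t + 1) = g t + 1 + 2 * of_int m"
proof -
  have "lifts_matrix (g \<circ> sh 1) (A ** rot (pi * of_int 1))"
    "lifts_matrix (sh 1 \<circ> g) (rot (pi * of_int 1) ** A)"
    using lifts_comp[OF assms lifts_sh[of 1]] lifts_comp[OF lifts_sh[of 1] assms] by simp_all
  then have "lifts_matrix (g \<circ> sh 1) (- A)" "lifts_matrix (sh 1 \<circ> g) (- A)"
    unfolding rot_int by simp_all
  then obtain m :: int where m: "g \<circ> sh 1 = sh (2 * of_int m) \<circ> (sh 1 \<circ> g)" by (rule lifts_unique)
  show thesis using fun_cong[OF m] by (intro that[of m]) (simp add: sh_def)
qed

text \<open>A matrix of determinant \<open>1\<close> preserves the area form, so \<open>sin (\<pi> (g t - g s))\<close> has the sign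
  of \<open>sin (\<pi> (t - s))\<close>. As \<open>t\<close> moves away from \<open>s\<close> by less than one unit, \<open>g t - g s\<close> therefore
  starts at \<open>0\<close>, is never an integer again, and has to stay between \<open>0\<close> and \<open>1\<close>.\<close>

lemma lift_step:
  assumes "lifts_matrix g A" "det A = 1" "s < t" "t < s + 1"
  shows "g s < g t" "g t < g s + 1"
proof -
  have pos: "sin (pi * (g u - g s)) > 0" if u: "s < u" "u < s + 1" for u
  proof -
    obtain c where c: "c > 0" "A *v dir s = c *\<^sub>R dir (g s)"
      using assms(1) by (auto simp: lifts_matrix_def)
    obtain c' where c': "c' > 0" "A *v dir u = c' *\<^sub>R dir (g u)"
      using assms(1) by (auto simp: lifts_matrix_def)
    define cross where "cross v w = v $ 1 * w $ 2 - v $ 2 * w $ 1" for v w :: "real ^ 2"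
    have "cross (A *v v) (A *v w) = det A * cross v w" for v w
      by (simp add: cross_def matrix_vector_mult_def sum_2 det_2 algebra_simps)
    moreover have "cross (a *\<^sub>R dir x) (b *\<^sub>R dir y) = a * b * sin (pi * (y - x))" for a b x y
      by (simp add: cross_def dir_nth right_diff_distrib sin_diff algebra_simps)
    ultimately have "c * c' * sin (pi * (g u - g s)) = 1 * 1 * sin (pi * (u - s))"
      using c(2) c'(2) assms(2) by (metis mult_1 scaleR_one)
    moreover have "sin (pi * (u - s)) > 0"
      using u by (intro sin_gt_zero) (simp_all add: mult_less_cancel_left1)
    ultimately have "c * c' * sin (pi * (g u - g s)) > 0" by simp
    then show ?thesis using c(1) c'(1) by (meson mult_pos_pos zero_less_mult_pos)
  qed
  have cont: "continuous_on {s..t} g"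
    using assms(1) by (auto simp: lifts_matrix_def intro: continuous_on_subset)
  have "g t < g s + 1"
  proof (rule ccontr)
    assume "\<not> g t < g s + 1"
    then obtain u where u: "s \<le> u" "u \<le> t" "g u = g s + 1"
      using IVT'[of g s "g s + 1" t] cont assms(3) by auto
    then have "s < u" using less_le by fastforce
    with pos[of u] u assms(4) show False by simp
  qed
  moreover have "g s - 1 < g t"
  proof (rule ccontr)
    assume "\<not> g s - 1 < g t"
    then obtain u where u: "s \<le> u" "u \<le> t" "g u = g s - 1"
      using IVT2'[of g t "g s - 1" s] cont assms(3) by auto
    then have "s < u" using less_le by fastforce
    with pos[of u] u assms(4) show False by simp
  qed
  moreover have "\<not> (- 1 < g t - g s \<and> g t - g s \<le> 0)"
  proof
    assume "- 1 < g t - g s \<and> g t - g s \<le> 0"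
    then have "pi * (g s - g t) \<ge> 0" "pi * (g s - g t) \<le> pi" by simp_all
    then have "sin (pi * (g s - g t)) \<ge> 0" by (rule sin_ge_zero)
    moreover have "sin (pi * (g s - g t)) = - sin (pi * (g t - g s))"
      by (metis minus_diff_eq mult_minus_right sin_minus)
    ultimately show False using pos[OF assms(3,4)] by simp
  qed
  ultimately show "g s < g t" "g t < g s + 1" by auto
qed

text \<open>Continuity gives \<open>g (t + 1) = g t + 1 + 2 m\<close> with a constant \<open>m\<close>, and two half steps of
  \<open>lift_step\<close> bound the increment by \<open>0\<close> and \<open>2\<close>.\<close>

lemma cover_shift_int:
  assumes "g \<in> carrier PSL2R_cover"
  shows "g (t + of_int k) = g t + of_int k"
proof -
  note g = to_SL2R[OF assms]
  obtain m :: int where m: "\<And>t. g (t + 1) = g t + 1 + 2 * of_int m"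
    using sh_int_commute[OF g(2)] by metis
  have "g 0 < g (1/2)" "g (1/2) < g 0 + 1" "g (1/2) < g 1" "g 1 < g (1/2) + 1"
    using lift_step[OF g(2,1), of 0 "1/2"] lift_step[OF g(2,1), of "1/2" 1] by simp_all
  with m[of 0] have "m = 0" by simp
  with m have step: "g (t + 1) = g t + 1" for t by simp
  show ?thesis
  proof (induction k arbitrary: t rule: int_induct[where k = 0])
    case (step1 i)
    have "g (t + of_int i + 1) = g t + of_int i + 1" using step step1(2) by simp
    then show ?case by (simp add: add.assoc)
  next
    case (step2 i)
    have "g (t + of_int i) = g (t + of_int (i - 1)) + 1"
      using step[of "t + of_int (i - 1)"] by simp
    then show ?case using step2(2)[of t] by simp
  qed simp
qed

lemma cover_strict_mono:
  assumes "g \<in> carrier PSL2R_cover" "s < t"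
  shows "g s < g t"
proof -
  note g = to_SL2R[OF assms(1)]
  define n where "n = \<lfloor>t - s\<rfloor>"
  have n: "0 \<le> n" using assms(2) by (simp add: n_def)
  have gn: "g (s + of_int n) = g s + of_int n" using cover_shift_int[OF assms(1)] .
  show ?thesis
  proof (cases "t = s + of_int n")
    case True
    then have "0 < n" using assms(2) by simp
    then show ?thesis using gn True by simp
  next
    case False
    have "s + of_int n < t" "t < s + of_int n + 1"
      using False unfolding n_def by linarith+
    from lift_step(1)[OF g(2,1) this] gn n show ?thesis by simp
  qed
qed

lemma cover_le_iff:
  assumes "g \<in> carrier PSL2R_cover"
  shows "g s \<le> g t \<longleftrightarrow> s \<le> t"
  using cover_strict_mono[OF assms, of s t] cover_strict_mono[OF assms, of t s]
  by (metis linorder_not_less order_le_less)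

lemma sh_int_central:
  assumes "g \<in> carrier PSL2R_cover"
  shows "sh (of_int k) \<circ> g = g \<circ> sh (of_int k)"
  using cover_shift_int[OF assms] by (simp add: fun_eq_iff sh_def)

lemma (in group) pow_conj:
  assumes "q \<in> carrier G" "a \<in> carrier G"
  shows "(q \<otimes> a \<otimes> inv q) [^] (n::nat) = q \<otimes> a [^] n \<otimes> inv q"
proof (induction n)
  case (Suc n)
  have "inv q \<otimes> (q \<otimes> x) = x" if "x \<in> carrier G" for x
    using assms that by (simp flip: m_assoc)
  with Suc assms show ?case by (simp add: m_assoc)
qed (use assms in simp)

lemma sh_pow: "sh r [^]\<^bsub>PSL2R_cover\<^esub> (n::nat) = sh (real n * r)"
  by (induction n) (simp_all add: sh_0 sh_add algebra_simps)

lemma inv_sh: "inv\<^bsub>PSL2R_cover\<^esub> (sh r) = sh (- r)"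
  by (rule group.inv_equality[OF group_cover]) (simp_all add: sh_add sh_0)

lemma sh_int_pow: "sh r [^]\<^bsub>PSL2R_cover\<^esub> (k::int) = sh (of_int k * r)"
  by (simp add: int_pow_def2 inv_sh sh_pow)

lemma sh_inj [simp]: "sh r = sh s \<longleftrightarrow> r = s"
  by (auto simp: sh_def fun_eq_iff)

text \<open>The elliptic element with conjugator \<open>q\<close> and rotation number \<open>r\<close>.\<close>

abbreviation conj_sh :: "(real \<Rightarrow> real) \<Rightarrow> real \<Rightarrow> real \<Rightarrow> real" where
  "conj_sh q r \<equiv> q \<circ> sh r \<circ> inv\<^bsub>PSL2R_cover\<^esub> q"

lemma conj_sh_apply:
  assumes "q \<in> carrier PSL2R_cover"
  shows "conj_sh q r (q u) = q (u + r)"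
    and "\<exists>u. t = q u"
proof -
  have "inv\<^bsub>PSL2R_cover\<^esub> q \<circ> q = id" "q \<circ> inv\<^bsub>PSL2R_cover\<^esub> q = id"
    using group.l_inv[OF group_cover assms] group.r_inv[OF group_cover assms] by simp_all
  then have "(inv\<^bsub>PSL2R_cover\<^esub> q) (q v) = v" "q ((inv\<^bsub>PSL2R_cover\<^esub> q) v) = v" for v
    by (simp_all add: fun_eq_iff)
  then show "conj_sh q r (q u) = q (u + r)" "\<exists>u. t = q u"
    by (auto simp: sh_def) metis
qed

text \<open>Elements of the cover are increasing and commute with integral shifts, so at every single
  point the comparison of a shift with an integral one is invariant under conjugation.\<close>

lemma conj_sh_le_iff:
  assumes "q \<in> carrier PSL2R_cover"
  shows "conj_sh q r t \<le> t + of_int k \<longleftrightarrow> r \<le> of_int k"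
proof -
  obtain u where u: "t = q u" using conj_sh_apply(2)[OF assms] by metis
  have "conj_sh q r t = q (u + r)" "t + of_int k = q (u + of_int k)"
    unfolding u using conj_sh_apply(1)[OF assms] cover_shift_int[OF assms] by simp_all
  then show ?thesis by (simp add: cover_le_iff[OF assms])
qed

text \<open>The point is \<open>q u\<^sub>0\<close>, where \<open>u\<^sub>0\<close> minimizes the periodic function \<open>q u - u\<close>. A conjugate of
  the shift by \<open>r\<close> thus cannot move all points by less than \<open>r\<close>.\<close>

lemma conj_sh_large_displacement:
  assumes "q \<in> carrier PSL2R_cover"
  obtains t where "t + r \<le> conj_sh q r t"
proof -
  define d where "d u = q u - u" for u
  have "continuous_on {0..1} d"
    using to_SL2R(2)[OF assms] unfolding d_def lifts_matrix_def
    by (intro continuous_intros) (auto intro: continuous_on_subset)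
  then obtain u0 where "\<forall>u\<in>{0..1}. d u0 \<le> d u"
    using continuous_attains_inf[of "{0..1::real}" d] by auto
  moreover have "d u = d (frac u)" for u
    using cover_shift_int[OF assms, of u "- \<lfloor>u\<rfloor>"] by (simp add: d_def frac_def)
  ultimately have "d u0 \<le> d (u0 + r)"
    by (metis atLeastAtMost_iff frac_ge_0 frac_lt_1 less_imp_le)
  then have "q u0 + r \<le> q (u0 + r)" by (simp add: d_def)
  then show thesis using conj_sh_apply(1)[OF assms] by (intro that[of "q u0"]) simp
qed

section \<open>Elliptic elements\<close>

lemma elliptic_conj_rot:
  fixes A :: "real ^ 2 ^ 2"
  assumes det: "det A = 1" and tr: "\<bar>trace A\<bar> < 2"
  obtains Q \<theta> where "det Q = 1" "A = Q ** rot \<theta> ** matrix_inv Q"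
proof -
  obtain a b c d where A: "A = mat22 a b c d" by (rule mat22_cases)
  have ad: "a * d - b * c = 1" using det by (simp add: A)
  have t4: "(a + d)\<^sup>2 < 4" using tr abs_square_less_1[of "(a + d) / 2"]
    by (simp add: A power_divide)
  have "c \<noteq> 0"
  proof
    assume "c = 0"
    then have "(a + d)\<^sup>2 = (a - d)\<^sup>2 + 4" using ad by (simp add: power2_eq_square algebra_simps)
    then show False using t4 by (metis add_less_same_cancel2 not_sum_power2_lt_zero
        power2_eq_square zero_le_square linorder_not_less)
  qed
  \<comment> \<open>The conjugator moves the base point of the upper half plane to the fixed point
    of \<open>A\<close>, which is \<open>x + \<i> y\<close>.\<close>
  define h where "h = 1 - ((a + d) / 2)\<^sup>2"
  have h: "h > 0" using t4 by (simp add: h_def power_divide)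
  define s where "s = sgn c * sqrt h"
  define y where "y = s / c"
  define x where "x = (a - d) / (2 * c)"
  have "y = sqrt h / \<bar>c\<bar>" by (auto simp: y_def s_def sgn_if)
  then have y: "y > 0" using \<open>c \<noteq> 0\<close> h by simp
  have s2: "s * s = h" using \<open>c \<noteq> 0\<close> h by (auto simp: s_def sgn_if)
  have "((a + d) / 2)\<^sup>2 + s\<^sup>2 = 1" using s2 by (simp add: h_def power2_eq_square)
  then obtain \<theta> where \<theta>: "(a + d) / 2 = cos \<theta>" "s = sin \<theta>"
    using sincos_total_2pi by metis
  define Q where "Q = mat22 (sqrt y) (x / sqrt y) 0 (1 / sqrt y)"
  have Q: "det Q = 1" using y by (simp add: Q_def)
  have cy: "c * y = s" "c * x = (a - d) / 2" using \<open>c \<noteq> 0\<close> by (simp_all add: y_def x_def)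
  have "b * c = a * d - 1" using ad by simp
  then have "c * (a * x + b) = c * (cos \<theta> * x - s * y)"
  proof -
    have "c * (a * x + b) = a * (c * x) + b * c" by (simp add: algebra_simps)
    also have "\<dots> = (a * a + a * d) / 2 - 1" using \<open>b * c = a * d - 1\<close> unfolding cy
        by (simp add: field_simps)
    also have "\<dots> = (a + d) / 2 * ((a - d) / 2) - s * s"
      unfolding s2 h_def by (simp add: power2_eq_square field_simps)
    also have "\<dots> = cos \<theta> * (c * x) - s * (c * y)" unfolding cy \<theta>(1) ..
    finally show ?thesis by (simp add: algebra_simps)
  qed
  then have e1: "a * x + b = cos \<theta> * x - s * y" using \<open>c \<noteq> 0\<close> by simp
  have e2: "a * y = cos \<theta> * y + s * x"
  proof -
    have "a = (a + d) / 2 + c * x" unfolding cy by (simp add: field_simps)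
    from arg_cong[OF this, of "\<lambda>u. u * y"] show ?thesis
      unfolding \<theta>(1)[symmetric] cy(1)[symmetric]
      by (simp only: distrib_right mult.assoc mult.commute[of x y])
  qed
  have e3: "c * x + d = cos \<theta>" unfolding cy \<theta>(1)[symmetric] by (simp add: field_simps)
  have "A ** Q = Q ** rot \<theta>"
    using y e1 e2 e3 cy(1) unfolding A Q_def \<theta>(2)[symmetric]
    by (simp add: field_simps)
  from conj_eqI[OF Q this] Q show thesis by (intro that)
qed

text \<open>The matrix is conjugate to a rotation. Lifting the conjugator and the rotation reproduces
  \<open>g\<close> up to an even shift, which is central and can be absorbed into \<open>r\<close>.\<close>

lemma elliptic_lift:
  assumes g: "g \<in> carrier PSL2R_cover"
    and ell: "\<bar>trace (to_SL2R g)\<bar> < 2 \<or> to_SL2R g \<in> {mat 1, - mat 1}"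
  obtains q r where "q \<in> carrier PSL2R_cover"
    "g = conj_sh q r" "trace (to_SL2R g) = 2 * cos (pi * r)"
proof -
  interpret C: group PSL2R_cover by (rule group_cover)
  obtain Q \<theta> where Q: "det Q = 1" "to_SL2R g = Q ** rot \<theta> ** matrix_inv Q"
  proof (cases "\<bar>trace (to_SL2R g)\<bar> < 2")
    case True
    with elliptic_conj_rot[OF to_SL2R(1)[OF g]] that show thesis by metis
  next
    case False
    then have "to_SL2R g \<in> {mat 1, - mat 1}" using ell by simp
    then have "to_SL2R g = rot 0 \<or> to_SL2R g = rot pi" by (auto simp: mat22_one)
    moreover have "matrix_inv (mat 1 :: real ^ 2 ^ 2) = mat 1" by (simp add: matrix_inv_eqI)
    ultimately show thesis by (metis det_I matrix_mul_lid matrix_mul_rid that)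
  qed
  obtain q where q: "q \<in> carrier PSL2R_cover" "to_SL2R q = Q"
    using to_SL2R_surj[OF Q(1)] .
  interpret h: group_hom PSL2R_cover SL2 to_SL2R
    by (rule group_homI[OF group_cover group_SL2 to_SL2R_hom])
  define k where "k = conj_sh q (\<theta> / pi)"
  have k: "k = q \<otimes>\<^bsub>PSL2R_cover\<^esub> sh (\<theta> / pi) \<otimes>\<^bsub>PSL2R_cover\<^esub> inv\<^bsub>PSL2R_cover\<^esub> q"
    by (simp add: k_def)
  have kc: "k \<in> carrier PSL2R_cover" unfolding k using q by (intro C.m_closed) simp_all
  have "to_SL2R k = Q ** rot \<theta> ** matrix_inv Q"
    unfolding k using q inv_SL2[OF Q(1)] by (simp add: to_SL2R_sh del: mult_cover)
  with Q(2) have "to_SL2R g = to_SL2R k" by simp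
  then obtain m :: int where m: "g = sh (2 * of_int m) \<circ> k" by (rule same_SL2R[OF g kc])
  have "sh (of_int (2 * m)) \<circ> q = q \<circ> sh (of_int (2 * m))" by (rule sh_int_central[OF q(1)])
  then have "g = q \<circ> (sh (2 * of_int m) \<circ> sh (\<theta> / pi)) \<circ> inv\<^bsub>PSL2R_cover\<^esub> q"
    unfolding m k_def comp_assoc[symmetric] by simp
  then have "g = conj_sh q (\<theta> / pi + 2 * of_int m)"
    by (simp add: sh_add add.commute)
  moreover have "trace (to_SL2R g) = 2 * cos \<theta>" unfolding Q(2) trace_conj[OF Q(1)] by simp
  moreover have "cos (pi * (\<theta> / pi + 2 * of_int m)) = cos \<theta>"
    by (intro cos_eq_periodic_intro[of _ _ m] disjI1) (simp add: algebra_simps)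
  ultimately show thesis using q(1) that by metis
qed

lemma complexify:
  fixes A B :: "real ^ 2 ^ 2"
  shows "map_matrix complex_of_real (A ** B) =
      map_matrix complex_of_real A ** map_matrix complex_of_real B"
    and "det (map_matrix complex_of_real A) = complex_of_real (det A)"
    and "trace (map_matrix complex_of_real A) = complex_of_real (trace A)"
    and "map_matrix complex_of_real (- A) = - map_matrix complex_of_real A"
    and "map_matrix complex_of_real (mat 1) = (mat 1 :: complex ^ 2 ^ 2)"
    and "map_matrix complex_of_real A = map_matrix complex_of_real B \<longleftrightarrow> A = B"
  by (cases A; cases B; simp add: mat22_one)+

lemma complexify_hom: "map_matrix complex_of_real \<in> hom SL2 SL2"
  by (rule homI) (simp_all add: complexify)

text \<open>An element with a shift as a power has a matrix of finite order modulo the centre, hence is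
  conjugate to a shift, and the power determines by how much. In particular the trace of its
  matrix is known without any further information on the element.\<close>

lemma cover_torsion:
  assumes g: "g \<in> carrier PSL2R_cover" and n: "n > 0"
    and gn: "g [^]\<^bsub>PSL2R_cover\<^esub> (n::nat) = sh (of_int k)"
  obtains q where "q \<in> carrier PSL2R_cover"
    "g = conj_sh q (of_int k / n)"
    "trace (to_SL2R g) = 2 * cos (pi * of_int k / n)"
proof -
  interpret C: group PSL2R_cover by (rule group_cover)
  let ?c = "map_matrix complex_of_real"
  have "to_SL2R g [^]\<^bsub>SL2\<^esub> n = to_SL2R (sh (of_int k))"
    using hom_nat_pow[OF to_SL2R_hom g group_cover group_SL2, of n] gn by simp
  also have "\<dots> \<in> {mat 1, - mat 1}" unfolding to_SL2R_sh rot_int by auto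
  finally have "to_SL2R g [^]\<^bsub>SL2\<^esub> n \<in> {mat 1, - mat 1}" .
  then have "?c (to_SL2R g) [^]\<^bsub>SL2\<^esub> n \<in> {mat 1, - mat 1}"
    using hom_nat_pow[OF complexify_hom _ group_SL2 group_SL2, of "to_SL2R g" n] to_SL2R(1)[OF g]
    by (auto simp: complexify)
  note tors = torsion_trace[OF _ n this]
  have "\<bar>trace (to_SL2R g)\<bar> < 2 \<or> to_SL2R g \<in> {mat 1, - mat 1}"
  proof (cases "to_SL2R g \<in> {mat 1, - mat 1}")
    case False
    have "\<exists>m. 0 < m \<and> m < n \<and> trace (?c (to_SL2R g)) = of_real (2 * cos (pi * real m / real n))"
    proof (rule tors)
      show "det (?c (to_SL2R g)) = 1" by (simp add: complexify to_SL2R(1)[OF g])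
      show "?c (to_SL2R g) \<noteq> mat 1" "?c (to_SL2R g) \<noteq> - mat 1"
        using False complexify(4,5,6) by (metis insert_iff)+
    qed blast
    then obtain m where m: "0 < m" "m < n"
        "trace (?c (to_SL2R g)) = of_real (2 * cos (pi * real m / real n))"
      by blast
    have tr: "trace (to_SL2R g) = 2 * cos (pi * real m / real n)"
      using m(3) unfolding complexify by (metis of_real_eq_iff)
    have "pi * real m / real n < pi" "0 < pi * real m / real n" using m
        by (simp_all add: field_simps)
    then have "\<bar>cos (pi * real m / real n)\<bar> < 1"
      using cos_monotone_0_pi[of 0 "pi * real m / real n"] cos_monotone_0_pi[of
          "pi * real m / real n" pi]
      by simp
    then show ?thesis using tr by (simp add: abs_mult)
  qed simp
  from elliptic_lift[OF g this] obtain q r where q: "q \<in> carrier PSL2R_cover"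
    "g = conj_sh q r" "trace (to_SL2R g) = 2 * cos (pi * r)" by metis
  have "q \<otimes>\<^bsub>PSL2R_cover\<^esub> sh r [^]\<^bsub>PSL2R_cover\<^esub> n \<otimes>\<^bsub>PSL2R_cover\<^esub> inv\<^bsub>PSL2R_cover\<^esub> q = sh (of_int k)"
    using C.pow_conj[OF q(1) sh_in_cover[of r], of n] gn q(2) by simp
  then have "q \<otimes>\<^bsub>PSL2R_cover\<^esub> sh (real n * r) = sh (of_int k) \<otimes>\<^bsub>PSL2R_cover\<^esub> q"
    unfolding sh_pow using q(1) by (metis C.inv_solve_right C.m_closed sh_in_cover)
  also have "\<dots> = q \<otimes>\<^bsub>PSL2R_cover\<^esub> sh (of_int k)"
    using sh_int_central[OF q(1)] by simp
  finally have "sh (real n * r) = sh (of_int k)"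
    using q(1) C.Units_l_cancel[of q] by simp
  then have "r = of_int k / n" using n by (simp add: field_simps)
  with q that show thesis by (metis times_divide_eq_right)
qed

section \<open>Triangle groups in the universal cover\<close>

lemma stretch_exists:
  fixes w :: real
  assumes "w \<ge> 1"
  obtains l where "l > 0" "l + 1 / l = 2 * w"
proof -
  define r where "r = sqrt (w\<^sup>2 - 1)"
  have r2: "r * r = w\<^sup>2 - 1" using assms by (simp add: r_def)
  have "r \<ge> 0" using assms by (simp add: r_def)
  then have pos: "w + r > 0" using assms by simp
  have "(w + r) * (w - r) = 1" using r2 by (simp add: algebra_simps power2_eq_square)
  then have "1 / (w + r) = w - r" using pos by (simp add: field_simps)
  then show thesis using pos by (intro that[of "w + r"]) simp_all
qed

text \<open>The existence half of the Jankins--Neumann theorem for the classes in \<open>E\<close>: the rotations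
  about two vertices of a hyperbolic triangle with angles \<open>\<pi> s\<^sub>i\<close> compose to a rotation about the
  third. The first two vertices are placed on the imaginary axis.\<close>

lemma triangle_in_cover:
  fixes s1 s2 s3 :: real
  assumes s: "0 < s1" "0 < s2" "0 < s3" "s1 + s2 + s3 < 1"
  obtains q r where "q \<in> carrier PSL2R_cover" "r \<in> carrier PSL2R_cover"
    "sh (- s1) \<circ> conj_sh q (- s2) = conj_sh r (s3 - 1)"
proof -
  interpret C: group PSL2R_cover by (rule group_cover)
  define A B C where ABC: "A = pi * s1" "B = pi * s2" "C = pi * s3"
  have sin: "sin A > 0" "sin B > 0"
    unfolding ABC using s by (auto intro!: sin_gt_zero simp: mult_less_cancel_left1)
  have "A + B + C = pi * (s1 + s2 + s3)" by (simp add: ABC algebra_simps)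
  also have "\<dots> < pi" using s by simp
  finally have "sin A * sin B < cos A * cos B + cos C"
    using s by (intro angle_sum_less_pi) (simp_all add: ABC)
  then have "1 \<le> (cos A * cos B + cos C) / (sin A * sin B)" using sin by simp
  then obtain l where l: "l > 0" "l + 1 / l = 2 * ((cos A * cos B + cos C) / (sin A * sin B))"
    by (rule stretch_exists)
  \<comment> \<open>The first rotation is centred at \<open>\<i>\<close>, the second at \<open>l \<i>\<close>; their distance is
    chosen to give the third angle.\<close>
  define Q where "Q = mat22 (sqrt l) 0 0 (1 / sqrt l)"
  have Q: "det Q = 1" using l by (simp add: Q_def)
  obtain q where q: "q \<in> carrier PSL2R_cover" "to_SL2R q = Q"
    using to_SL2R_surj[OF Q] .
  define x where "x = sh (- s1)"
  define y where "y = conj_sh q (- s2)"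
  have yc: "y = q \<otimes>\<^bsub>PSL2R_cover\<^esub> sh (- s2) \<otimes>\<^bsub>PSL2R_cover\<^esub> inv\<^bsub>PSL2R_cover\<^esub> q"
    by (simp add: y_def)
  have mem: "x \<in> carrier PSL2R_cover" "y \<in> carrier PSL2R_cover"
    unfolding yc x_def using q(1) by (auto intro!: C.m_closed simp del: mult_cover)
  then have "x \<otimes>\<^bsub>PSL2R_cover\<^esub> y \<in> carrier PSL2R_cover" by (rule C.m_closed)
  then have xy: "x \<circ> y \<in> carrier PSL2R_cover" by simp
  interpret h: group_hom PSL2R_cover SL2 to_SL2R
    by (rule group_homI[OF group_cover group_SL2 to_SL2R_hom])
  have "to_SL2R y = Q ** rot (- B) ** matrix_inv Q"
    unfolding yc using q inv_SL2[OF Q] by (simp add: to_SL2R_sh ABC del: mult_cover)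
  also have "\<dots> = mat22 (cos B) (l * sin B) (- sin B / l) (cos B)"
    using l Q unfolding Q_def by (simp add: mat22_inv field_simps)
  finally have "to_SL2R (x \<circ> y) = rot (- A) ** mat22 (cos B) (l * sin B) (- sin B / l) (cos B)"
    using h.hom_mult[OF mem] by (simp add: to_SL2R_sh x_def ABC)
  then have "trace (to_SL2R (x \<circ> y)) = 2 * (cos A * cos B) - (sin A * sin B) * (l + 1 / l)"
    by (simp add: algebra_simps)
  also have "\<dots> = - 2 * cos C" unfolding l(2) using sin by simp
  finally have tr: "trace (to_SL2R (x \<circ> y)) = - 2 * cos C" .
  have C: "0 < C" "C < pi" using s by (simp_all add: ABC mult_less_cancel_left1)
  have "\<bar>cos C\<bar> < 1" using cos_monotone_0_pi[of 0 C] cos_monotone_0_pi[of C pi] C by simp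
  then have "\<bar>trace (to_SL2R (x \<circ> y))\<bar> < 2" unfolding tr by (simp add: abs_mult)
  then obtain r \<rho> where r: "r \<in> carrier PSL2R_cover"
      "x \<circ> y = conj_sh r \<rho>" "trace (to_SL2R (x \<circ> y)) = 2 * cos (pi * \<rho>)"
    using elliptic_lift[OF xy] by metis
  \<comment> \<open>The trace leaves the sign and the integral part of the rotation number open; moving
    some point by more than \<open>-1\<close> and every point by less than \<open>0\<close> settles both.\<close>
  obtain t where t: "t + (- s2) \<le> y t"
    using conj_sh_large_displacement[OF q(1), of "- s2"] unfolding y_def by metis
  have "\<not> (x \<circ> y) t \<le> t + of_int (- 1)" using t s by (simp add: x_def sh_def)
  then have \<rho>1: "- 1 < \<rho>" unfolding r(2) conj_sh_le_iff[OF r(1)] by simp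
  have "y 0 \<le> 0 + of_int 0" unfolding y_def conj_sh_le_iff[OF q(1)] using s by simp
  then have "(x \<circ> y) 0 < 0" using s by (simp add: x_def sh_def)
  moreover have "\<rho> < 0"
  proof (rule ccontr)
    assume "\<not> \<rho> < 0"
    obtain u where u: "0 = r u" using conj_sh_apply(2)[OF r(1)] by metis
    have "r u \<le> r (u + \<rho>)" using \<open>\<not> \<rho> < 0\<close> by (simp add: cover_le_iff[OF r(1)])
    then have "0 \<le> (x \<circ> y) 0" unfolding r(2) u using conj_sh_apply(1)[OF r(1), of \<rho> u] by simp
    with \<open>(x \<circ> y) 0 < 0\<close> show False by simp
  qed
  ultimately have "0 \<le> - \<rho>" "- \<rho> \<le> 1" using \<rho>1 by simp_all
  then have "0 \<le> pi * (- \<rho>) \<and> pi * (- \<rho>) \<le> pi"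
    using mult_nonneg_nonneg[OF pi_ge_zero] mult_left_le[OF _ pi_ge_zero] by blast
  moreover have "cos (pi * (- \<rho>)) = cos (pi - C)" using r(3) tr by simp
  ultimately have "pi * (- \<rho>) = pi - C" using C cos_inj_pi[of "pi * (- \<rho>)" "pi - C"] by simp
  then have "pi * \<rho> = pi * (s3 - 1)" by (simp add: ABC algebra_simps)
  then have "\<rho> = s3 - 1" by simp
  with r(2) have "sh (- s1) \<circ> conj_sh q (- s2) = conj_sh r (s3 - 1)" unfolding x_def y_def by simp
  with q(1) r(1) show thesis by (rule that)
qed

text \<open>The third element is the inverse of the product of the first two, shifted so that its
  rotation number is \<open>- s\<^sub>3\<close>.\<close>

lemma triangle_representation:
  fixes a1 a2 a3 :: nat and \<beta>1 \<beta>2 \<beta>3 :: int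
  assumes a: "0 < a1" "0 < a2" "0 < a3" and \<beta>: "0 < \<beta>1" "0 < \<beta>2" "0 < \<beta>3"
    and sum: "of_int \<beta>1 / of_nat a1 + of_int \<beta>2 / of_nat a2 + of_int \<beta>3 / of_nat a3 < (1::real)"
  obtains x y z where "x \<in> carrier PSL2R_cover" "y \<in> carrier PSL2R_cover" "z \<in> carrier PSL2R_cover"
    "x [^]\<^bsub>PSL2R_cover\<^esub> a1 = sh (of_int (- \<beta>1))"
    "y [^]\<^bsub>PSL2R_cover\<^esub> a2 = sh (of_int (- \<beta>2))"
    "z [^]\<^bsub>PSL2R_cover\<^esub> a3 = sh (of_int (- \<beta>3))"
    "x \<otimes>\<^bsub>PSL2R_cover\<^esub> y \<otimes>\<^bsub>PSL2R_cover\<^esub> z = sh (of_int (- 1))"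
proof -
  interpret C: group PSL2R_cover by (rule group_cover)
  define s1 s2 s3 where s: "s1 = of_int \<beta>1 / real a1" "s2 = of_int \<beta>2 / real a2"
      "s3 = of_int \<beta>3 / real a3"
  have "0 < s1" "0 < s2" "0 < s3" "s1 + s2 + s3 < 1" using assms by (simp_all add: s)
  then obtain q r where q: "q \<in> carrier PSL2R_cover" and r: "r \<in> carrier PSL2R_cover"
    and product: "sh (- s1) \<circ> conj_sh q (- s2) = conj_sh r (s3 - 1)"
    by (rule triangle_in_cover)
  define x where x: "x = sh (- s1)"
  note xqr = product[folded x]
  have conj: "q \<circ> g \<circ> inv\<^bsub>PSL2R_cover\<^esub> q =
      q \<otimes>\<^bsub>PSL2R_cover\<^esub> g \<otimes>\<^bsub>PSL2R_cover\<^esub> inv\<^bsub>PSL2R_cover\<^esub> q" for q g by simp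
  have conj_int: "conj_sh q (of_int k) = sh (of_int k)"
    if "q \<in> carrier PSL2R_cover" for q k
    using sh_int_central[OF that, of k, symmetric] C.r_inv[OF that] by (simp add: comp_assoc)
  define y where "y = conj_sh q (- s2)"
  define z where "z = conj_sh r (- s3)"
  have "x \<in> carrier PSL2R_cover" "y \<in> carrier PSL2R_cover" "z \<in> carrier PSL2R_cover"
    unfolding x y_def z_def conj using q r by (simp_all del: mult_cover)
  moreover have "x [^]\<^bsub>PSL2R_cover\<^esub> a1 = sh (of_int (- \<beta>1))"
    using a by (simp add: x sh_pow s)
  moreover have "y [^]\<^bsub>PSL2R_cover\<^esub> a2 = conj_sh q (of_int (- \<beta>2))"
    unfolding y_def conj C.pow_conj[OF q sh_in_cover] using a by (simp add: sh_pow s)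
  moreover have "z [^]\<^bsub>PSL2R_cover\<^esub> a3 = conj_sh r (of_int (- \<beta>3))"
    unfolding z_def conj C.pow_conj[OF r sh_in_cover] using a by (simp add: sh_pow s)
  moreover have "x \<otimes>\<^bsub>PSL2R_cover\<^esub> y \<otimes>\<^bsub>PSL2R_cover\<^esub> z = sh (of_int (- 1))"
  proof -
    have "(inv\<^bsub>PSL2R_cover\<^esub> r) \<circ> r = id" using C.l_inv[OF r] by simp
    then have "(inv\<^bsub>PSL2R_cover\<^esub> r) \<circ> (r \<circ> g) = g" for g :: "real \<Rightarrow> real"
      by (metis comp_assoc id_comp)
    then have "x \<circ> y \<circ> z = r \<circ> (sh (s3 - 1) \<circ> sh (- s3)) \<circ> inv\<^bsub>PSL2R_cover\<^esub> r"
      unfolding y_def z_def xqr by (simp add: comp_assoc)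
    also have "sh (s3 - 1) \<circ> sh (- s3) = sh (of_int (- 1))" by (simp add: sh_add)
    finally show ?thesis unfolding conj_int[OF r] by (simp only: mult_cover)
  qed
  ultimately show thesis unfolding conj_int[OF q] conj_int[OF r] by (rule that)
qed

section \<open>Presented groups\<close>

definition gen_class :: "('g word \<times> 'g word) set \<Rightarrow> 'g \<Rightarrow> 'g word set" where
  "gen_class R g = word_class R [(g, False)]"

fun word_eval :: "('b, 'm) monoid_scheme \<Rightarrow> ('g \<Rightarrow> 'b) \<Rightarrow> 'g word \<Rightarrow> 'b" where
  "word_eval H f [] = \<one>\<^bsub>H\<^esub>"
| "word_eval H f ((g, e) # w) = (if e then inv\<^bsub>H\<^esub> (f g) else f g) \<otimes>\<^bsub>H\<^esub> word_eval H f w"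

context group begin

lemma word_eval_closed:
  assumes "\<And>g. f g \<in> carrier G"
  shows "word_eval G f w \<in> carrier G"
proof (induction w)
  case (Cons x w)
  then show ?case using assms by (cases x) simp
qed simp

lemma word_eval_append:
  assumes "\<And>g. f g \<in> carrier G"
  shows "word_eval G f (u @ v) = word_eval G f u \<otimes> word_eval G f v"
proof (induction u)
  case (Cons x u)
  then show ?case using assms by (cases x) (simp add: word_eval_closed m_assoc)
qed (simp add: word_eval_closed assms)

lemma word_eval_pow_word:
  assumes "\<And>g. f g \<in> carrier G"
  shows "word_eval G f (pow_word g k) = f g [^] k"
proof -
  have rep: "word_eval G f (replicate n (g, e)) = (if e then inv (f g) else f g) [^] n" for n e
  proof (induction n)
    case (Suc n)
    then show ?case using assms nat_pow_Suc2[of "if e then inv (f g) else f g" n] by auto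
  qed simp
  have "word_eval G f (pow_word g k) = (if k < 0 then inv (f g) else f g) [^] nat \<bar>k\<bar>"
    unfolding pow_word_def rep ..
  also have "\<dots> = f g [^] k"
  proof (cases "k < 0")
    case True
    then have "nat \<bar>k\<bar> = nat (- k)" by simp
    then show ?thesis using True by (simp only: if_True int_pow_def2 nat_pow_inv[OF assms])
  next
    case False
    then have "nat \<bar>k\<bar> = nat k" by simp
    then show ?thesis using False by (simp only: if_False int_pow_def2)
  qed
  finally show ?thesis .
qed

lemma word_eval_cong:
  assumes "\<And>g. f g \<in> carrier G"
    and "\<And>l r. (l, r) \<in> R \<Longrightarrow> word_eval G f l = word_eval G f r"
    and "word_eq R u v"
  shows "word_eval G f u = word_eval G f v"
  using assms(3)
proof (induction rule: word_eq.induct)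
  case (cancel u g e v)
  have "word_eval G f [(g, e), (g, \<not> e)] = \<one>" using assms(1) by simp
  then show ?case by (simp only: word_eval_append[OF assms(1)]) (simp add: word_eval_closed
      assms(1))
next
  case (rel l r u v)
  then show ?case by (simp only: word_eval_append[OF assms(1)] assms(2))
qed simp_all

text \<open>The universal property of a presentation. The value on a class is read off from any
  representative, by \<open>word_eval_cong\<close>.\<close>

lemma presented_hom:
  assumes f: "\<And>g. f g \<in> carrier G"
    and rels: "\<And>l r. (l, r) \<in> R \<Longrightarrow> word_eval G f l = word_eval G f r"
  shows "\<exists>F\<in>hom (presented_group R) G. \<forall>g. F (gen_class R g) = f g"
proof -
  define F where "F A = word_eval G f (SOME w. w \<in> A)" for A
  have F: "F (word_class R w) = word_eval G f w" for w
  proof -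
    have "w \<in> word_class R w" by (simp add: word_class_def word_eq.refl)
    then have "(SOME v. v \<in> word_class R w) \<in> word_class R w" by (rule someI)
    then show ?thesis unfolding F_def
      by (intro word_eval_cong[OF f rels, symmetric]) (simp_all add: word_class_def)
  qed
  have "F \<in> hom (presented_group R) G"
    by (rule homI)
      (auto simp: carrier_presented_group F word_eval_closed f word_class_mult word_eval_append)
  moreover have "F (gen_class R g) = f g" for g by (simp add: gen_class_def F f)
  ultimately show ?thesis by blast
qed

end

lemma (in group) subgroup_centralizer:
  assumes "h \<in> carrier G"
  shows "subgroup {g \<in> carrier G. h \<otimes> g = g \<otimes> h} G"
proof (rule subgroupI)
  fix a assume "a \<in> {g \<in> carrier G. h \<otimes> g = g \<otimes> h}"
  then have a: "a \<in> carrier G" "h \<otimes> a = a \<otimes> h" by auto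
  have "inv a \<otimes> (h \<otimes> a) \<otimes> inv a = inv a \<otimes> (a \<otimes> h) \<otimes> inv a" by (simp only: a(2))
  moreover have "inv a \<otimes> (h \<otimes> a) \<otimes> inv a = inv a \<otimes> h" using a(1) assms by (simp add: m_assoc)
  moreover have "inv a \<otimes> (a \<otimes> h) \<otimes> inv a = h \<otimes> inv a"
    using a(1) assms by (simp flip: m_assoc)
  ultimately show "inv a \<in> {g \<in> carrier G. h \<otimes> g = g \<otimes> h}" using a(1) by simp
next
  fix a b
  assume "a \<in> {g \<in> carrier G. h \<otimes> g = g \<otimes> h}" "b \<in> {g \<in> carrier G. h \<otimes> g = g \<otimes> h}"
  then have ab: "a \<in> carrier G" "h \<otimes> a = a \<otimes> h" "b \<in> carrier G" "h \<otimes> b = b \<otimes> h" by auto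
  have "h \<otimes> (a \<otimes> b) = h \<otimes> a \<otimes> b" using ab(1,3) assms by (simp add: m_assoc)
  also have "\<dots> = a \<otimes> (h \<otimes> b)" unfolding ab(2) using ab(1,3) assms by (simp add: m_assoc)
  also have "\<dots> = a \<otimes> b \<otimes> h" unfolding ab(4) using ab(1,3) assms by (simp add: m_assoc)
  finally show "a \<otimes> b \<in> {g \<in> carrier G. h \<otimes> g = g \<otimes> h}" using ab(1,3) by simp
qed (use assms in auto)

lemma gen_class_closed [simp]: "gen_class R g \<in> carrier (presented_group R)"
  by (simp add: gen_class_def carrier_presented_group)

lemma gen_class_inv:
  "inv\<^bsub>presented_group R\<^esub> (gen_class R g) = word_class R [(g, True)]"
proof (rule group.inv_equality[OF group_presented_group])
  have "word_eq R ([] @ [(g, True), (g, \<not> True)] @ []) ([] @ [])" by (rule word_eq.cancel)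
  then show "word_class R [(g, True)] \<otimes>\<^bsub>presented_group R\<^esub> gen_class R g = \<one>\<^bsub>presented_group R\<^esub>"
    by (simp add: gen_class_def word_class_mult one_presented_group word_class_eq_iff)
qed (simp_all add: carrier_presented_group gen_class_def)

lemma word_class_eval: "word_class R w = word_eval (presented_group R) (gen_class R) w"
proof (induction w)
  case (Cons x w)
  obtain g e where x: "x = (g, e)" by (cases x)
  have "word_class R (x # w) = word_class R [x] \<otimes>\<^bsub>presented_group R\<^esub> word_class R w"
    by (simp add: word_class_mult)
  also have "word_class R [x] = (if e then inv\<^bsub>presented_group R\<^esub> (gen_class R g) else gen_class R g)"
    by (simp add: x gen_class_inv) (simp add: gen_class_def)
  finally show ?case by (simp only: Cons.IH x word_eval.simps)
qed (simp add: one_presented_group)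

lemma presented_induct [consumes 1, case_names one gen inv]:
  assumes "A \<in> carrier (presented_group R)"
    and "Q \<one>\<^bsub>presented_group R\<^esub>"
    and "\<And>g A. A \<in> carrier (presented_group R) \<Longrightarrow> Q A \<Longrightarrow> Q (gen_class R g \<otimes>\<^bsub>presented_group R\<^esub> A)"
    and "\<And>g A. A \<in> carrier (presented_group R) \<Longrightarrow> Q A \<Longrightarrow>
      Q (inv\<^bsub>presented_group R\<^esub> (gen_class R g) \<otimes>\<^bsub>presented_group R\<^esub> A)"
  shows "Q A"
proof -
  interpret P: group "presented_group R" by (rule group_presented_group)
  have "Q (word_eval (presented_group R) (gen_class R) w)" for w
  proof (induction w)
    case (Cons x w)
    then show ?case using assms(3,4) P.word_eval_closed[of "gen_class R" w]
      by (cases x) auto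
  qed (use assms(2) in simp)
  then show ?thesis using assms(1) by (auto simp: carrier_presented_group word_class_eval)
qed

lemma presented_subgroup_top:
  assumes "subgroup K (presented_group R)" "\<And>g. gen_class R g \<in> K"
    and "A \<in> carrier (presented_group R)"
  shows "A \<in> K"
  using assms(3)
  by (induction rule: presented_induct)
    (use assms(1,2) in \<open>auto simp: subgroup.one_closed subgroup.m_closed subgroup.m_inv_closed\<close>)

lemma presented_hom_eqI:
  assumes F: "F \<in> hom (presented_group R) H" "F' \<in> hom (presented_group R) H" and H: "group H"
    and eq: "\<And>g. F (gen_class R g) = F' (gen_class R g)"
    and A: "A \<in> carrier (presented_group R)"
  shows "F A = F' A"
  using A
proof (induction rule: presented_induct)
  note [simp] = hom_mult[OF F(1)] hom_mult[OF F(2)]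
  interpret P: group "presented_group R" by (rule group_presented_group)
  interpret F: group_hom "presented_group R" H F
    by (rule group_homI[OF P.group_axioms H F(1)])
  interpret F': group_hom "presented_group R" H F'
    by (rule group_homI[OF P.group_axioms H F(2)])
  {
    case one show ?case by simp
  next
    case (gen g A) then show ?case by (simp add: eq)
  next
    case (inv g A) then show ?case by (simp add: eq)
  }
qed

lemma presented_relation:
  assumes "(l, r) \<in> R"
  shows "word_eval (presented_group R) (gen_class R) l = word_eval (presented_group R) (gen_class
      R) r"
  using word_eq.rel[OF assms, of "[]" "[]"] by (simp flip: word_class_eval add: word_class_eq_iff)

section \<open>Triangle groups and Seifert groups\<close>

lemma pow_word_1: "pow_word g 1 = [(g, False)]"
  by (simp add: pow_word_def)

lemma seif_elem_gen: "seif_elem a1 a2 a3 B g = gen_class (seifert_rels a1 a2 a3 B) g"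
  by (simp add: seif_elem_def gen_class_def pow_word_1)

lemma tri_elem_gen: "tri_elem a1 a2 a3 g = gen_class (triangle_rels a1 a2 a3) g"
  by (simp add: tri_elem_def gen_class_def pow_word_1)

lemma group_seifert: "group (seifert_group a1 a2 a3 B)"
  by (simp add: seifert_group_def group_presented_group)

lemma group_triangle: "group (triangle_group a1 a2 a3)"
  by (simp add: triangle_group_def group_presented_group)

lemma seif_elem_closed [simp]: "seif_elem a1 a2 a3 B g \<in> carrier (seifert_group a1 a2 a3 B)"
  by (simp add: seif_elem_gen seifert_group_def)

lemma tri_elem_closed [simp]: "tri_elem a1 a2 a3 g \<in> carrier (triangle_group a1 a2 a3)"
  by (simp add: tri_elem_gen triangle_group_def)

lemma triangle_relations:
  fixes a1 a2 a3 :: nat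
  defines "T \<equiv> triangle_group a1 a2 a3"
  shows "tri_elem a1 a2 a3 Tx [^]\<^bsub>T\<^esub> a1 = \<one>\<^bsub>T\<^esub>"
    "tri_elem a1 a2 a3 Ty [^]\<^bsub>T\<^esub> a2 = \<one>\<^bsub>T\<^esub>"
    "tri_elem a1 a2 a3 Tz [^]\<^bsub>T\<^esub> a3 = \<one>\<^bsub>T\<^esub>"
    "tri_elem a1 a2 a3 Tx \<otimes>\<^bsub>T\<^esub> tri_elem a1 a2 a3 Ty \<otimes>\<^bsub>T\<^esub> tri_elem a1 a2 a3 Tz = \<one>\<^bsub>T\<^esub>"
proof -
  let ?R = "triangle_rels a1 a2 a3"
  define e where "e = tri_elem a1 a2 a3"
  have T: "T = presented_group ?R" and e: "e = gen_class ?R"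
    by (simp_all add: T_def e_def triangle_group_def tri_elem_gen fun_eq_iff)
  interpret T: group T unfolding T by (rule group_presented_group)
  have mem [simp]: "e g \<in> carrier T" for g by (simp add: T e)
  note ev = T.word_eval_append[OF mem] T.word_eval_pow_word[OF mem]
  have rel: "word_eval T e l = \<one>\<^bsub>T\<^esub>" if "(l, []) \<in> ?R" for l
    using presented_relation[OF that] by (simp add: T e)
  from rel[of "pow_word Tx (int a1)"] rel[of "pow_word Ty (int a2)"] rel[of "pow_word Tz (int a3)"]
    rel[of "pow_word Tx 1 @ pow_word Ty 1 @ pow_word Tz 1"]
  show "tri_elem a1 a2 a3 Tx [^]\<^bsub>T\<^esub> a1 = \<one>\<^bsub>T\<^esub>"
    "tri_elem a1 a2 a3 Ty [^]\<^bsub>T\<^esub> a2 = \<one>\<^bsub>T\<^esub>"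
    "tri_elem a1 a2 a3 Tz [^]\<^bsub>T\<^esub> a3 = \<one>\<^bsub>T\<^esub>"
    "tri_elem a1 a2 a3 Tx \<otimes>\<^bsub>T\<^esub> tri_elem a1 a2 a3 Ty \<otimes>\<^bsub>T\<^esub> tri_elem a1 a2 a3 Tz = \<one>\<^bsub>T\<^esub>"
    unfolding e_def[symmetric] by (simp_all add: triangle_rels_def ev int_pow_int T.m_assoc)
qed

lemma triangle_hom:
  assumes H: "group H" and mem: "X \<in> carrier H" "Y \<in> carrier H" "Z \<in> carrier H"
    and rel: "X [^]\<^bsub>H\<^esub> a1 = \<one>\<^bsub>H\<^esub>" "Y [^]\<^bsub>H\<^esub> a2 = \<one>\<^bsub>H\<^esub>" "Z [^]\<^bsub>H\<^esub> a3 = \<one>\<^bsub>H\<^esub>"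
      "X \<otimes>\<^bsub>H\<^esub> Y \<otimes>\<^bsub>H\<^esub> Z = \<one>\<^bsub>H\<^esub>"
  obtains F where "F \<in> hom (triangle_group a1 a2 a3) H"
    "F (tri_elem a1 a2 a3 Tx) = X" "F (tri_elem a1 a2 a3 Ty) = Y" "F (tri_elem a1 a2 a3 Tz) = Z"
proof -
  interpret H: group H by (rule H)
  define f where "f g = (case g of Tx \<Rightarrow> X | Ty \<Rightarrow> Y | Tz \<Rightarrow> Z)" for g
  have f: "f g \<in> carrier H" for g using mem by (simp add: f_def split: tri_gen.split)
  have rels: "word_eval H f l = word_eval H f r" if "(l, r) \<in> triangle_rels a1 a2 a3" for l r
    using that rel mem f
    unfolding triangle_rels_def
    by (elim insertE emptyE Pair_inject)
      (simp_all add: H.word_eval_append[OF f] H.word_eval_pow_word[OF f] int_pow_int H.m_assoc,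
        simp_all add: f_def)
  obtain F where F: "F \<in> hom (presented_group (triangle_rels a1 a2 a3)) H"
      "\<And>g. F (gen_class (triangle_rels a1 a2 a3) g) = f g"
    using H.presented_hom[OF f rels] by auto
  show thesis
    by (rule that[of F]) (simp_all add: triangle_group_def F tri_elem_gen f_def)
qed

lemma seifert_relations:
  fixes a1 a2 a3 :: nat and B :: "int \<times> int \<times> int \<times> int"
  assumes "B = (\<beta>, \<beta>1, \<beta>2, \<beta>3)"
  defines "S \<equiv> seifert_group a1 a2 a3 B"
    and "e \<equiv> seif_elem a1 a2 a3 B"
  shows "e Sx [^]\<^bsub>S\<^esub> a1 = e Sh [^]\<^bsub>S\<^esub> (- \<beta>1)"
    "e Sy [^]\<^bsub>S\<^esub> a2 = e Sh [^]\<^bsub>S\<^esub> (- \<beta>2)"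
    "e Sz [^]\<^bsub>S\<^esub> a3 = e Sh [^]\<^bsub>S\<^esub> (- \<beta>3)"
    "e Sx \<otimes>\<^bsub>S\<^esub> e Sy \<otimes>\<^bsub>S\<^esub> e Sz = e Sh [^]\<^bsub>S\<^esub> \<beta>"
    "\<And>g. g \<in> carrier S \<Longrightarrow> e Sh \<otimes>\<^bsub>S\<^esub> g = g \<otimes>\<^bsub>S\<^esub> e Sh"
proof -
  let ?R = "seifert_rels a1 a2 a3 B"
  have S: "S = presented_group ?R" and e: "e = gen_class ?R"
    by (simp_all add: S_def e_def seifert_group_def seif_elem_gen fun_eq_iff)
  interpret S: group S unfolding S by (rule group_presented_group)
  have mem [simp]: "e g \<in> carrier S" for g by (simp add: S e)
  note ev = S.word_eval_append[OF mem] S.word_eval_pow_word[OF mem]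
  have rel: "word_eval S e l = word_eval S e r" if "(l, r) \<in> ?R" for l r
    using presented_relation[OF that] by (simp add: S e)
  show "e Sx [^]\<^bsub>S\<^esub> a1 = e Sh [^]\<^bsub>S\<^esub> (- \<beta>1)"
    using rel[of "pow_word Sx (int a1)" "pow_word Sh (- \<beta>1)"] by (simp add: assms(1) ev int_pow_int)
  show "e Sy [^]\<^bsub>S\<^esub> a2 = e Sh [^]\<^bsub>S\<^esub> (- \<beta>2)"
    using rel[of "pow_word Sy (int a2)" "pow_word Sh (- \<beta>2)"] by (simp add: assms(1) ev int_pow_int)
  show "e Sz [^]\<^bsub>S\<^esub> a3 = e Sh [^]\<^bsub>S\<^esub> (- \<beta>3)"
    using rel[of "pow_word Sz (int a3)" "pow_word Sh (- \<beta>3)"] by (simp add: assms(1) ev int_pow_int)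
  show "e Sx \<otimes>\<^bsub>S\<^esub> e Sy \<otimes>\<^bsub>S\<^esub> e Sz = e Sh [^]\<^bsub>S\<^esub> \<beta>"
    using rel[of "pow_word Sx 1 @ pow_word Sy 1 @ pow_word Sz 1" "pow_word Sh \<beta>"]
    by (simp add: assms(1) ev S.m_assoc)
  have comm: "e Sh \<otimes>\<^bsub>S\<^esub> e g = e g \<otimes>\<^bsub>S\<^esub> e Sh" for g
    using rel[of "pow_word g 1 @ pow_word Sh 1" "pow_word Sh 1 @ pow_word g 1"]
    by (auto simp: assms(1) ev)
  define K where "K = {g \<in> carrier S. e Sh \<otimes>\<^bsub>S\<^esub> g = g \<otimes>\<^bsub>S\<^esub> e Sh}"
  have "subgroup K S" unfolding K_def by (rule S.subgroup_centralizer) simp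
  moreover have "e g \<in> K" for g using comm by (simp add: K_def)
  ultimately show "e Sh \<otimes>\<^bsub>S\<^esub> g = g \<otimes>\<^bsub>S\<^esub> e Sh" if "g \<in> carrier S" for g
    using presented_subgroup_top[of K ?R g] that unfolding S[symmetric] e[symmetric]
    by (simp add: K_def)
qed

lemma seifert_hom:
  fixes X Y Z h :: 'b
  assumes H: "group H" and mem: "X \<in> carrier H" "Y \<in> carrier H" "Z \<in> carrier H" "h \<in> carrier H"
    and rel: "X [^]\<^bsub>H\<^esub> a1 = h [^]\<^bsub>H\<^esub> (- \<beta>1)" "Y [^]\<^bsub>H\<^esub> a2 = h [^]\<^bsub>H\<^esub> (- \<beta>2)"
      "Z [^]\<^bsub>H\<^esub> a3 = h [^]\<^bsub>H\<^esub> (- \<beta>3)" "X \<otimes>\<^bsub>H\<^esub> Y \<otimes>\<^bsub>H\<^esub> Z = h [^]\<^bsub>H\<^esub> \<beta>"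
    and comm: "\<And>g. g \<in> carrier H \<Longrightarrow> h \<otimes>\<^bsub>H\<^esub> g = g \<otimes>\<^bsub>H\<^esub> h"
    and B: "B = (\<beta>, \<beta>1, \<beta>2, \<beta>3)"
  obtains F where "F \<in> hom (seifert_group a1 a2 a3 B) H"
    "F (seif_elem a1 a2 a3 B Sx) = X" "F (seif_elem a1 a2 a3 B Sy) = Y"
    "F (seif_elem a1 a2 a3 B Sz) = Z" "F (seif_elem a1 a2 a3 B Sh) = h"
proof -
  interpret H: group H by (rule H)
  define f where "f g = (case g of Sx \<Rightarrow> X | Sy \<Rightarrow> Y | Sz \<Rightarrow> Z | Sh \<Rightarrow> h)" for g
  have f: "f g \<in> carrier H" for g using mem by (simp add: f_def split: seif_gen.split)
  have fh: "f Sh = h" by (simp add: f_def)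
  have rels: "word_eval H f l = word_eval H f r" if "(l, r) \<in> seifert_rels a1 a2 a3 B" for l r
    using that rel mem f comm[OF f]
    unfolding B seifert_rels.simps
    by (elim UnE CollectE exE conjE insertE emptyE Pair_inject)
      (simp_all add: H.word_eval_append[OF f] H.word_eval_pow_word[OF f] int_pow_int H.m_assoc fh,
        simp_all add: f_def H.m_assoc)
  obtain F where F: "F \<in> hom (presented_group (seifert_rels a1 a2 a3 B)) H"
      "\<And>g. F (gen_class (seifert_rels a1 a2 a3 B) g) = f g"
    using H.presented_hom[OF f rels] by auto
  show thesis
    by (rule that[of F]) (simp_all add: seifert_group_def F seif_elem_gen f_def)
qed

section \<open>Fibrations of Seifert groups over triangle groups\<close>

lemma (in group) central_int_pow:
  assumes "h \<in> carrier G" "\<And>g. g \<in> carrier G \<Longrightarrow> h \<otimes> g = g \<otimes> h" "g \<in> carrier G"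
  shows "h [^] (k::int) \<otimes> g = g \<otimes> h [^] k"
proof -
  have "subgroup {x \<in> carrier G. g \<otimes> x = x \<otimes> g} G"
    using assms(3) by (rule subgroup_centralizer)
  moreover have "h \<in> {x \<in> carrier G. g \<otimes> x = x \<otimes> g}" using assms by simp
  ultimately have "h [^] k \<in> {x \<in> carrier G. g \<otimes> x = x \<otimes> g}"
    using subgroup_int_pow_closed by blast
  then show ?thesis by simp
qed

lemma seifert_fibre_commutes:
  assumes "g \<in> carrier (seifert_group a1 a2 a3 B)"
  shows "seif_elem a1 a2 a3 B Sh [^]\<^bsub>seifert_group a1 a2 a3 B\<^esub> (k::int)
      \<otimes>\<^bsub>seifert_group a1 a2 a3 B\<^esub> g
    = g \<otimes>\<^bsub>seifert_group a1 a2 a3 B\<^esub>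
      seif_elem a1 a2 a3 B Sh [^]\<^bsub>seifert_group a1 a2 a3 B\<^esub> k"
proof -
  obtain \<beta> \<beta>1 \<beta>2 \<beta>3 where B: "B = (\<beta>, \<beta>1, \<beta>2, \<beta>3)" by (metis prod_cases4)
  show ?thesis
    using group.central_int_pow[OF group_seifert _ _ assms] seifert_relations(5)[OF B] by simp
qed

lemma seifert_subgroup_top:
  assumes "subgroup K (seifert_group a1 a2 a3 B)" "\<And>g. seif_elem a1 a2 a3 B g \<in> K"
    and "A \<in> carrier (seifert_group a1 a2 a3 B)"
  shows "A \<in> K"
  using presented_subgroup_top[of K "seifert_rels a1 a2 a3 B" A] assms
  by (simp add: seifert_group_def seif_elem_gen)

lemma triangle_subgroup_top:
  assumes "subgroup K (triangle_group a1 a2 a3)" "\<And>g. tri_elem a1 a2 a3 g \<in> K"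
    and "A \<in> carrier (triangle_group a1 a2 a3)"
  shows "A \<in> K"
  using presented_subgroup_top[of K "triangle_rels a1 a2 a3" A] assms
  by (simp add: triangle_group_def tri_elem_gen)

lemma seifert_hom_eqI:
  assumes "F \<in> hom (seifert_group a1 a2 a3 B) H" "F' \<in> hom (seifert_group a1 a2 a3 B) H" "group H"
    and "F (seif_elem a1 a2 a3 B Sx) = F' (seif_elem a1 a2 a3 B Sx)"
      "F (seif_elem a1 a2 a3 B Sy) = F' (seif_elem a1 a2 a3 B Sy)"
      "F (seif_elem a1 a2 a3 B Sz) = F' (seif_elem a1 a2 a3 B Sz)"
      "F (seif_elem a1 a2 a3 B Sh) = F' (seif_elem a1 a2 a3 B Sh)"
    and "A \<in> carrier (seifert_group a1 a2 a3 B)"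
  shows "F A = F' A"
proof (rule presented_hom_eqI[of F "seifert_rels a1 a2 a3 B" H F'])
  show "F (gen_class (seifert_rels a1 a2 a3 B) g) = F' (gen_class (seifert_rels a1 a2 a3 B) g)"
      for g
    using assms(4-7) by (cases g) (simp_all add: seif_elem_gen)
qed (use assms in \<open>simp_all add: seifert_group_def\<close>)

lemma triangle_hom_eqI:
  assumes "F \<in> hom (triangle_group a1 a2 a3) H" "F' \<in> hom (triangle_group a1 a2 a3) H" "group H"
    and "F (tri_elem a1 a2 a3 Tx) = F' (tri_elem a1 a2 a3 Tx)"
      "F (tri_elem a1 a2 a3 Ty) = F' (tri_elem a1 a2 a3 Ty)"
      "F (tri_elem a1 a2 a3 Tz) = F' (tri_elem a1 a2 a3 Tz)"
    and "A \<in> carrier (triangle_group a1 a2 a3)"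
  shows "F A = F' A"
proof (rule presented_hom_eqI[of F "triangle_rels a1 a2 a3" H F'])
  show "F (gen_class (triangle_rels a1 a2 a3) g) = F' (gen_class (triangle_rels a1 a2 a3) g)" for g
    using assms(4-6) by (cases g) (simp_all add: tri_elem_gen)
qed (use assms in \<open>simp_all add: triangle_group_def\<close>)

lemma base_projection:
  obtains \<pi> where "\<pi> \<in> hom (seifert_group a1 a2 a3 B) (triangle_group a1 a2 a3)"
    "\<pi> (seif_elem a1 a2 a3 B Sx) = tri_elem a1 a2 a3 Tx"
    "\<pi> (seif_elem a1 a2 a3 B Sy) = tri_elem a1 a2 a3 Ty"
    "\<pi> (seif_elem a1 a2 a3 B Sz) = tri_elem a1 a2 a3 Tz"
    "\<pi> (seif_elem a1 a2 a3 B Sh) = \<one>\<^bsub>triangle_group a1 a2 a3\<^esub>"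
proof -
  obtain \<beta> \<beta>1 \<beta>2 \<beta>3 where B: "B = (\<beta>, \<beta>1, \<beta>2, \<beta>3)" by (metis prod_cases4)
  interpret T: group "triangle_group a1 a2 a3" by (rule group_triangle)
  show thesis
    by (rule seifert_hom[OF group_triangle tri_elem_closed tri_elem_closed tri_elem_closed
        T.one_closed
          _ _ _ _ _ B]) (use triangle_relations that in \<open>simp_all\<close>)
qed

lemma base_projection_surj:
  assumes "\<pi> \<in> hom (seifert_group a1 a2 a3 B) (triangle_group a1 a2 a3)"
    and "\<pi> (seif_elem a1 a2 a3 B Sx) = tri_elem a1 a2 a3 Tx"
    "\<pi> (seif_elem a1 a2 a3 B Sy) = tri_elem a1 a2 a3 Ty"
    "\<pi> (seif_elem a1 a2 a3 B Sz) = tri_elem a1 a2 a3 Tz"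
    and "\<gamma> \<in> carrier (triangle_group a1 a2 a3)"
  obtains g where "g \<in> carrier (seifert_group a1 a2 a3 B)" "\<pi> g = \<gamma>"
proof -
  interpret \<pi>: group_hom "seifert_group a1 a2 a3 B" "triangle_group a1 a2 a3" \<pi>
    by (rule group_homI[OF group_seifert group_triangle assms(1)])
  have "tri_elem a1 a2 a3 g \<in> \<pi> ` carrier (seifert_group a1 a2 a3 B)" for g
    using assms(2-4) by (cases g) (metis image_eqI seif_elem_closed)+
  from triangle_subgroup_top[OF \<pi>.img_is_subgroup this assms(5)] that show thesis by blast
qed

text \<open>The quotient of the Seifert group by the powers of the fibre satisfies the relations of the
  triangle group, so the quotient map factors through \<open>\<pi>\<close>. Its kernel therefore contains the
  kernel of \<open>\<pi>\<close>.\<close>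

lemma base_projection_kernel:
  assumes \<pi>: "\<pi> \<in> hom (seifert_group a1 a2 a3 B) (triangle_group a1 a2 a3)"
    "\<pi> (seif_elem a1 a2 a3 B Sx) = tri_elem a1 a2 a3 Tx"
    "\<pi> (seif_elem a1 a2 a3 B Sy) = tri_elem a1 a2 a3 Ty"
    "\<pi> (seif_elem a1 a2 a3 B Sz) = tri_elem a1 a2 a3 Tz"
    "\<pi> (seif_elem a1 a2 a3 B Sh) = \<one>\<^bsub>triangle_group a1 a2 a3\<^esub>"
    and g: "g \<in> carrier (seifert_group a1 a2 a3 B)" "\<pi> g = \<one>\<^bsub>triangle_group a1 a2 a3\<^esub>"
  obtains k :: int where "g = seif_elem a1 a2 a3 B Sh [^]\<^bsub>seifert_group a1 a2 a3 B\<^esub> k"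
proof -
  define S where "S = seifert_group a1 a2 a3 B"
  define e where "e = seif_elem a1 a2 a3 B"
  have mem [simp]: "e s \<in> carrier S" for s by (simp add: e_def S_def)
  obtain \<beta> \<beta>1 \<beta>2 \<beta>3 where B: "B = (\<beta>, \<beta>1, \<beta>2, \<beta>3)" by (metis prod_cases4)
  note rels = seifert_relations[OF B, where ?a1.0 = a1 and ?a2.0 = a2
      and ?a3.0 = a3, folded S_def e_def]
  interpret S: group S unfolding S_def by (rule group_seifert)
  define N where "N = range (\<lambda>k::int. e Sh [^]\<^bsub>S\<^esub> k)"
  have subN: "subgroup N S"
  proof (rule S.subgroupI)
    show "N \<subseteq> carrier S" "N \<noteq> {}" by (auto simp: N_def)
    show "inv\<^bsub>S\<^esub> a \<in> N" if "a \<in> N" for a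
      using that by (auto simp: N_def S.int_pow_neg[symmetric])
    show "a \<otimes>\<^bsub>S\<^esub> b \<in> N" if "a \<in> N" "b \<in> N" for a b
      using that by (auto simp: N_def S.int_pow_mult[symmetric])
  qed
  have "a \<otimes>\<^bsub>S\<^esub> n \<otimes>\<^bsub>S\<^esub> inv\<^bsub>S\<^esub> a \<in> N" if a: "a \<in> carrier S" and "n \<in> N" for a n
  proof -
    obtain k :: int where n: "n = e Sh [^]\<^bsub>S\<^esub> k" using \<open>n \<in> N\<close> by (auto simp: N_def)
    have "a \<otimes>\<^bsub>S\<^esub> n \<otimes>\<^bsub>S\<^esub> inv\<^bsub>S\<^esub> a = n \<otimes>\<^bsub>S\<^esub> a \<otimes>\<^bsub>S\<^esub> inv\<^bsub>S\<^esub> a"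
      using S.central_int_pow[OF mem rels(5) a] by (simp add: n)
    also have "\<dots> = n" using a by (simp add: n S.m_assoc)
    finally show ?thesis using \<open>n \<in> N\<close> by simp
  qed
  with subN have "N \<lhd> S" by (intro S.normal_invI)
  then interpret N: normal N S .
  interpret Q: group "S Mod N" by (rule N.factorgroup_is_group)
  define c where "c = (\<lambda>a. N #>\<^bsub>S\<^esub> a)"
  have c: "c \<in> hom S (S Mod N)" unfolding c_def by (rule N.r_coset_hom_Mod)
  interpret c: group_hom S "S Mod N" c
    by (rule group_homI[OF S.group_axioms Q.group_axioms c])
  have kerN: "c n = \<one>\<^bsub>S Mod N\<^esub>" if "n \<in> N" for n
    unfolding c_def one_FactGroup using N.rcos_const[OF S.group_axioms that] .
  have ker: "n \<in> N" if "n \<in> carrier S" "c n = \<one>\<^bsub>S Mod N\<^esub>" for n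
    using that S.rcos_self[OF _ subN] unfolding c_def one_FactGroup by blast
  have hN: "e Sh [^]\<^bsub>S\<^esub> (k::int) \<in> N" for k by (simp add: N_def)
  have "c (e Sx) [^]\<^bsub>S Mod N\<^esub> a1 = \<one>\<^bsub>S Mod N\<^esub>" "c (e Sy) [^]\<^bsub>S Mod N\<^esub> a2 = \<one>\<^bsub>S Mod N\<^esub>"
    "c (e Sz) [^]\<^bsub>S Mod N\<^esub> a3 = \<one>\<^bsub>S Mod N\<^esub>"
    using kerN[OF hN] rels(1-3) by (simp_all flip: c.hom_nat_pow)
  moreover have "c (e Sx) \<otimes>\<^bsub>S Mod N\<^esub> c (e Sy) \<otimes>\<^bsub>S Mod N\<^esub> c (e Sz) = \<one>\<^bsub>S Mod N\<^esub>"
    using kerN[OF hN] rels(4) by (simp flip: c.hom_mult del: mult_FactGroup one_FactGroup)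
  ultimately obtain F where F: "F \<in> hom (triangle_group a1 a2 a3) (S Mod N)"
    "F (tri_elem a1 a2 a3 Tx) = c (e Sx)" "F (tri_elem a1 a2 a3 Ty) = c (e Sy)"
    "F (tri_elem a1 a2 a3 Tz) = c (e Sz)"
    using triangle_hom[OF Q.group_axioms c.hom_closed[OF mem] c.hom_closed[OF mem] c.hom_closed[OF
        mem]]
    by metis
  interpret F: group_hom "triangle_group a1 a2 a3" "S Mod N" F
    by (rule group_homI[OF group_triangle Q.group_axioms F(1)])
  have "(F \<circ> \<pi>) g = c g"
  proof (rule seifert_hom_eqI[of "F \<circ> \<pi>" a1 a2 a3 B "S Mod N" c])
    show "F \<circ> \<pi> \<in> hom (seifert_group a1 a2 a3 B) (S Mod N)"
      using \<pi>(1) F(1) by (rule Group.hom_compose)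
    show "c \<in> hom (seifert_group a1 a2 a3 B) (S Mod N)" using c by (simp add: S_def)
    show "(F \<circ> \<pi>) (seif_elem a1 a2 a3 B Sh) = c (seif_elem a1 a2 a3 B Sh)"
      using kerN[OF hN[of 1]] \<pi>(5)[folded e_def] by (simp flip: e_def)
  qed (use F \<pi> g Q.group_axioms in \<open>simp_all flip: e_def\<close>)
  then have "c g = \<one>\<^bsub>S Mod N\<^esub>" using g(2) by simp
  with ker g(1) have "g \<in> N" by (simp add: S_def)
  then show thesis using that by (auto simp: N_def S_def e_def)
qed

text \<open>The reflection of the base orbifold. It is needed because the two Seifert fibrations related
  by the covering have Euler numbers of opposite signs, while the fibre is sent to a positive
  power of the fibre.\<close>

lemma triangle_reflection:
  obtains r where "r \<in> hom (triangle_group a1 a2 a3) (triangle_group a1 a2 a3)"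
    "r (tri_elem a1 a2 a3 Tx) = inv\<^bsub>triangle_group a1 a2 a3\<^esub> (tri_elem a1 a2 a3 Tx)"
    "r (tri_elem a1 a2 a3 Ty) = inv\<^bsub>triangle_group a1 a2 a3\<^esub> (tri_elem a1 a2 a3 Ty)"
    "r (tri_elem a1 a2 a3 Tz) =
      tri_elem a1 a2 a3 Ty \<otimes>\<^bsub>triangle_group a1 a2 a3\<^esub> tri_elem a1 a2 a3 Tx"
    "\<And>\<gamma>. \<gamma> \<in> carrier (triangle_group a1 a2 a3) \<Longrightarrow> r (r \<gamma>) = \<gamma>"
proof -
  define T where "T = triangle_group a1 a2 a3"
  define x y z where xyz: "x = tri_elem a1 a2 a3 Tx" "y = tri_elem a1 a2 a3 Ty"
      "z = tri_elem a1 a2 a3 Tz"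
  interpret T: group T unfolding T_def by (rule group_triangle)
  have mem [simp]: "x \<in> carrier T" "y \<in> carrier T" "z \<in> carrier T" by (simp_all add: xyz T_def)
  note rels = triangle_relations[of a1 a2 a3, folded T_def xyz]
  have z: "inv\<^bsub>T\<^esub> z = x \<otimes>\<^bsub>T\<^esub> y" using rels(4) by (intro T.inv_equality) simp_all
  have "(y \<otimes>\<^bsub>T\<^esub> x) = inv\<^bsub>T\<^esub> x \<otimes>\<^bsub>T\<^esub> inv\<^bsub>T\<^esub> z \<otimes>\<^bsub>T\<^esub> inv\<^bsub>T\<^esub> (inv\<^bsub>T\<^esub> x)"
    unfolding z by (simp flip: T.m_assoc)
  then have "(y \<otimes>\<^bsub>T\<^esub> x) [^]\<^bsub>T\<^esub> a3 = inv\<^bsub>T\<^esub> x \<otimes>\<^bsub>T\<^esub> (inv\<^bsub>T\<^esub> z) [^]\<^bsub>T\<^esub> a3 \<otimes>\<^bsub>T\<^esub> inv\<^bsub>T\<^esub> (inv\<^bsub>T\<^esub> x)"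
    by (simp only: T.pow_conj T.inv_closed mem)
  also have "\<dots> = \<one>\<^bsub>T\<^esub>" by (simp add: T.nat_pow_inv rels)
  finally have yx: "(y \<otimes>\<^bsub>T\<^esub> x) [^]\<^bsub>T\<^esub> a3 = \<one>\<^bsub>T\<^esub>" .
  have "inv\<^bsub>T\<^esub> y \<otimes>\<^bsub>T\<^esub> (y \<otimes>\<^bsub>T\<^esub> x) = x" by (simp flip: T.m_assoc)
  then have prod: "inv\<^bsub>T\<^esub> x \<otimes>\<^bsub>T\<^esub> inv\<^bsub>T\<^esub> y \<otimes>\<^bsub>T\<^esub> (y \<otimes>\<^bsub>T\<^esub> x) = \<one>\<^bsub>T\<^esub>"
    by (simp add: T.m_assoc)
  have pows: "inv\<^bsub>T\<^esub> x [^]\<^bsub>T\<^esub> a1 = \<one>\<^bsub>T\<^esub>" "inv\<^bsub>T\<^esub> y [^]\<^bsub>T\<^esub> a2 = \<one>\<^bsub>T\<^esub>"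
    by (simp_all add: T.nat_pow_inv rels)
  obtain r where r: "r \<in> hom T T" "r x = inv\<^bsub>T\<^esub> x" "r y = inv\<^bsub>T\<^esub> y" "r z = y \<otimes>\<^bsub>T\<^esub> x"
  proof (rule triangle_hom[OF T.group_axioms _ _ _ pows yx prod])
    fix F
    assume "F \<in> hom (triangle_group a1 a2 a3) T" "F (tri_elem a1 a2 a3 Tx) = inv\<^bsub>T\<^esub> x"
      "F (tri_elem a1 a2 a3 Ty) = inv\<^bsub>T\<^esub> y" "F (tri_elem a1 a2 a3 Tz) = y \<otimes>\<^bsub>T\<^esub> x"
    then show thesis by (intro that[of F]) (simp_all add: T_def xyz)
  qed simp_all
  interpret r: group_hom T T r by (rule group_homI[OF T.group_axioms T.group_axioms r(1)])
  have "(r \<circ> r) \<gamma> = id \<gamma>" if "\<gamma> \<in> carrier T" for \<gamma>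
  proof (rule triangle_hom_eqI[of "r \<circ> r" a1 a2 a3 T id])
    show "r \<circ> r \<in> hom (triangle_group a1 a2 a3) T" "id \<in> hom (triangle_group a1 a2 a3) T"
      using r(1) by (auto simp: T_def intro: Group.hom_compose homI)
    have "r (r z) = inv\<^bsub>T\<^esub> (x \<otimes>\<^bsub>T\<^esub> y)" by (simp add: r T.inv_mult_group)
    then have "r (r z) = z" by (simp flip: z)
    then show "(r \<circ> r) (tri_elem a1 a2 a3 Tz) = id (tri_elem a1 a2 a3 Tz)"
      by (simp flip: xyz)
  qed (use that T.group_axioms in \<open>simp_all add: r flip: xyz T_def\<close>)
  with r show thesis by (intro that[of r]) (simp_all add: T_def xyz)
qed

section \<open>The universal abelian cover\<close>

text \<open>The relations of the covering Seifert group hold for the reflected generators \<open>x\<^sup>-\<^sup>1\<close>, \<open>y\<^sup>-\<^sup>1\<close>,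
  \<open>y x\<close>, corrected by powers of the fibre, and the power \<open>h\<^sup>d\<close>. Up to a power of \<open>h\<close>, the element
  \<open>y x\<close> is conjugate to \<open>z\<^sup>-\<^sup>1\<close>, which gives the third relation.\<close>

lemma (in group) reflected_seifert_relations:
  fixes n1 n2 n3 :: nat and \<beta> \<beta>1 \<beta>2 \<beta>3 b b1 b2 b3 d k1 k2 k3 :: int
  assumes mem [simp]: "x \<in> carrier G" "y \<in> carrier G" "z \<in> carrier G" "h \<in> carrier G"
    and rel: "x [^] n1 = h [^] (- \<beta>1)" "y [^] n2 = h [^] (- \<beta>2)" "z [^] n3 = h [^] (- \<beta>3)"
      "x \<otimes> y \<otimes> z = h [^] \<beta>"
    and comm: "\<And>g. g \<in> carrier G \<Longrightarrow> h \<otimes> g = g \<otimes> h"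
    and k: "k1 * int n1 = - \<beta>1 - b1 * d" "k2 * int n2 = - \<beta>2 - b2 * d"
      "k3 * int n3 = - \<beta>3 - b3 * d" "k1 + k2 + k3 = d * b + \<beta>"
  shows "(inv x \<otimes> h [^] k1) [^] n1 = (h [^] d) [^] (- b1)"
    and "(inv y \<otimes> h [^] k2) [^] n2 = (h [^] d) [^] (- b2)"
    and "(y \<otimes> x \<otimes> h [^] (k3 - \<beta>)) [^] n3 = (h [^] d) [^] (- b3)"
    and "inv x \<otimes> h [^] k1 \<otimes> (inv y \<otimes> h [^] k2) \<otimes> (y \<otimes> x \<otimes> h [^] (k3 - \<beta>)) = (h [^] d) [^] b"
proof -
  have hc: "h [^] (k::int) \<otimes> g = g \<otimes> h [^] k" if "g \<in> carrier G" for g k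
    using central_int_pow[OF mem(4) comm that] .
  have hpow: "(g \<otimes> h [^] k) [^] n = g [^] n \<otimes> h [^] (k * int n)"
    if "g \<in> carrier G" for g n and k :: int
  proof -
    have "(h [^] k) [^] n = h [^] (k * int n)"
      by (metis int_pow_pow int_pow_int mem(4))
    then show ?thesis
      using pow_mult_distrib[OF hc[OF that, of k, symmetric], of n] that by simp
  qed
  have inv_h: "inv (h [^] k) = h [^] (- k)" for k :: int
    by (simp add: int_pow_neg)
  have hh: "h [^] i \<otimes> h [^] j = h [^] (i + j)" for i j :: int
    by (simp add: int_pow_mult)
  have gen: "(inv g \<otimes> h [^] k) [^] n = (h [^] d) [^] (- m)"
    if "g \<in> carrier G" "g [^] n = h [^] (- \<mu>)" "k * int n = - \<mu> - m * d" for g n k m \<mu>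
    using that by (simp add: hpow nat_pow_inv inv_h hh int_pow_pow mult.commute)
  show "(inv x \<otimes> h [^] k1) [^] n1 = (h [^] d) [^] (- b1)"
    by (rule gen[OF _ rel(1) k(1)]) simp
  show "(inv y \<otimes> h [^] k2) [^] n2 = (h [^] d) [^] (- b2)"
    by (rule gen[OF _ rel(2) k(2)]) simp
  have yx: "y \<otimes> x \<otimes> h [^] (k3 - \<beta>) =
      inv x \<otimes> (inv z \<otimes> h [^] k3) \<otimes> inv (inv x)"
  proof -
    have "x \<otimes> y = h [^] \<beta> \<otimes> inv z"
      using rel(4) by (simp add: inv_solve_right)
    then have "inv z \<otimes> h [^] k3 = x \<otimes> y \<otimes> h [^] (k3 - \<beta>)"
      by (simp add: hc[of "inv z"] m_assoc hh)
    then have "inv x \<otimes> (inv z \<otimes> h [^] k3) = y \<otimes> h [^] (k3 - \<beta>)"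
      by (simp add: m_assoc inv_solve_left')
    then show ?thesis by (simp add: m_assoc hc[of x])
  qed
  show "(y \<otimes> x \<otimes> h [^] (k3 - \<beta>)) [^] n3 = (h [^] d) [^] (- b3)"
  proof -
    have "(h [^] d) [^] (- b3) = h [^] (d * (- b3))" by (simp add: int_pow_pow)
    then have "inv x \<otimes> (h [^] d) [^] (- b3) \<otimes> inv (inv x) = (h [^] d) [^] (- b3)"
      using hc[of x "d * (- b3)"] by (simp add: m_assoc) (simp flip: m_assoc)
    then show ?thesis
      unfolding yx using pow_conj[of "inv x" "inv z \<otimes> h [^] k3" n3]
        gen[OF mem(3) rel(3) k(3)] by simp
  qed
  have cancel: "inv g \<otimes> (g \<otimes> u) = u" if "g \<in> carrier G" "u \<in> carrier G" for g u
    using that by (simp flip: m_assoc)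
  show "inv x \<otimes> h [^] k1 \<otimes> (inv y \<otimes> h [^] k2) \<otimes>
      (y \<otimes> x \<otimes> h [^] (k3 - \<beta>)) = (h [^] d) [^] b"
  proof -
    have "inv x \<otimes> h [^] k1 \<otimes> (inv y \<otimes> h [^] k2) \<otimes>
        (y \<otimes> x \<otimes> h [^] (k3 - \<beta>)) =
      inv x \<otimes> (h [^] k1 \<otimes> inv y) \<otimes> (h [^] k2 \<otimes>
        (y \<otimes> x)) \<otimes> h [^] (k3 - \<beta>)"
      by (simp add: m_assoc)
    also have "\<dots> = inv x \<otimes> inv y \<otimes> (h [^] k1 \<otimes> (y \<otimes> x)) \<otimes> h [^] (k2 + (k3 - \<beta>))"
      using hc[of "inv y" k1] hc[of "y \<otimes> x" k2] by (simp add: m_assoc hh)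
    also have "\<dots> = h [^] (k1 + (k2 + (k3 - \<beta>)))"
      using hc[of "y \<otimes> x" k1] by (simp add: m_assoc hh cancel)
    also have "k1 + (k2 + (k3 - \<beta>)) = d * b" using k(4) by simp
    finally show ?thesis by (simp add: int_pow_pow)
  qed
qed

lemma abelian_cover_on_generators:
  fixes a1 a2 a3 :: nat and B c :: "int \<times> int \<times> int \<times> int"
  assumes c: "c = (b, b1, b2, b3)" and B: "B = (\<beta>, \<beta>1, \<beta>2, \<beta>3)"
    and k: "k1 * int a1 = - \<beta>1 - b1 * d" "k2 * int a2 = - \<beta>2 - b2 * d" "k3 * int a3 = - \<beta>3 - b3 * d"
      "k1 + k2 + k3 = d * b + \<beta>"
  defines "S \<equiv> seifert_group a1 a2 a3 B" and "e \<equiv> seif_elem a1 a2 a3 B"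
  obtains p where "p \<in> hom (seifert_group a1 a2 a3 c) S"
    "p (seif_elem a1 a2 a3 c Sx) = inv\<^bsub>S\<^esub> (e Sx) \<otimes>\<^bsub>S\<^esub> e Sh [^]\<^bsub>S\<^esub> k1"
    "p (seif_elem a1 a2 a3 c Sy) = inv\<^bsub>S\<^esub> (e Sy) \<otimes>\<^bsub>S\<^esub> e Sh [^]\<^bsub>S\<^esub> k2"
    "p (seif_elem a1 a2 a3 c Sz) = e Sy \<otimes>\<^bsub>S\<^esub> e Sx \<otimes>\<^bsub>S\<^esub> e Sh [^]\<^bsub>S\<^esub> (k3 - \<beta>)"
    "p (seif_elem a1 a2 a3 c Sh) = e Sh [^]\<^bsub>S\<^esub> d"
proof -
  interpret S: group S unfolding S_def by (rule group_seifert)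
  have mem [simp]: "e g \<in> carrier S" for g by (simp add: e_def S_def)
  note rels = seifert_relations[OF B, where ?a1.0 = a1 and ?a2.0 = a2
      and ?a3.0 = a3, folded S_def e_def]
  note refl = S.reflected_seifert_relations[OF mem mem mem mem rels k]
  have hd: "e Sh [^]\<^bsub>S\<^esub> d \<otimes>\<^bsub>S\<^esub> g = g \<otimes>\<^bsub>S\<^esub> e Sh [^]\<^bsub>S\<^esub> d" if "g \<in> carrier S" for g
    using S.central_int_pow[OF mem rels(5) that] .
  show thesis
    by (rule seifert_hom[OF S.group_axioms _ _ _ _ refl hd c]) (use that in simp_all)
qed

text \<open>Modulo the fibres, the covering homomorphism is the reflection of the triangle group. As the
  reflection is an involution, this controls both the kernel and the image of \<open>p\<close>.\<close>

lemma abelian_cover_projects: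
  fixes a1 a2 a3 :: nat and B c :: "int \<times> int \<times> int \<times> int"
  defines "S \<equiv> seifert_group a1 a2 a3 B" and "e \<equiv> seif_elem a1 a2 a3 B"
    and "T \<equiv> triangle_group a1 a2 a3" and "t \<equiv> tri_elem a1 a2 a3"
  assumes p: "p \<in> hom (seifert_group a1 a2 a3 c) S"
    "p (seif_elem a1 a2 a3 c Sx) = inv\<^bsub>S\<^esub> (e Sx) \<otimes>\<^bsub>S\<^esub> e Sh [^]\<^bsub>S\<^esub> (k1::int)"
    "p (seif_elem a1 a2 a3 c Sy) = inv\<^bsub>S\<^esub> (e Sy) \<otimes>\<^bsub>S\<^esub> e Sh [^]\<^bsub>S\<^esub> (k2::int)"
    "p (seif_elem a1 a2 a3 c Sz) = e Sy \<otimes>\<^bsub>S\<^esub> e Sx \<otimes>\<^bsub>S\<^esub> e Sh [^]\<^bsub>S\<^esub> (k3::int)"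
    "p (seif_elem a1 a2 a3 c Sh) = e Sh [^]\<^bsub>S\<^esub> (d::int)"
  obtains \<pi> \<pi>' r where "\<pi> \<in> hom S T" "\<pi> (e Sh) = \<one>\<^bsub>T\<^esub>"
    "\<And>g. g \<in> carrier S \<Longrightarrow> \<pi> g = \<one>\<^bsub>T\<^esub> \<Longrightarrow> \<exists>k::int. g = e Sh [^]\<^bsub>S\<^esub> k"
    "\<pi>' \<in> hom (seifert_group a1 a2 a3 c) T"
    "\<And>g. g \<in> carrier (seifert_group a1 a2 a3 c) \<Longrightarrow> \<pi>' g = \<one>\<^bsub>T\<^esub> \<Longrightarrow>
      \<exists>k::int. g = seif_elem a1 a2 a3 c Sh [^]\<^bsub>seifert_group a1 a2 a3 c\<^esub> k"
    "\<And>\<gamma>. \<gamma> \<in> carrier T \<Longrightarrow> \<exists>g\<in>carrier (seifert_group a1 a2 a3 c). \<pi>' g = \<gamma>"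
    "r \<in> hom T T" "\<And>\<gamma>. \<gamma> \<in> carrier T \<Longrightarrow> r (r \<gamma>) = \<gamma>"
    "\<And>g. g \<in> carrier (seifert_group a1 a2 a3 c) \<Longrightarrow> \<pi> (p g) = r (\<pi>' g)"
proof -
  obtain \<pi> where \<pi>: "\<pi> \<in> hom S T" "\<pi> (e Sx) = t Tx" "\<pi> (e Sy) = t Ty" "\<pi> (e Sz) = t Tz"
      "\<pi> (e Sh) = \<one>\<^bsub>T\<^esub>"
    using base_projection unfolding S_def T_def e_def t_def by metis
  define S' where "S' = seifert_group a1 a2 a3 c"
  define e' where "e' = seif_elem a1 a2 a3 c"
  obtain \<pi>' where \<pi>': "\<pi>' \<in> hom S' T" "\<pi>' (e' Sx) = t Tx" "\<pi>' (e' Sy) = t Ty" "\<pi>' (e' Sz) = t Tz"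
    "\<pi>' (e' Sh) = \<one>\<^bsub>T\<^esub>"
    using base_projection unfolding S'_def T_def e'_def t_def by metis
  obtain r where r: "r \<in> hom T T" "r (t Tx) = inv\<^bsub>T\<^esub> (t Tx)" "r (t Ty) = inv\<^bsub>T\<^esub> (t Ty)"
    "r (t Tz) = t Ty \<otimes>\<^bsub>T\<^esub> t Tx" "\<And>\<gamma>. \<gamma> \<in> carrier T \<Longrightarrow> r (r \<gamma>) = \<gamma>"
    using triangle_reflection unfolding T_def t_def by metis
  interpret T: group T unfolding T_def by (rule group_triangle)
  interpret S: group S unfolding S_def by (rule group_seifert)
  interpret \<pi>: group_hom S T \<pi> by (rule group_homI[OF S.group_axioms T.group_axioms \<pi>(1)])
  interpret r: group_hom T T r by (rule group_homI[OF T.group_axioms T.group_axioms r(1)])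
  have mem [simp]: "e g \<in> carrier S" "t s \<in> carrier T" for g s
    by (simp_all add: e_def S_def t_def T_def)
  have \<pi>h: "\<pi> (e Sh [^]\<^bsub>S\<^esub> (k::int)) = \<one>\<^bsub>T\<^esub>" for k
    by (simp add: \<pi>.hom_int_pow \<pi>(5) T.int_pow_one)
  have "(\<pi> \<circ> p) g = (r \<circ> \<pi>') g" if "g \<in> carrier S'" for g
  proof (rule seifert_hom_eqI[of "\<pi> \<circ> p" a1 a2 a3 c T "r \<circ> \<pi>'"])
    show "\<pi> \<circ> p \<in> hom (seifert_group a1 a2 a3 c) T" using p(1) \<pi>(1) by (rule Group.hom_compose)
    show "r \<circ> \<pi>' \<in> hom (seifert_group a1 a2 a3 c) T"
      using \<pi>'(1) r(1) unfolding S'_def by (rule Group.hom_compose)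
    show "(\<pi> \<circ> p) (seif_elem a1 a2 a3 c Sx) = (r \<circ> \<pi>') (seif_elem a1 a2 a3 c Sx)"
      using \<pi>'(2) by (simp add: p \<pi> \<pi>h r e'_def)
    show "(\<pi> \<circ> p) (seif_elem a1 a2 a3 c Sy) = (r \<circ> \<pi>') (seif_elem a1 a2 a3 c Sy)"
      using \<pi>'(3) by (simp add: p \<pi> \<pi>h r e'_def)
    show "(\<pi> \<circ> p) (seif_elem a1 a2 a3 c Sz) = (r \<circ> \<pi>') (seif_elem a1 a2 a3 c Sz)"
      using \<pi>'(4) by (simp add: p \<pi> \<pi>h r e'_def)
    show "(\<pi> \<circ> p) (seif_elem a1 a2 a3 c Sh) = (r \<circ> \<pi>') (seif_elem a1 a2 a3 c Sh)"
      using \<pi>'(5) by (simp add: p \<pi>h e'_def)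
    show "group T" by (rule T.group_axioms)
    show "g \<in> carrier (seifert_group a1 a2 a3 c)" using that by (simp add: S'_def)
  qed
  moreover have "\<exists>k::int. g = e Sh [^]\<^bsub>S\<^esub> k" if "g \<in> carrier S" "\<pi> g = \<one>\<^bsub>T\<^esub>" for g
    using base_projection_kernel[of \<pi> a1 a2 a3 B g] \<pi> that unfolding S_def T_def e_def t_def
        by metis
  moreover have "\<exists>k::int. g = e' Sh [^]\<^bsub>S'\<^esub> k" if "g \<in> carrier S'" "\<pi>' g = \<one>\<^bsub>T\<^esub>" for g
    using base_projection_kernel[of \<pi>' a1 a2 a3 c g] \<pi>' that unfolding S'_def T_def e'_def t_def
        by metis
  moreover have "\<exists>g\<in>carrier S'. \<pi>' g = \<gamma>" if "\<gamma> \<in> carrier T" for \<gamma>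
    using base_projection_surj[of \<pi>' a1 a2 a3 c \<gamma>] \<pi>' that unfolding S'_def T_def e'_def t_def
        by metis
  ultimately show thesis using \<pi>(1,5) \<pi>'(1) r(1,5)
    by (intro that[of \<pi> \<pi>' r]) (simp_all add: S'_def e'_def)
qed

section \<open>Perfect groups and central factors\<close>

lemma (in group) central_commutator:
  assumes mem: "u \<in> carrier G" "v \<in> carrier G" "c \<in> carrier G" "d \<in> carrier G"
    and c: "\<And>w. w \<in> carrier G \<Longrightarrow> c \<otimes> w = w \<otimes> c" and d: "\<And>w. w \<in> carrier G \<Longrightarrow> d \<otimes> w = w \<otimes> d"
  shows "(u \<otimes> c) \<otimes> (v \<otimes> d) \<otimes> inv (u \<otimes> c) \<otimes> inv (v \<otimes> d) = u \<otimes> v \<otimes> inv u \<otimes> inv v"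
proof -
  have "(u \<otimes> c) \<otimes> (v \<otimes> d) \<otimes> inv (u \<otimes> c) \<otimes> inv (v \<otimes> d) =
      u \<otimes> (c \<otimes> (v \<otimes> (d \<otimes> (inv c \<otimes> (inv u \<otimes> (inv d \<otimes> inv v))))))"
    using mem by (simp add: m_assoc inv_mult_group)
  also have "c \<otimes> (v \<otimes> (d \<otimes> (inv c \<otimes> (inv u \<otimes> (inv d \<otimes> inv v))))) =
      v \<otimes> (d \<otimes> (inv c \<otimes> (inv u \<otimes> (inv d \<otimes> inv v)))) \<otimes> c"
    using mem by (intro c) simp
  also have "d \<otimes> (inv c \<otimes> (inv u \<otimes> (inv d \<otimes> inv v))) = inv c \<otimes> (inv u \<otimes> (inv d \<otimes> inv v)) \<otimes> d"
    using mem by (intro d) simp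
  also have "v \<otimes> (inv c \<otimes> (inv u \<otimes> (inv d \<otimes> inv v)) \<otimes> d) \<otimes> c =
      v \<otimes> (inv c \<otimes> (inv u \<otimes> (inv d \<otimes> (inv v \<otimes> d \<otimes> c))))"
    using mem by (simp add: m_assoc)
  also have "inv v \<otimes> d \<otimes> c = c \<otimes> (d \<otimes> inv v)"
    using mem c[of "inv v \<otimes> d"] d[of "inv v"] by simp
  also have "inv d \<otimes> (c \<otimes> (d \<otimes> inv v)) = c \<otimes> inv v"
    using mem c[of "d \<otimes> inv v"] c[of "inv v"] by (simp add: m_assoc) (simp flip: m_assoc)
  also have "inv u \<otimes> (c \<otimes> inv v) = c \<otimes> (inv u \<otimes> inv v)"
    using mem c[of "inv u"] by (simp flip: m_assoc)
  also have "inv c \<otimes> (c \<otimes> (inv u \<otimes> inv v)) = inv u \<otimes> inv v"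
    using mem by (simp flip: m_assoc)
  finally show ?thesis using mem by (simp add: m_assoc)
qed

text \<open>Central factors drop out of commutators, so all commutators of \<open>S\<close> are images of commutators
  of \<open>G\<close>.\<close>

lemma perfect_central_extension_image:
  assumes G: "group G" and S: "group S" and p: "p \<in> hom G S"
    and perfect: "derived G (carrier G) = carrier G"
    and gen: "\<And>g. g \<in> carrier S \<Longrightarrow> \<exists>g'\<in>carrier G. \<exists>c\<in>carrier S.
      g = p g' \<otimes>\<^bsub>S\<^esub> c \<and> (\<forall>u\<in>carrier S. c \<otimes>\<^bsub>S\<^esub> u = u \<otimes>\<^bsub>S\<^esub> c)"
  shows "p ` carrier G = derived S (carrier S)"
proof
  interpret S: group S by (rule S)
  interpret p: group_hom G S p by (rule group_homI[OF G S p])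
  have "p ` carrier G = derived S (p ` carrier G)"
    using p.derived_img[of "carrier G"] perfect by simp
  also have "\<dots> \<subseteq> derived S (carrier S)"
    by (rule S.mono_derived) (auto simp: p.hom_closed)
  finally show "p ` carrier G \<subseteq> derived S (carrier S)" .
  show "derived S (carrier S) \<subseteq> p ` carrier G"
    unfolding derived_def
  proof (rule S.generate_subgroup_incl[OF _ p.img_is_subgroup])
    have "u \<otimes>\<^bsub>S\<^esub> v \<otimes>\<^bsub>S\<^esub> inv\<^bsub>S\<^esub> u \<otimes>\<^bsub>S\<^esub> inv\<^bsub>S\<^esub> v \<in> p ` carrier G"
      if uv: "u \<in> carrier S" "v \<in> carrier S" for u v
    proof -
      obtain u' c where u: "u' \<in> carrier G" "c \<in> carrier S" "u = p u' \<otimes>\<^bsub>S\<^esub> c"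
        and c: "\<And>w. w \<in> carrier S \<Longrightarrow> c \<otimes>\<^bsub>S\<^esub> w = w \<otimes>\<^bsub>S\<^esub> c" using gen[OF uv(1)] by blast
      obtain v' d where v: "v' \<in> carrier G" "d \<in> carrier S" "v = p v' \<otimes>\<^bsub>S\<^esub> d"
        and d: "\<And>w. w \<in> carrier S \<Longrightarrow> d \<otimes>\<^bsub>S\<^esub> w = w \<otimes>\<^bsub>S\<^esub> d" using gen[OF uv(2)] by blast
      have "u \<otimes>\<^bsub>S\<^esub> v \<otimes>\<^bsub>S\<^esub> inv\<^bsub>S\<^esub> u \<otimes>\<^bsub>S\<^esub> inv\<^bsub>S\<^esub> v =
          p u' \<otimes>\<^bsub>S\<^esub> p v' \<otimes>\<^bsub>S\<^esub> inv\<^bsub>S\<^esub> (p u') \<otimes>\<^bsub>S\<^esub> inv\<^bsub>S\<^esub> (p v')"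
        unfolding u(3) v(3) using u v by (intro S.central_commutator c d) auto
      also have "\<dots> = p (u' \<otimes>\<^bsub>G\<^esub> v' \<otimes>\<^bsub>G\<^esub> inv\<^bsub>G\<^esub> u' \<otimes>\<^bsub>G\<^esub> inv\<^bsub>G\<^esub> v')" using u v by simp
      finally show ?thesis by (rule image_eqI) (use u v in simp)
    qed
    then show "derived_set S (carrier S) \<subseteq> p ` carrier G" by blast
  qed
qed

text \<open>Homomorphisms that agree up to central factors agree on commutators.\<close>

lemma perfect_hom_eqI:
  assumes G: "group G" and H: "group H" and F: "F \<in> hom G H" "F' \<in> hom G H"
    and perfect: "derived G (carrier G) = carrier G"
    and central: "\<And>g. g \<in> carrier G \<Longrightarrow> \<exists>c\<in>carrier H. F g = F' g \<otimes>\<^bsub>H\<^esub> c \<and>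
      (\<forall>u\<in>carrier H. c \<otimes>\<^bsub>H\<^esub> u = u \<otimes>\<^bsub>H\<^esub> c)"
    and g: "g \<in> carrier G"
  shows "F g = F' g"
proof -
  interpret G: group G by (rule G)
  interpret H: group H by (rule H)
  interpret F: group_hom G H F by (rule group_homI[OF G H F(1)])
  interpret F': group_hom G H F' by (rule group_homI[OF G H F(2)])
  have "subgroup {g \<in> carrier G. F g = F' g} G"
    by (rule G.subgroupI) auto
  moreover have "derived_set G (carrier G) \<subseteq> {g \<in> carrier G. F g = F' g}"
  proof clarify
    fix u v assume uv: "u \<in> carrier G" "v \<in> carrier G"
    obtain c where u: "c \<in> carrier H" "F u = F' u \<otimes>\<^bsub>H\<^esub> c"
      and c: "\<And>w. w \<in> carrier H \<Longrightarrow> c \<otimes>\<^bsub>H\<^esub> w = w \<otimes>\<^bsub>H\<^esub> c" using central[OF uv(1)] by blast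
    obtain d where v: "d \<in> carrier H" "F v = F' v \<otimes>\<^bsub>H\<^esub> d"
      and d: "\<And>w. w \<in> carrier H \<Longrightarrow> d \<otimes>\<^bsub>H\<^esub> w = w \<otimes>\<^bsub>H\<^esub> d" using central[OF uv(2)] by blast
    have "F u \<otimes>\<^bsub>H\<^esub> F v \<otimes>\<^bsub>H\<^esub> inv\<^bsub>H\<^esub> (F u) \<otimes>\<^bsub>H\<^esub> inv\<^bsub>H\<^esub> (F v) =
        F' u \<otimes>\<^bsub>H\<^esub> F' v \<otimes>\<^bsub>H\<^esub> inv\<^bsub>H\<^esub> (F' u) \<otimes>\<^bsub>H\<^esub> inv\<^bsub>H\<^esub> (F' v)"
      unfolding u(2) v(2) using u v uv by (intro H.central_commutator c d) auto
    then show "u \<otimes>\<^bsub>G\<^esub> v \<otimes>\<^bsub>G\<^esub> inv\<^bsub>G\<^esub> u \<otimes>\<^bsub>G\<^esub> inv\<^bsub>G\<^esub> v \<in> carrier G \<and>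
        F (u \<otimes>\<^bsub>G\<^esub> v \<otimes>\<^bsub>G\<^esub> inv\<^bsub>G\<^esub> u \<otimes>\<^bsub>G\<^esub> inv\<^bsub>G\<^esub> v) = F' (u \<otimes>\<^bsub>G\<^esub> v \<otimes>\<^bsub>G\<^esub> inv\<^bsub>G\<^esub> u \<otimes>\<^bsub>G\<^esub> inv\<^bsub>G\<^esub> v)"
      using uv by simp
  qed
  ultimately have "derived G (carrier G) \<subseteq> {g \<in> carrier G. F g = F' g}"
    unfolding derived_def by (rule G.generate_subgroup_incl[rotated])
  then show ?thesis using perfect g by blast
qed

text \<open>The power of \<open>x y z = h\<^sup>b\<close> with exponent \<open>a\<^sub>1 a\<^sub>2 a\<^sub>3\<close> rewrites, through the other relations, to
  \<open>h = 1\<close>. Then the orders of \<open>x\<close>, \<open>y\<close> and \<open>z\<close> are pairwise coprime and their product is trivial.\<close>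

lemma (in comm_group) abelian_brieskorn_trivial:
  fixes a1 a2 a3 b b1 b2 b3 :: int
  assumes mem: "x \<in> carrier G" "y \<in> carrier G" "z \<in> carrier G" "h \<in> carrier G"
    and rel: "x [^] a1 = h [^] (- b1)" "y [^] a2 = h [^] (- b2)" "z [^] a3 = h [^] (- b3)"
      "x \<otimes> y \<otimes> z = h [^] b"
    and unit: "b * a1 * a2 * a3 + b1 * a2 * a3 + b2 * a1 * a3 + b3 * a1 * a2 = 1"
    and cop: "coprime a1 (a2 * a3)" "coprime a2 (a1 * a3)" "coprime a3 (a1 * a2)"
  shows "x = \<one>" "y = \<one>" "z = \<one>" "h = \<one>"
proof -
  let ?a = "a1 * a2 * a3"
  have pw: "g [^] ?a = h [^] (- m * (n1 * n2))"
    if "g \<in> carrier G" "g [^] n = h [^] (- m)" "?a = n * (n1 * n2)" for g n m n1 n2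
    using that mem(4) by (metis int_pow_pow)
  have "h [^] (b * ?a) = (x \<otimes> y \<otimes> z) [^] ?a" using mem by (simp add: rel int_pow_pow)
  also have "\<dots> = x [^] ?a \<otimes> y [^] ?a \<otimes> z [^] ?a" using mem by (simp add: int_pow_distrib)
  also have "x [^] ?a = h [^] (- b1 * (a2 * a3))"
    by (rule pw[OF mem(1) rel(1)]) simp
  also have "y [^] ?a = h [^] (- b2 * (a1 * a3))"
    by (rule pw[OF mem(2) rel(2)]) simp
  also have "z [^] ?a = h [^] (- b3 * (a1 * a2))"
    by (rule pw[OF mem(3) rel(3)]) simp
  also have "h [^] (- b1 * (a2 * a3)) \<otimes> h [^] (- b2 * (a1 * a3)) \<otimes> h [^] (- b3 * (a1 * a2)) =
      h [^] (- b1 * (a2 * a3) + - b2 * (a1 * a3) + - b3 * (a1 * a2))"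
    using mem(4) by (simp only: int_pow_mult)
  finally have "h [^] (b * ?a) \<otimes> inv (h [^] (- b1 * (a2 * a3) + - b2 * (a1 * a3) + - b3 * (a1 *
      a2))) = \<one>"
    using mem(4) by simp
  then have "h [^] (b * ?a - (- b1 * (a2 * a3) + - b2 * (a1 * a3) + - b3 * (a1 * a2))) = \<one>"
    using int_pow_diff[OF mem(4)] by simp
  moreover have "b * ?a - (- b1 * (a2 * a3) + - b2 * (a1 * a3) + - b3 * (a1 * a2)) = 1"
    using unit by (simp add: algebra_simps)
  ultimately show h: "h = \<one>" using mem(4) by (metis int_pow_1)
  have one: "x [^] a1 = \<one>" "y [^] a2 = \<one>" "z [^] a3 = \<one>" "x \<otimes> y \<otimes> z = \<one>"
    using rel by (simp_all add: h)
  have kill: "g = \<one>"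
    if g: "g \<in> carrier G" "g [^] (m::int) = \<one>" "g [^] n = \<one>" "coprime m n" for g m n
  proof -
    obtain u v where uv: "u * m + v * n = 1" using bezout_int[of m n] g(4) by auto
    have "g [^] (u * m + v * n) = (g [^] m) [^] u \<otimes> (g [^] n) [^] v"
      using g(1) by (simp add: int_pow_mult int_pow_pow mult.commute)
    then show ?thesis using g uv by simp
  qed
  have pm: "g [^] (m * n) = \<one>" "g [^] (n * m) = \<one>" if "g \<in> carrier G" "g [^] m = \<one>" for g
      and m n :: int
    using that by (metis int_pow_one int_pow_pow mult.commute)+
  have "(x \<otimes> y \<otimes> z) [^] n = x [^] n \<otimes> y [^] n \<otimes> z [^] n" for n :: int
    using mem by (simp add: int_pow_distrib)
  then have prod: "x [^] n \<otimes> y [^] n \<otimes> z [^] n = \<one>" for n :: int using one(4) by simp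
  have "x [^] (a2 * a3) = \<one>"
    using prod[of "a2 * a3"] pm[OF mem(2) one(2)] pm[OF mem(3) one(3)] mem by simp
  then show "x = \<one>" using kill[OF mem(1) one(1)] cop(1) by simp
  have "y [^] (a1 * a3) = \<one>"
    using prod[of "a1 * a3"] pm[OF mem(1) one(1)] pm[OF mem(3) one(3)] mem by simp
  then show "y = \<one>" using kill[OF mem(2) one(2)] cop(2) by simp
  have "z [^] (a1 * a2) = \<one>"
    using prod[of "a1 * a2"] pm[OF mem(1) one(1)] pm[OF mem(2) one(2)] mem by simp
  then show "z = \<one>" using kill[OF mem(3) one(3)] cop(3) by simp
qed

lemma clear_denominators:
  fixes u v w :: "'a::field"
  assumes "u \<noteq> 0" "v \<noteq> 0" "w \<noteq> 0"
  shows "u * v * w * (x0 + x1 / u + x2 / v + x3 / w) =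
    x0 * u * v * w + x1 * v * w + x2 * u * w + x3 * u * v"
  using assms by (simp add: field_simps)

lemma brieskorn_data_int:
  assumes "0 < a1" "0 < a2" "0 < a3" "brieskorn_data a1 a2 a3 (b, b1, b2, b3)"
  shows "b * int a1 * int a2 * int a3 + b1 * int a2 * int a3 + b2 * int a1 * int a3
    + b3 * int a1 * int a2 = 1"
proof -
  have "(of_int (b * int a1 * int a2 * int a3 + b1 * int a2 * int a3 + b2 * int a1 * int a3
    + b3 * int a1 * int a2) :: rat) = of_int 1"
    using assms(4) clear_denominators[of "of_nat a1" "of_nat a2" "of_nat a3 :: rat"] assms(1-3)
    by (simp add: brieskorn_data_def)
  then show ?thesis by (simp only: of_int_eq_iff)
qed

text \<open>\<open>\<Sigma>(a\<^sub>1, a\<^sub>2, a\<^sub>3)\<close> is a homology sphere, so the abelianized group is trivial.\<close>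

lemma brieskorn_perfect:
  fixes a1 a2 a3 :: nat and b b1 b2 b3 :: int
  assumes a: "0 < a1" "0 < a2" "0 < a3"
    and cop: "coprime a1 a2" "coprime a1 a3" "coprime a2 a3"
    and data: "brieskorn_data a1 a2 a3 (b, b1, b2, b3)"
  defines "G \<equiv> pi1_brieskorn a1 a2 a3 (b, b1, b2, b3)"
  shows "derived G (carrier G) = carrier G"
proof -
  define e where "e = seif_elem a1 a2 a3 (b, b1, b2, b3)"
  interpret G: group G unfolding G_def by (rule group_seifert)
  have mem [simp]: "e g \<in> carrier G" for g by (simp add: e_def G_def)
  note rels = seifert_relations[OF HOL.refl, where ?a1.0 = a1 and ?a2.0 = a2 and ?a3.0 = a3
      and \<beta> = b and ?\<beta>1.0 = b1 and ?\<beta>2.0 = b2 and ?\<beta>3.0 = b3, folded G_def e_def]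
  define D where "D = derived G (carrier G)"
  have subD: "subgroup D G" unfolding D_def by (rule G.derived_is_subgroup) simp
  have "D \<lhd> G" unfolding D_def by (rule G.derived_self_is_normal)
  then interpret D: normal D G .
  interpret Q: comm_group "G Mod D" unfolding D_def by (rule G.derived_quot_is_comm_group)
  define c where "c = (\<lambda>g. D #>\<^bsub>G\<^esub> g)"
  have c: "c \<in> hom G (G Mod D)" unfolding c_def by (rule D.r_coset_hom_Mod)
  interpret c: group_hom G "G Mod D" c by (rule group_homI[OF G.group_axioms Q.group_axioms c])
  have cop': "coprime (int a1) (int a2 * int a3)" "coprime (int a2) (int a1 * int a3)"
    "coprime (int a3) (int a1 * int a2)"
    using cop by (simp_all add: coprime_commute)
  have "c (e Sx) [^]\<^bsub>G Mod D\<^esub> int a1 = c (e Sh) [^]\<^bsub>G Mod D\<^esub> (- b1)"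
    "c (e Sy) [^]\<^bsub>G Mod D\<^esub> int a2 = c (e Sh) [^]\<^bsub>G Mod D\<^esub> (- b2)"
    "c (e Sz) [^]\<^bsub>G Mod D\<^esub> int a3 = c (e Sh) [^]\<^bsub>G Mod D\<^esub> (- b3)"
    "c (e Sx) \<otimes>\<^bsub>G Mod D\<^esub> c (e Sy) \<otimes>\<^bsub>G Mod D\<^esub> c (e Sz) = c (e Sh) [^]\<^bsub>G Mod D\<^esub> b"
    using rels(1-4) by (simp_all add: int_pow_int flip: c.hom_int_pow c.hom_nat_pow c.hom_mult
        del: mult_FactGroup one_FactGroup)
  note triv = Q.abelian_brieskorn_trivial[OF c.hom_closed[OF mem] c.hom_closed[OF mem]
      c.hom_closed[OF mem] c.hom_closed[OF mem] this brieskorn_data_int[OF a data] cop']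
  have "c (e g) = \<one>\<^bsub>G Mod D\<^esub>" for g
    using triv by (cases g) simp_all
  then have "e g \<in> D" for g
    using G.rcos_self[OF mem subD, of g] unfolding c_def one_FactGroup by simp
  then have "carrier G \<subseteq> D"
    using seifert_subgroup_top[of D a1 a2 a3 "(b, b1, b2, b3)"] subD unfolding G_def e_def by blast
  then show ?thesis using subgroup.subset[OF subD] unfolding D_def by blast
qed

lemma euler_degree:
  fixes a1 a2 a3 :: nat
  assumes "0 < a1" "0 < a2" "0 < a3"
  shows "of_nat (a1 * a2 * a3) * seifert_euler_number a1 a2 a3 (\<beta>, \<beta>1, \<beta>2, \<beta>3) =
    of_int (- (\<beta> * int a1 * int a2 * int a3 + \<beta>1 * int a2 * int a3 + \<beta>2 * int a1 * int a3
      + \<beta>3 * int a1 * int a2))"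
proof -
  have "of_nat (a1 * a2 * a3) * seifert_euler_number a1 a2 a3 (\<beta>, \<beta>1, \<beta>2, \<beta>3) =
      - (of_nat a1 * of_nat a2 * of_nat a3 * (of_int \<beta> + of_int \<beta>1 / of_nat a1 +
        of_int \<beta>2 / of_nat a2 + of_int \<beta>3 / of_nat a3))"
    by (simp only: seifert_euler_number.simps of_nat_mult mult_minus_right)
  also have "\<dots> = of_int (- (\<beta> * int a1 * int a2 * int a3 + \<beta>1 * int a2 * int a3 + \<beta>2 * int a1 *
      int a3
      + \<beta>3 * int a1 * int a2))"
    using assms by (subst clear_denominators) simp_all
  finally show ?thesis .
qed

lemma euler_degree_floor:
  fixes a1 a2 a3 :: nat
  assumes "0 < a1" "0 < a2" "0 < a3" "d > 0"
    and "d = int a1 * int a2 * int a3 - \<beta>1 * int a2 * int a3 - \<beta>2 * int a1 * int a3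
      - \<beta>3 * int a1 * int a2"
  shows "\<lfloor>of_nat (a1 * a2 * a3) * \<bar>seifert_euler_number a1 a2 a3 (- 1, \<beta>1, \<beta>2, \<beta>3)\<bar>\<rfloor> = d"
proof -
  have "of_nat (a1 * a2 * a3) * seifert_euler_number a1 a2 a3 (- 1, \<beta>1, \<beta>2, \<beta>3) = of_int d"
    unfolding euler_degree[OF assms(1-3)] assms(5) by (simp add: algebra_simps)
  then have "of_nat (a1 * a2 * a3) * \<bar>seifert_euler_number a1 a2 a3 (- 1, \<beta>1, \<beta>2, \<beta>3)\<bar> = \<bar>of_int d\<bar>"
    by (metis abs_mult abs_of_nat)
  then show ?thesis using assms(4) by simp
qed

section \<open>Representations induced by Euler classes\<close>

lemma signs_normal: "{mat 1, - mat 1} \<lhd> (SL2 :: ('a::field ^ 2 ^ 2) monoid)"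
proof -
  interpret group "SL2 :: ('a ^ 2 ^ 2) monoid" by (rule group_SL2)
  have neg: "inv\<^bsub>SL2\<^esub> (- mat 1) = (- mat 1 :: 'a ^ 2 ^ 2)" by (rule inv_equality) simp_all
  have "subgroup {mat 1, - mat 1 :: 'a ^ 2 ^ 2} SL2"
  proof (rule subgroupI)
    show "inv\<^bsub>SL2\<^esub> A \<in> {mat 1, - mat 1}" if "A \<in> {mat 1, - mat 1}" for A :: "'a ^ 2 ^ 2"
      using that neg inv_one by auto
  qed auto
  moreover have "A \<otimes>\<^bsub>SL2\<^esub> u \<otimes>\<^bsub>SL2\<^esub> inv\<^bsub>SL2\<^esub> A \<in> {mat 1, - mat 1}"
    if "A \<in> carrier SL2" "u \<in> {mat 1, - mat 1}" for A u :: "'a ^ 2 ^ 2"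
    using that r_inv[OF that(1)] by auto
  ultimately show ?thesis by (rule normal_invI)
qed

lemma group_PSL2R: "group PSL2R"
  unfolding PSL2R_def by (rule normal.factorgroup_is_group[OF signs_normal])

lemma PSL2R_class: "{mat 1, - mat 1} #>\<^bsub>SL2\<^esub> A = {A, - A}"
  by (auto simp: r_coset_def)

lemma to_PSL2R_hom: "to_PSL2R \<in> hom PSL2R_cover PSL2R"
proof -
  have "(\<lambda>A. {mat 1, - mat 1} #>\<^bsub>SL2\<^esub> A) \<circ> to_SL2R \<in> hom PSL2R_cover PSL2R"
    unfolding PSL2R_def
    by (rule Group.hom_compose[OF to_SL2R_hom normal.r_coset_hom_Mod[OF signs_normal]])
  then show ?thesis by (simp add: comp_def to_PSL2R_def[abs_def])
qed

lemma to_PSL2R_sh: "to_PSL2R (sh (of_int k)) = \<one>\<^bsub>PSL2R\<^esub>"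
  unfolding PSL2R_def to_PSL2R_def to_SL2R_sh rot_int PSL2R_class by auto

lemma same_PSL2R:
  assumes g: "g \<in> carrier PSL2R_cover" and h: "h \<in> carrier PSL2R_cover" and eq:
      "to_PSL2R g = to_PSL2R h"
  obtains k :: int where "g = sh (of_int k) \<circ> h"
proof -
  have "to_SL2R g = to_SL2R h \<or> to_SL2R g = - to_SL2R h"
    using eq unfolding to_PSL2R_def PSL2R_class by blast
  then show thesis
  proof
    assume "to_SL2R g = to_SL2R h"
    then obtain m :: int where "g = sh (2 * of_int m) \<circ> h" by (rule same_SL2R[OF g h])
    then show thesis using that[of "2 * m"] by simp
  next
    assume neg: "to_SL2R g = - to_SL2R h"
    have mem: "sh 1 \<circ> h \<in> carrier PSL2R_cover"
      using group.is_monoid[OF group_cover, THEN monoid.m_closed, OF sh_in_cover[of 1] h] by simp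
    have "to_SL2R (sh 1 \<circ> h) = rot (pi * of_int 1) ** to_SL2R h"
      using hom_mult[OF to_SL2R_hom sh_in_cover[of 1] h] by (simp add: to_SL2R_sh)
    then have "to_SL2R g = to_SL2R (sh 1 \<circ> h)" unfolding rot_int using neg by simp
    then obtain m :: int where "g = sh (2 * of_int m) \<circ> (sh 1 \<circ> h)" by (rule same_SL2R[OF g mem])
    then have "g = sh (of_int (2 * m + 1)) \<circ> h" by (simp add: sh_add flip: comp_assoc)
    then show thesis by (rule that)
  qed
qed

lemma pullback_mult:
  "(\<gamma>, g) \<otimes>\<^bsub>pullback_extension a1 a2 a3 f\<^esub> (\<gamma>', g') = (\<gamma> \<otimes>\<^bsub>triangle_group a1 a2 a3\<^esub> \<gamma>', g \<circ> g')"
  by (simp add: pullback_extension_def)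

lemma pullback_carrier:
  "(\<gamma>, g) \<in> carrier (pullback_extension a1 a2 a3 f) \<longleftrightarrow>
    \<gamma> \<in> carrier (triangle_group a1 a2 a3) \<and> g \<in> carrier PSL2R_cover \<and> f \<gamma> = to_PSL2R g"
  by (simp add: pullback_extension_def)

text \<open>A homomorphism from the Seifert group to the cover that maps the fibre to \<open>sh 1\<close> descends to
  a homomorphism \<open>f\<close> of the triangle group. Together with the projection to the triangle group it
  is a map of central extensions by \<open>\<int>\<close> that is the identity on \<open>\<int>\<close>, hence an isomorphism onto the
  pull-back.\<close>

lemma euler_identification_exists:
  fixes a1 a2 a3 :: nat and B :: "int \<times> int \<times> int \<times> int"
  assumes \<Phi>: "\<Phi> \<in> hom (seifert_group a1 a2 a3 B) PSL2R_cover" "\<Phi> (seif_elem a1 a2 a3 B Sh) = sh 1"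
  obtains f \<psi> where "f \<in> hom (triangle_group a1 a2 a3) PSL2R" "euler_identification a1 a2 a3 f B \<psi>"
    "\<And>g. snd (\<psi> g) = \<Phi> g"
proof -
  define S where "S = seifert_group a1 a2 a3 B"
  define e where "e = seif_elem a1 a2 a3 B"
  define T where "T = triangle_group a1 a2 a3"
  define t where "t = tri_elem a1 a2 a3"
  obtain \<beta> \<beta>1 \<beta>2 \<beta>3 where B: "B = (\<beta>, \<beta>1, \<beta>2, \<beta>3)" by (metis prod_cases4)
  note rels = seifert_relations[OF B, where ?a1.0 = a1 and ?a2.0 = a2
      and ?a3.0 = a3, folded S_def e_def]
  interpret S: group S unfolding S_def by (rule group_seifert)
  interpret T: group T unfolding T_def by (rule group_triangle)
  interpret C: group PSL2R_cover by (rule group_cover)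
  interpret P: group PSL2R by (rule group_PSL2R)
  have mem [simp]: "e g \<in> carrier S" for g by (simp add: e_def S_def)
  note \<Phi> = \<Phi>[folded S_def e_def]
  interpret \<Phi>: group_hom S PSL2R_cover \<Phi> by (rule group_homI[OF S.group_axioms C.group_axioms \<Phi>(1)])
  define q where "q = to_PSL2R \<circ> \<Phi>"
  have q: "q \<in> hom S PSL2R" unfolding q_def by (rule Group.hom_compose[OF \<Phi>(1) to_PSL2R_hom])
  interpret q: group_hom S PSL2R q by (rule group_homI[OF S.group_axioms P.group_axioms q])
  have \<Phi>h: "\<Phi> (e Sh [^]\<^bsub>S\<^esub> (k::int)) = sh (of_int k)" for k
    by (simp add: \<Phi>.hom_int_pow \<Phi>(2) sh_int_pow)
  then have qh: "q (e Sh [^]\<^bsub>S\<^esub> (k::int)) = \<one>\<^bsub>PSL2R\<^esub>" for k by (simp add: q_def to_PSL2R_sh)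
  obtain \<pi> where \<pi>: "\<pi> \<in> hom S T" "\<pi> (e Sx) = t Tx" "\<pi> (e Sy) = t Ty" "\<pi> (e Sz) = t Tz"
      "\<pi> (e Sh) = \<one>\<^bsub>T\<^esub>"
    using base_projection unfolding S_def T_def e_def t_def by metis
  interpret \<pi>: group_hom S T \<pi> by (rule group_homI[OF S.group_axioms T.group_axioms \<pi>(1)])
  have kernel: "\<exists>k::int. g = e Sh [^]\<^bsub>S\<^esub> k" if "g \<in> carrier S" "\<pi> g = \<one>\<^bsub>T\<^esub>" for g
    using base_projection_kernel[of \<pi> a1 a2 a3 B g] \<pi> that unfolding S_def T_def e_def t_def
        by metis
  have qrel: "q (e Sx) [^]\<^bsub>PSL2R\<^esub> a1 = \<one>\<^bsub>PSL2R\<^esub>" "q (e Sy) [^]\<^bsub>PSL2R\<^esub> a2 = \<one>\<^bsub>PSL2R\<^esub>"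
    "q (e Sz) [^]\<^bsub>PSL2R\<^esub> a3 = \<one>\<^bsub>PSL2R\<^esub>" "q (e Sx) \<otimes>\<^bsub>PSL2R\<^esub> q (e Sy) \<otimes>\<^bsub>PSL2R\<^esub> q (e Sz) = \<one>\<^bsub>PSL2R\<^esub>"
    using rels(1-4) qh by (simp_all flip: q.hom_nat_pow q.hom_mult)
  have qmem: "q (e g) \<in> carrier PSL2R" for g by (rule q.hom_closed[OF mem])
  obtain f where f: "f \<in> hom T PSL2R" "f (t Tx) = q (e Sx)" "f (t Ty) = q (e Sy)"
      "f (t Tz) = q (e Sz)"
    by (rule triangle_hom[OF group_PSL2R qmem qmem qmem qrel]) (simp_all add: T_def t_def)
  interpret f: group_hom T PSL2R f by (rule group_homI[OF T.group_axioms P.group_axioms f(1)])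
  have f\<pi>: "f (\<pi> g) = to_PSL2R (\<Phi> g)" if "g \<in> carrier S" for g
  proof -
    have "(f \<circ> \<pi>) g = q g"
    proof (rule seifert_hom_eqI[of "f \<circ> \<pi>" a1 a2 a3 B PSL2R q])
      show "f \<circ> \<pi> \<in> hom (seifert_group a1 a2 a3 B) PSL2R"
        using Group.hom_compose[OF \<pi>(1) f(1)] by (simp add: S_def)
      show "q \<in> hom (seifert_group a1 a2 a3 B) PSL2R" using q by (simp add: S_def)
      show "(f \<circ> \<pi>) (seif_elem a1 a2 a3 B Sh) = q (seif_elem a1 a2 a3 B Sh)"
        using qh[of 1] \<pi>(5) by (simp flip: e_def)
    qed (use that \<pi> f P.group_axioms in \<open>simp_all flip: e_def S_def\<close>)
    then show ?thesis by (simp add: q_def)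
  qed
  define \<psi> where "\<psi> g = (\<pi> g, \<Phi> g)" for g
  have "\<psi> \<in> iso S (pullback_extension a1 a2 a3 f)"
  proof (rule isoI)
    show "\<psi> \<in> hom S (pullback_extension a1 a2 a3 f)"
    proof (rule homI)
      fix g assume "g \<in> carrier S"
      then show "\<psi> g \<in> carrier (pullback_extension a1 a2 a3 f)"
        unfolding \<psi>_def pullback_carrier T_def[symmetric] using f\<pi> by simp
    next
      fix g g' assume "g \<in> carrier S" "g' \<in> carrier S"
      then show "\<psi> (g \<otimes>\<^bsub>S\<^esub> g') = \<psi> g \<otimes>\<^bsub>pullback_extension a1 a2 a3 f\<^esub> \<psi> g'"
        unfolding \<psi>_def pullback_mult T_def[symmetric] by simp
    qed
    have "inj_on \<psi> (carrier S)"
    proof (rule inj_onI)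
      fix g g' assume g: "g \<in> carrier S" "g' \<in> carrier S" and eq: "\<psi> g = \<psi> g'"
      have "\<pi> (g \<otimes>\<^bsub>S\<^esub> inv\<^bsub>S\<^esub> g') = \<one>\<^bsub>T\<^esub>" using g eq by (simp add: \<psi>_def)
      with g have "\<exists>k::int. g \<otimes>\<^bsub>S\<^esub> inv\<^bsub>S\<^esub> g' = e Sh [^]\<^bsub>S\<^esub> k" by (intro kernel) simp_all
      then obtain k :: int where k: "g \<otimes>\<^bsub>S\<^esub> inv\<^bsub>S\<^esub> g' = e Sh [^]\<^bsub>S\<^esub> k" ..
      have "\<Phi> g = \<Phi> g'" using eq by (simp add: \<psi>_def)
      then have "\<Phi> (g \<otimes>\<^bsub>S\<^esub> inv\<^bsub>S\<^esub> g') = \<one>\<^bsub>PSL2R_cover\<^esub>"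
        using g by (simp only: \<Phi>.hom_mult \<Phi>.hom_inv S.inv_closed C.r_inv \<Phi>.hom_closed)
      then have "sh (of_int k) = sh 0" unfolding k \<Phi>h by (simp add: sh_0)
      then have "k = 0" by simp
      then have "g \<otimes>\<^bsub>S\<^esub> inv\<^bsub>S\<^esub> g' = \<one>\<^bsub>S\<^esub>" using k by simp
      then have "inv\<^bsub>S\<^esub> (inv\<^bsub>S\<^esub> g') = g" using g by (intro S.inv_equality) simp_all
      then show "g = g'" using g(2) by simp
    qed
    moreover have "\<psi> ` carrier S = carrier (pullback_extension a1 a2 a3 f)"
    proof
      show "\<psi> ` carrier S \<subseteq> carrier (pullback_extension a1 a2 a3 f)"
        unfolding \<psi>_def using f\<pi> by (auto simp: pullback_carrier simp flip: T_def)
      show "carrier (pullback_extension a1 a2 a3 f) \<subseteq> \<psi> ` carrier S"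
      proof clarify
        fix \<gamma> g assume "(\<gamma>, g) \<in> carrier (pullback_extension a1 a2 a3 f)"
        then have \<gamma>: "\<gamma> \<in> carrier T" "g \<in> carrier PSL2R_cover" "f \<gamma> = to_PSL2R g"
          by (simp_all add: pullback_carrier T_def)
        obtain s where s: "s \<in> carrier S" "\<pi> s = \<gamma>"
          using base_projection_surj[of \<pi> a1 a2 a3 B \<gamma>] \<pi> \<gamma>(1) unfolding S_def T_def e_def t_def
              by metis
        have "to_PSL2R g = to_PSL2R (\<Phi> s)" using f\<pi>[OF s(1)] s(2) \<gamma>(3) by simp
        then obtain k :: int where k: "g = sh (of_int k) \<circ> \<Phi> s"
          by (rule same_PSL2R[OF \<gamma>(2) \<Phi>.hom_closed[OF s(1)]])
        have "\<psi> (e Sh [^]\<^bsub>S\<^esub> k \<otimes>\<^bsub>S\<^esub> s) = (\<gamma>, g)"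
          using s \<gamma>(1) by (simp add: \<psi>_def \<pi>.hom_int_pow \<pi>(5) \<Phi>h k)
        then show "(\<gamma>, g) \<in> \<psi> ` carrier S" using s by (intro image_eqI[of _ _
            "e Sh [^]\<^bsub>S\<^esub> k \<otimes>\<^bsub>S\<^esub> s"]) simp_all
      qed
    qed
    ultimately show "bij_betw \<psi> (carrier S) (carrier (pullback_extension a1 a2 a3 f))"
      by (simp add: bij_betw_def)
  qed
  then have "euler_identification a1 a2 a3 f B \<psi>"
    unfolding euler_identification_def using \<pi> \<Phi>(2)
        by (simp add: \<psi>_def flip: S_def T_def e_def t_def)
  then show thesis using f(1) by (intro that[of f \<psi>]) (simp_all add: T_def \<psi>_def)
qed

section \<open>Existence of the induced representations\<close>

text \<open>Modulo \<open>a\<^sub>1\<close>, the hypothesis \<open>unit\<close> reads \<open>b\<^sub>1 a\<^sub>2 a\<^sub>3 = 1\<close> and the definition of \<open>d\<close> reads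
  \<open>d = - \<beta>\<^sub>1 a\<^sub>2 a\<^sub>3\<close>, so \<open>b\<^sub>1 d = - \<beta>\<^sub>1\<close>; similarly for the other two indices. The sum of the three
  quotients follows by clearing denominators.\<close>

lemma cover_multipliers:
  fixes a1 a2 a3 b b1 b2 b3 \<beta>1 \<beta>2 \<beta>3 :: int
  assumes nz: "a1 \<noteq> 0" "a2 \<noteq> 0" "a3 \<noteq> 0"
    and unit: "b * a1 * a2 * a3 + b1 * a2 * a3 + b2 * a1 * a3 + b3 * a1 * a2 = 1"
    and d: "d = a1 * a2 * a3 - \<beta>1 * a2 * a3 - \<beta>2 * a1 * a3 - \<beta>3 * a1 * a2"
  obtains k1 k2 k3 where "k1 * a1 = - \<beta>1 - b1 * d" "k2 * a2 = - \<beta>2 - b2 * d"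
      "k3 * a3 = - \<beta>3 - b3 * d"
    "k1 + k2 + k3 = d * b + (- 1)"
proof -
  have k: "\<exists>k. k * u = - \<mu> - m * d"
    if "m * (v * w) = 1 - u * r" "d = u * s - \<mu> * (v * w)" for u v w r s \<mu> m
  proof -
    have "m * d = m * u * s - \<mu> * (m * (v * w))" unfolding that(2) by (simp add: algebra_simps)
    also have "\<dots> = m * u * s - \<mu> * (1 - u * r)" unfolding that(1) ..
    finally have "(- \<mu> * r - m * s) * u = - \<mu> - m * d" by (simp add: algebra_simps)
    then show ?thesis by blast
  qed
  obtain k1 where k1: "k1 * a1 = - \<beta>1 - b1 * d"
    using k[of b1 a2 a3 a1 "b * a2 * a3 + b2 * a3 + b3 * a2"
        "a2 * a3 - \<beta>2 * a3 - \<beta>3 * a2" \<beta>1] unit d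
    by (auto simp: algebra_simps)
  obtain k2 where k2: "k2 * a2 = - \<beta>2 - b2 * d"
    using k[of b2 a1 a3 a2 "b * a1 * a3 + b1 * a3 + b3 * a1"
        "a1 * a3 - \<beta>1 * a3 - \<beta>3 * a1" \<beta>2] unit d
    by (auto simp: algebra_simps)
  obtain k3 where k3: "k3 * a3 = - \<beta>3 - b3 * d"
    using k[of b3 a1 a2 a3 "b * a1 * a2 + b1 * a2 + b2 * a1"
        "a1 * a2 - \<beta>1 * a2 - \<beta>2 * a1" \<beta>3] unit d
    by (auto simp: algebra_simps)
  have "(a1 * a2 * a3) * (k1 + k2 + k3) = (k1 * a1) * (a2 * a3) + (k2 * a2) * (a1 * a3) + (k3 *
      a3) * (a1 * a2)"
    by (simp add: algebra_simps)
  also have "\<dots> = - (\<beta>1 * a2 * a3 + \<beta>2 * a1 * a3 + \<beta>3 * a1 * a2) - d * (b1 * a2 * a3 + b2 * a1 * a3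
      + b3 * a1 * a2)"
    unfolding k1 k2 k3 by (simp add: algebra_simps)
  also have "b1 * a2 * a3 + b2 * a1 * a3 + b3 * a1 * a2 = 1 - b * a1 * a2 * a3" using unit by simp
  also have "\<beta>1 * a2 * a3 + \<beta>2 * a1 * a3 + \<beta>3 * a1 * a2 = a1 * a2 * a3 - d" using d by simp
  finally have "(a1 * a2 * a3) * (k1 + k2 + k3) = (a1 * a2 * a3) * (d * b + (- 1))"
      by (simp add: algebra_simps)
  then have "k1 + k2 + k3 = d * b + (- 1)" using nz by simp
  with k1 k2 k3 show thesis by (rule that)
qed

text \<open>Injectivity needs that the fibre has infinite order, and the image is the commutator
  subgroup because the covering group is perfect and \<open>p\<close> is onto modulo the centre.\<close>

lemma abelian_cover_exists:
  fixes a1 a2 a3 :: nat and b b1 b2 b3 \<beta>1 \<beta>2 \<beta>3 :: int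
  assumes a: "0 < a1" "0 < a2" "0 < a3"
    and cop: "coprime a1 a2" "coprime a1 a3" "coprime a2 a3"
    and data: "brieskorn_data a1 a2 a3 c" and c: "c = (b, b1, b2, b3)"
    and B: "B = (- 1, \<beta>1, \<beta>2, \<beta>3)"
    and d: "d = int a1 * int a2 * int a3 - \<beta>1 * int a2 * int a3 - \<beta>2 * int a1 * int a3 - \<beta>3 * int
        a1 * int a2" "d > 0"
    and free: "\<And>k::int. seif_elem a1 a2 a3 B Sh [^]\<^bsub>seifert_group a1 a2 a3 B\<^esub> k = \<one>\<^bsub>seifert_group a1
        a2 a3 B\<^esub> \<Longrightarrow> k = 0"
  defines "S \<equiv> seifert_group a1 a2 a3 B" and "e \<equiv> seif_elem a1 a2 a3 B"
  obtains p k1 k2 where "abelian_cover_hom a1 a2 a3 c B p"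
    "p (seif_elem a1 a2 a3 c Sx) = inv\<^bsub>S\<^esub> (e Sx) \<otimes>\<^bsub>S\<^esub> e Sh [^]\<^bsub>S\<^esub> (k1::int)"
    "p (seif_elem a1 a2 a3 c Sy) = inv\<^bsub>S\<^esub> (e Sy) \<otimes>\<^bsub>S\<^esub> e Sh [^]\<^bsub>S\<^esub> (k2::int)"
    "p (seif_elem a1 a2 a3 c Sh) = e Sh [^]\<^bsub>S\<^esub> d"
proof -
  define G where "G = seifert_group a1 a2 a3 c"
  define e' where "e' = seif_elem a1 a2 a3 c"
  define T where "T = triangle_group a1 a2 a3"
  have nz: "int a1 \<noteq> 0" "int a2 \<noteq> 0" "int a3 \<noteq> 0" using a by simp_all
  obtain k1 k2 k3 where k: "k1 * int a1 = - \<beta>1 - b1 * d" "k2 * int a2 = - \<beta>2 - b2 * d"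
    "k3 * int a3 = - \<beta>3 - b3 * d" "k1 + k2 + k3 = d * b + (- 1)"
    using cover_multipliers[OF nz brieskorn_data_int[OF a data[unfolded c]] d(1)] by metis
  obtain p where p: "p \<in> hom G S" "p (e' Sx) = inv\<^bsub>S\<^esub> (e Sx) \<otimes>\<^bsub>S\<^esub> e Sh [^]\<^bsub>S\<^esub> k1"
    "p (e' Sy) = inv\<^bsub>S\<^esub> (e Sy) \<otimes>\<^bsub>S\<^esub> e Sh [^]\<^bsub>S\<^esub> k2"
    "p (e' Sz) = e Sy \<otimes>\<^bsub>S\<^esub> e Sx \<otimes>\<^bsub>S\<^esub> e Sh [^]\<^bsub>S\<^esub> (k3 - (- 1))"
    "p (e' Sh) = e Sh [^]\<^bsub>S\<^esub> d"
    using abelian_cover_on_generators[OF c B k] unfolding S_def e_def G_def e'_def by metis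
  interpret S: group S unfolding S_def by (rule group_seifert)
  interpret G: group G unfolding G_def by (rule group_seifert)
  interpret T: group T unfolding T_def by (rule group_triangle)
  interpret p: group_hom G S p by (rule group_homI[OF G.group_axioms S.group_axioms p(1)])
  have mem [simp]: "e g \<in> carrier S" "e' g \<in> carrier G" for g
      by (simp_all add: e_def S_def e'_def G_def)
  obtain \<pi> \<pi>' r where \<pi>: "\<pi> \<in> hom S T" "\<pi> (e Sh) = \<one>\<^bsub>T\<^esub>"
    and ker: "\<And>g. g \<in> carrier S \<Longrightarrow> \<pi> g = \<one>\<^bsub>T\<^esub> \<Longrightarrow> \<exists>k::int. g = e Sh [^]\<^bsub>S\<^esub> k"
    and \<pi>': "\<pi>' \<in> hom G T"
    and ker': "\<And>g. g \<in> carrier G \<Longrightarrow> \<pi>' g = \<one>\<^bsub>T\<^esub> \<Longrightarrow> \<exists>k::int. g = e' Sh [^]\<^bsub>G\<^esub> k"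
    and surj: "\<And>\<gamma>. \<gamma> \<in> carrier T \<Longrightarrow> \<exists>g\<in>carrier G. \<pi>' g = \<gamma>"
    and r: "r \<in> hom T T" "\<And>\<gamma>. \<gamma> \<in> carrier T \<Longrightarrow> r (r \<gamma>) = \<gamma>"
    and \<pi>p: "\<And>g. g \<in> carrier G \<Longrightarrow> \<pi> (p g) = r (\<pi>' g)"
    by (rule abelian_cover_projects[OF p[unfolded S_def e_def G_def e'_def],
          folded S_def e_def G_def e'_def T_def]) (rule that)
  interpret \<pi>: group_hom S T \<pi> by (rule group_homI[OF S.group_axioms T.group_axioms \<pi>(1)])
  interpret \<pi>': group_hom G T \<pi>' by (rule group_homI[OF G.group_axioms T.group_axioms \<pi>'])
  interpret r: group_hom T T r by (rule group_homI[OF T.group_axioms T.group_axioms r(1)])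
  have "inj_on p (carrier G)"
    unfolding p.inj_on_one_iff
  proof (intro allI impI)
    fix g assume g: "g \<in> carrier G" "p g = \<one>\<^bsub>S\<^esub>"
    then have "r (\<pi>' g) = \<one>\<^bsub>T\<^esub>" using \<pi>p[OF g(1)] by simp
    then have "\<pi>' g = \<one>\<^bsub>T\<^esub>" using r(2)[of "\<pi>' g"] g by simp
    then obtain k :: int where k: "g = e' Sh [^]\<^bsub>G\<^esub> k" using ker'[OF g(1)] by blast
    have "e Sh [^]\<^bsub>S\<^esub> (d * k) = \<one>\<^bsub>S\<^esub>"
      using g(2) unfolding k by (simp add: p.hom_int_pow p(5) S.int_pow_pow)
    then have "d * k = 0" unfolding e_def S_def by (rule free)
    then show "g = \<one>\<^bsub>G\<^esub>" using d(2) k by simp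
  qed
  moreover have "p ` carrier G = derived S (carrier S)"
  proof (rule perfect_central_extension_image[OF G.group_axioms S.group_axioms p(1)])
    show "derived G (carrier G) = carrier G"
      using brieskorn_perfect[OF a cop data[unfolded c]] by (simp add: G_def c)
    fix g assume g: "g \<in> carrier S"
    obtain g' where g': "g' \<in> carrier G" "\<pi>' g' = r (\<pi> g)" using surj[of "r (\<pi> g)"] g by auto
    have "\<pi> (inv\<^bsub>S\<^esub> (p g') \<otimes>\<^bsub>S\<^esub> g) = \<one>\<^bsub>T\<^esub>"
      using g g' \<pi>p[OF g'(1)] r(2)[of "\<pi> g"] by simp
    then have "\<exists>k::int. inv\<^bsub>S\<^esub> (p g') \<otimes>\<^bsub>S\<^esub> g = e Sh [^]\<^bsub>S\<^esub> k" using g g' by (intro ker) simp_all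
    then obtain k :: int where k: "inv\<^bsub>S\<^esub> (p g') \<otimes>\<^bsub>S\<^esub> g = e Sh [^]\<^bsub>S\<^esub> k" ..
    have "g = p g' \<otimes>\<^bsub>S\<^esub> e Sh [^]\<^bsub>S\<^esub> k"
      unfolding k[symmetric] using g g' by (simp flip: S.m_assoc)
    moreover have "\<forall>u\<in>carrier S. e Sh [^]\<^bsub>S\<^esub> k \<otimes>\<^bsub>S\<^esub> u = u \<otimes>\<^bsub>S\<^esub> e Sh [^]\<^bsub>S\<^esub> k"
      using seifert_fibre_commutes unfolding S_def e_def by blast
    ultimately show "\<exists>g'\<in>carrier G. \<exists>c\<in>carrier S. g = p g' \<otimes>\<^bsub>S\<^esub> c \<and>
        (\<forall>u\<in>carrier S. c \<otimes>\<^bsub>S\<^esub> u = u \<otimes>\<^bsub>S\<^esub> c)"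
      using g'(1) S.int_pow_closed[OF mem(1)] by blast
  qed
  moreover have "\<lfloor>of_nat (a1 * a2 * a3) * \<bar>seifert_euler_number a1 a2 a3 B\<bar>\<rfloor> = d"
    unfolding B by (rule euler_degree_floor[OF a d(2,1)])
  ultimately have "abelian_cover_hom a1 a2 a3 c B p"
    using p(1,5) unfolding abelian_cover_hom_def G_def S_def e_def e'_def by simp
  then show thesis using p(2,3,5) unfolding e'_def by (rule that)
qed

text \<open>The representation induced by a class in \<open>E\<close>, with explicit traces. The signs are left open;
  they are determined in the end by perfectness of the fundamental group. \<open>U\<close> and \<open>V\<close> are inverses
  of the rotations because the covering reflects the base.\<close>

lemma induced_rep_exists:
  fixes a1 a2 a3 :: nat and b b1 b2 b3 \<beta>1 \<beta>2 \<beta>3 :: int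
  assumes a: "0 < a1" "0 < a2" "0 < a3"
    and cop: "coprime a1 a2" "coprime a1 a3" "coprime a2 a3"
    and data: "brieskorn_data a1 a2 a3 c" and c: "c = (b, b1, b2, b3)"
    and \<beta>: "0 < \<beta>1" "0 < \<beta>2" "0 < \<beta>3"
      "of_int \<beta>1 / of_nat a1 + of_int \<beta>2 / of_nat a2 + of_int \<beta>3 / of_nat a3 < (1 :: real)"
  obtains \<sigma> U V where "\<sigma> \<in> hom (pi1_brieskorn a1 a2 a3 c) SL2"
    "induced_rep a1 a2 a3 c (H2_class a1 a2 a3 (- 1, \<beta>1, \<beta>2, \<beta>3)) (\<lambda>g. map_matrix complex_of_real
        (\<sigma> g))"
    "\<sigma> (seif_elem a1 a2 a3 c Sx) \<in> {U, - U}" "\<sigma> (seif_elem a1 a2 a3 c Sy) \<in> {V, - V}"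
    "\<sigma> (seif_elem a1 a2 a3 c Sh) \<in> {mat 1, - mat 1}"
    "det U = 1" "trace U = 2 * cos (pi * of_int \<beta>1 / of_nat a1)"
    "det V = 1" "trace V = 2 * cos (pi * of_int \<beta>2 / of_nat a2)"
    "trace (U ** V) = - 2 * cos (pi * of_int \<beta>3 / of_nat a3)"
proof -
  define B where "B = (- 1 :: int, \<beta>1, \<beta>2, \<beta>3)"
  define S where "S = seifert_group a1 a2 a3 B"
  define e where "e = seif_elem a1 a2 a3 B"
  interpret S: group S unfolding S_def by (rule group_seifert)
  interpret C: group PSL2R_cover by (rule group_cover)
  have mem [simp]: "e g \<in> carrier S" for g by (simp_all add: e_def S_def)
  obtain x y z where xyz: "x \<in> carrier PSL2R_cover" "y \<in> carrier PSL2R_cover"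
      "z \<in> carrier PSL2R_cover"
    and pows: "x [^]\<^bsub>PSL2R_cover\<^esub> a1 = sh (of_int (- \<beta>1))" "y [^]\<^bsub>PSL2R_cover\<^esub> a2 = sh (of_int (- \<beta>2))"
      "z [^]\<^bsub>PSL2R_cover\<^esub> a3 = sh (of_int (- \<beta>3))"
    and prod: "x \<otimes>\<^bsub>PSL2R_cover\<^esub> y \<otimes>\<^bsub>PSL2R_cover\<^esub> z = sh (of_int (- 1))"
    by (rule triangle_representation[OF a \<beta>])
  have sh1: "sh 1 [^]\<^bsub>PSL2R_cover\<^esub> k = sh (of_int k)" for k :: int by (simp add: sh_int_pow)
  have comm: "sh 1 \<otimes>\<^bsub>PSL2R_cover\<^esub> g = g \<otimes>\<^bsub>PSL2R_cover\<^esub> sh 1" if "g \<in> carrier PSL2R_cover" for g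
    using sh_int_central[OF that, of 1] by simp
  obtain \<Phi> where \<Phi>: "\<Phi> \<in> hom S PSL2R_cover" "\<Phi> (e Sx) = x" "\<Phi> (e Sy) = y" "\<Phi> (e Sz) = z"
      "\<Phi> (e Sh) = sh 1"
    by (rule seifert_hom[OF group_cover xyz sh_in_cover pows[folded sh1] prod[folded sh1] comm
        B_def,
          folded S_def e_def]) (assumption, rule that)
  interpret \<Phi>: group_hom S PSL2R_cover \<Phi> by (rule group_homI[OF S.group_axioms C.group_axioms \<Phi>(1)])
  obtain f \<psi> where f: "f \<in> hom (triangle_group a1 a2 a3) PSL2R"
      "euler_identification a1 a2 a3 f B \<psi>"
    and \<psi>: "\<And>g. snd (\<psi> g) = \<Phi> g"
    using euler_identification_exists[OF \<Phi>(1,5)[unfolded S_def e_def]] by metis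
  have \<Phi>h: "\<Phi> (e Sh [^]\<^bsub>S\<^esub> (k::int)) = sh (of_int k)" for k
    by (simp add: \<Phi>.hom_int_pow \<Phi>(5) sh1)
  have free: "k = 0" if "seif_elem a1 a2 a3 B Sh [^]\<^bsub>seifert_group a1 a2 a3 B\<^esub> k = \<one>\<^bsub>seifert_group a1
      a2 a3 B\<^esub>" for k :: int
  proof -
    have "sh (of_int k) = sh 0" using \<Phi>h[of k] that
        by (simp add: sh_0 S_def e_def \<Phi>.hom_one[unfolded S_def])
    then show ?thesis by simp
  qed
  define d where "d = int a1 * int a2 * int a3 - \<beta>1 * int a2 * int a3 - \<beta>2 * int a1 * int a3 - \<beta>3
      * int a1 * int a2"
  have "of_int d = real a1 * real a2 * real a3 * (1 - (of_int \<beta>1 / of_nat a1 + of_int \<beta>2 / of_nat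
      a2 + of_int \<beta>3 / of_nat a3))"
    using a clear_denominators[of "real a1" "real a2" "real a3" 0 \<beta>1 \<beta>2 \<beta>3]
    by (simp add: d_def algebra_simps)
  then have "real_of_int d > 0" using a \<beta>(4) by simp
  then have "d > 0" by simp
  obtain p k1 k2 where p: "abelian_cover_hom a1 a2 a3 c B p"
    "p (seif_elem a1 a2 a3 c Sx) = inv\<^bsub>S\<^esub> (e Sx) \<otimes>\<^bsub>S\<^esub> e Sh [^]\<^bsub>S\<^esub> (k1::int)"
    "p (seif_elem a1 a2 a3 c Sy) = inv\<^bsub>S\<^esub> (e Sy) \<otimes>\<^bsub>S\<^esub> e Sh [^]\<^bsub>S\<^esub> (k2::int)"
    "p (seif_elem a1 a2 a3 c Sh) = e Sh [^]\<^bsub>S\<^esub> d"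
    unfolding S_def e_def
    using abelian_cover_exists[OF a cop data c B_def d_def \<open>d > 0\<close> free] by metis
  have phom: "p \<in> hom (seifert_group a1 a2 a3 c) S"
    using p(1) by (simp add: abelian_cover_hom_def S_def)
  define \<sigma> where "\<sigma> g = to_SL2R (\<Phi> (p g))" for g
  have "to_SL2R \<circ> (\<Phi> \<circ> p) \<in> hom (seifert_group a1 a2 a3 c) SL2"
    by (rule Group.hom_compose[OF Group.hom_compose[OF phom \<Phi>(1)] to_SL2R_hom])
  then have \<sigma>: "\<sigma> \<in> hom (pi1_brieskorn a1 a2 a3 c) SL2" by (simp add: \<sigma>_def[abs_def] comp_def)
  have ind: "induced_rep a1 a2 a3 c (H2_class a1 a2 a3 (- 1, \<beta>1, \<beta>2, \<beta>3)) (\<lambda>g. map_matrix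
      complex_of_real (\<sigma> g))"
    unfolding induced_rep_def B_def[symmetric] \<sigma>_def using f p(1) \<psi> by metis
  interpret h: group_hom PSL2R_cover SL2 to_SL2R
    by (rule group_homI[OF group_cover group_SL2 to_SL2R_hom])
  have sgn: "to_SL2R (sh (of_int k)) \<in> {mat 1, - mat 1}" for k
    unfolding to_SL2R_sh rot_int by simp
  define X Y Z where XYZ: "X = to_SL2R x" "Y = to_SL2R y" "Z = to_SL2R z"
  have det: "det X = 1" "det Y = 1" "det Z = 1" using xyz by (simp_all add: XYZ to_SL2R)
  have img: "to_SL2R (\<Phi> (inv\<^bsub>S\<^esub> (e s) \<otimes>\<^bsub>S\<^esub> e Sh [^]\<^bsub>S\<^esub> k)) \<in> {matrix_inv W, - matrix_inv W}"
    if "W = to_SL2R (\<Phi> (e s))" for s W and k :: int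
  proof -
    have "\<Phi> (e s) \<in> carrier PSL2R_cover" by simp
    then have "to_SL2R (\<Phi> (inv\<^bsub>S\<^esub> (e s) \<otimes>\<^bsub>S\<^esub> e Sh [^]\<^bsub>S\<^esub> k)) = matrix_inv W ** to_SL2R (sh (of_int k))"
      unfolding that by (simp add: \<Phi>h inv_SL2 to_SL2R del: mult_cover)
    then show ?thesis using sgn[of k] by auto
  qed
  have sx: "\<sigma> (seif_elem a1 a2 a3 c Sx) \<in> {matrix_inv X, - matrix_inv X}"
    unfolding \<sigma>_def p by (rule img) (simp add: XYZ \<Phi>)
  have sy: "\<sigma> (seif_elem a1 a2 a3 c Sy) \<in> {matrix_inv Y, - matrix_inv Y}"
    unfolding \<sigma>_def p by (rule img) (simp add: XYZ \<Phi>)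
  have sz: "\<sigma> (seif_elem a1 a2 a3 c Sh) \<in> {mat 1, - mat 1}"
    unfolding \<sigma>_def p \<Phi>h by (rule sgn)
  have tr: "trace X = 2 * cos (pi * of_int \<beta>1 / a1)" "trace Y = 2 * cos (pi * of_int \<beta>2 / a2)"
    "trace Z = 2 * cos (pi * of_int \<beta>3 / a3)"
    using cover_torsion[OF xyz(1) a(1) pows(1)] cover_torsion[OF xyz(2) a(2) pows(2)]
      cover_torsion[OF xyz(3) a(3) pows(3)] unfolding XYZ
          by (metis cos_minus minus_divide_left mult_minus_right of_int_minus)+
  have "X ** Y ** Z = - mat 1"
    using arg_cong[OF prod, of to_SL2R] xyz unfolding to_SL2R_sh rot_int XYZ
        by (simp del: mult_cover)
  then have "X ** Y ** Z ** matrix_inv Z = - matrix_inv Z" by simp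
  then have XY: "X ** Y = - matrix_inv Z"
      by (metis SL2_matrix_inv(1)[OF det(3)] matrix_mul_assoc matrix_mul_rid)
  have "matrix_inv X ** matrix_inv Y = matrix_inv (Y ** X)"
  proof (rule matrix_inv_eqI[symmetric])
    show "Y ** X ** (matrix_inv X ** matrix_inv Y) = mat 1"
      by (metis SL2_matrix_inv(1) det(1,2) matrix_mul_assoc matrix_mul_rid)
  qed
  then have "trace (matrix_inv X ** matrix_inv Y) = trace (Y ** X)"
    using det by (simp add: trace_inv det_mul)
  also have "\<dots> = trace (X ** Y)" by (rule trace_mul_sym)
  also have "\<dots> = - 2 * cos (pi * of_int \<beta>3 / a3)" unfolding XY using tr(3) det(3)
      by (simp add: trace_inv)
  finally have trXY: "trace (matrix_inv X ** matrix_inv Y) = - 2 * cos (pi * of_int \<beta>3 / a3)" .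
  show thesis
    by (rule that[OF \<sigma> ind sx sy sz _ _ _ _ trXY]) (use det tr in \<open>simp_all add: SL2_matrix_inv
        trace_inv\<close>)
qed

section \<open>Traces of the induced representations\<close>

text \<open>The Euler number is the homomorphism \<open>x\<^sub>0 \<mapsto> - 1\<close>, \<open>x\<^sub>i \<mapsto> - 1 / a\<^sub>i\<close>, which respects the
  relations \<open>a\<^sub>i x\<^sub>i = x\<^sub>0\<close>.\<close>

lemma H2_class_euler_number:
  fixes a1 a2 a3 :: nat
  assumes a: "0 < a1" "0 < a2" "0 < a3" and eq: "H2_class a1 a2 a3 B = H2_class a1 a2 a3 B'"
  shows "seifert_euler_number a1 a2 a3 B = seifert_euler_number a1 a2 a3 B'"
proof -
  let ?F = "free_Abelian_group {0..3::nat}"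
  let ?l = "Poly_Mapping.lookup"
  define \<phi> :: "(nat \<Rightarrow>\<^sub>0 int) \<Rightarrow> rat" where
    "\<phi> v = of_int (?l v 0) + of_int (?l v 1) / of_nat a1 + of_int (?l v 2) / of_nat a2 + of_int
        (?l v 3) / of_nat a3" for v
  have add: "\<phi> (u + v) = \<phi> u + \<phi> v" and neg: "\<phi> (- u) = - \<phi> u" for u v
    by (simp_all add: \<phi>_def lookup_add add_divide_distrib)
  have diff: "\<phi> (u - v) = \<phi> u - \<phi> v" for u v
    using add[of u "- v"] neg[of v] by simp
  have cmul: "\<phi> (frag_cmul k u) = of_int k * \<phi> u" for k u
    by (simp add: \<phi>_def lookup_frag_cmul algebra_simps)
  have gen: "\<phi> (frag_of 0) = 1" "\<phi> (frag_of 1) = 1 / of_nat a1" "\<phi> (frag_of 2) = 1 / of_nat a2"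
    "\<phi> (frag_of 3) = 1 / of_nat a3"
    by (simp_all add: \<phi>_def lookup_single lookup_one)
  have \<phi>r: "\<phi> (frag_cmul (int a) (frag_of i) - frag_of 0) = 0"
    if "\<phi> (frag_of i) = 1 / of_nat a" "0 < a" for a i
    unfolding diff cmul gen(1) that(1) using that(2) by simp
  have kr: "Poly_Mapping.keys (frag_cmul k (frag_of i) - frag_of 0) \<subseteq> {0..3}" if "i \<in> {1, 2, 3}"
      for k and i :: nat
    using keys_diff[of "frag_cmul k (frag_of i)" "frag_of 0"] keys_cmul[of k "frag_of i"] that
    by (auto simp: keys_single)
  let ?R = "{frag_cmul (int a1) (frag_of 1) - frag_of 0, frag_cmul (int a2) (frag_of 2) - frag_of 0,
    frag_cmul (int a3) (frag_of 3) - frag_of 0}"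
  have base: "\<phi> v = 0" "Poly_Mapping.keys v \<subseteq> {0..3}" if "v \<in> ?R" for v
    using that \<phi>r[OF gen(2) a(1)] \<phi>r[OF gen(3) a(2)] \<phi>r[OF gen(4) a(3)] kr by blast+
  have rels: "\<phi> v = 0 \<and> Poly_Mapping.keys v \<subseteq> {0..3}" if "v \<in> H2_rels a1 a2 a3" for v
    using that unfolding H2_rels_def
  proof (induction rule: generate.induct)
    case (incl v)
    with base show ?case by blast
  next
    case (inv v)
    show ?case unfolding inv_free_Abelian_group[OF base(2)[OF inv]] neg using base[OF inv] by simp
  next
    case (eng u v)
    then show ?case using keys_add[of u v] by (auto simp: add)
  qed (simp add: \<phi>_def)
  define v where "v = (\<lambda>(\<beta>, \<beta>1, \<beta>2, \<beta>3). frag_cmul \<beta> (frag_of 0) + frag_cmul \<beta>1 (frag_of 1) +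
    frag_cmul \<beta>2 (frag_of 2) + frag_cmul \<beta>3 (frag_of (3::nat)))"
  have cls: "H2_class a1 a2 a3 A = {r + v A | r. r \<in> H2_rels a1 a2 a3}" for A
    by (cases A) (auto simp: v_def r_coset_def)
  have "0 \<in> H2_rels a1 a2 a3"
    using generate.one[of ?F] unfolding H2_rels_def by simp
  then have "v B \<in> H2_class a1 a2 a3 B" unfolding cls by force
  then have "v B \<in> {r + v B' | r. r \<in> H2_rels a1 a2 a3}" unfolding eq cls[of B'] .
  then obtain r where "v B = r + v B'" "r \<in> H2_rels a1 a2 a3"
    by (elim CollectE exE conjE) (rule that)
  then have "\<phi> (v B) = \<phi> (v B')" using rels add by simp
  moreover have "\<phi> (v A) = - seifert_euler_number a1 a2 a3 A" for A
    by (cases A) (simp only: v_def prod.case add cmul gen seifert_euler_number.simps, simp)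
  ultimately show ?thesis by simp
qed

text \<open>This holds for every choice of \<open>f\<close>, \<open>\<psi>\<close> and \<open>p\<close>: whatever \<open>p\<close> does to \<open>g\<close>, it maps the fibre
  to its \<open>d\<close>-th power, so the image of \<open>g\<close> in the cover has the shift by \<open>d m\<close> as its \<open>n\<close>-th
  power, and \<open>cover_torsion\<close> gives the trace. This replaces a classification of the automorphisms
  of the triangle group.\<close>

lemma induced_rep_trace:
  assumes "induced_rep a1 a2 a3 c eu \<rho>" "eu = H2_class a1 a2 a3 B"
    and a: "0 < a1" "0 < a2" "0 < a3"
    and g: "g \<in> carrier (pi1_brieskorn a1 a2 a3 c)" "0 < n"
      "g [^]\<^bsub>pi1_brieskorn a1 a2 a3 c\<^esub> n = seif_elem a1 a2 a3 c Sh [^]\<^bsub>pi1_brieskorn a1 a2 a3 c\<^esub>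
          (m::int)"
  shows "trace (\<rho> g) = of_real (2 * cos (pi * of_int
    (\<lfloor>of_nat (a1 * a2 * a3) * \<bar>seifert_euler_number a1 a2 a3 B\<bar>\<rfloor> * m) / of_nat n))"
proof -
  obtain B' f \<psi> p where eu: "eu = H2_class a1 a2 a3 B'" and ei:
      "euler_identification a1 a2 a3 f B' \<psi>"
    and ac: "abelian_cover_hom a1 a2 a3 c B' p"
    and \<rho>: "\<And>g. g \<in> carrier (pi1_brieskorn a1 a2 a3 c) \<Longrightarrow>
      \<rho> g = map_matrix complex_of_real (to_SL2R (snd (\<psi> (p g))))"
    using assms(1) unfolding induced_rep_def by blast
  define d where "d = \<lfloor>of_nat (a1 * a2 * a3) * \<bar>seifert_euler_number a1 a2 a3 B\<bar>\<rfloor>"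
  have eB: "seifert_euler_number a1 a2 a3 B' = seifert_euler_number a1 a2 a3 B"
    using H2_class_euler_number[OF a, of B' B] assms(2) eu by simp
  define G where "G = pi1_brieskorn a1 a2 a3 c"
  define S where "S = seifert_group a1 a2 a3 B'"
  interpret S: group S unfolding S_def by (rule group_seifert)
  interpret G: group G unfolding G_def by (rule group_seifert)
  have p: "p \<in> hom G S" "p (seif_elem a1 a2 a3 c Sh) = seif_elem a1 a2 a3 B' Sh [^]\<^bsub>S\<^esub> d"
    using ac unfolding abelian_cover_hom_def G_def S_def d_def eB by blast+
  have \<psi>: "\<psi> \<in> hom S (pullback_extension a1 a2 a3 f)" "snd (\<psi> (seif_elem a1 a2 a3 B' Sh)) = sh 1"
    using ei unfolding euler_identification_def S_def by (auto simp: iso_def)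
  have "snd \<in> hom (pullback_extension a1 a2 a3 f) PSL2R_cover"
    by (rule homI) (auto simp: pullback_carrier pullback_mult)
  then have \<Phi>: "snd \<circ> \<psi> \<in> hom S PSL2R_cover" by (rule Group.hom_compose[OF \<psi>(1)])
  define \<Phi> where "\<Phi> = (snd \<circ> \<psi>) \<circ> p"
  have hom: "\<Phi> \<in> hom G PSL2R_cover" unfolding \<Phi>_def by (rule Group.hom_compose[OF p(1) \<Phi>])
  interpret q: group_hom S PSL2R_cover "snd \<circ> \<psi>"
      by (rule group_homI[OF S.group_axioms group_cover \<Phi>])
  interpret \<Phi>: group_hom G PSL2R_cover \<Phi> by (rule group_homI[OF G.group_axioms group_cover hom])
  have h: "\<Phi> (seif_elem a1 a2 a3 c Sh) = sh (of_int d)"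
    using q.hom_int_pow[of "seif_elem a1 a2 a3 B' Sh" d] \<psi>(2)
        by (simp add: \<Phi>_def p(2) sh_int_pow S_def)
  have mem: "g \<in> carrier G" "seif_elem a1 a2 a3 c Sh \<in> carrier G" using g(1)
      by (simp_all add: G_def)
  have "\<Phi> g [^]\<^bsub>PSL2R_cover\<^esub> n = \<Phi> (seif_elem a1 a2 a3 c Sh [^]\<^bsub>G\<^esub> m)"
    using g(3) mem unfolding G_def[symmetric] by (simp flip: \<Phi>.hom_nat_pow)
  also have "\<dots> = sh (of_int (d * m))"
    using mem by (simp add: \<Phi>.hom_int_pow h sh_int_pow mult.commute)
  finally have "trace (to_SL2R (\<Phi> g)) = 2 * cos (pi * of_int (d * m) / of_nat n)"
    using cover_torsion[OF \<Phi>.hom_closed[OF mem(1)] g(2)] by metis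
  then show ?thesis using \<rho>[OF g(1)] by (simp add: complexify \<Phi>_def d_def)
qed

section \<open>Arithmetic of rotation numbers\<close>

lemma cos_fraction_eq:
  fixes m m' :: int and n :: nat
  assumes "n > 0" "cos (pi * of_int m / of_nat n) = cos (pi * of_int m' / of_nat n)"
  shows "2 * int n dvd m - m' \<or> 2 * int n dvd m + m'"
proof -
  obtain k :: int where k: "pi * of_int m / of_nat n = pi * of_int m' / of_nat n + 2 * of_int k *
      pi \<or>
      pi * of_int m / of_nat n = - (pi * of_int m' / of_nat n) + 2 * of_int k * pi"
    using assms(2) unfolding cos_eq by (auto elim!: Ints_cases)
  have int: "2 * int n dvd m - s"
    if "pi * of_int m / of_nat n = pi * of_int s / of_nat n + 2 * of_int k * pi" for s
  proof -
    have "pi * of_int m = pi * (of_int s + 2 * of_int k * of_nat n)"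
      using that assms(1) by (simp add: field_simps)
    then have "real_of_int m = of_int (s + 2 * k * int n)" by simp
    then have "m = s + 2 * k * int n" by (simp only: of_int_eq_iff)
    then show ?thesis by simp
  qed
  from k show ?thesis
  proof
    assume "pi * of_int m / of_nat n = - (pi * of_int m' / of_nat n) + 2 * of_int k * pi"
    then have "pi * of_int m / of_nat n = pi * of_int (- m') / of_nat n + 2 * of_int k * pi" by simp
    from int[OF this] show ?thesis by simp
  qed (use int in blast)
qed

text \<open>As \<open>b\<close> inverts \<open>w\<close> modulo \<open>a\<close>, the product \<open>b d\<close> is \<open>- \<beta>\<close> modulo \<open>a\<close>.\<close>

lemma seifert_invariant_up_to_sign:
  fixes a b d d' r u v w \<beta> \<beta>' :: int
  assumes range: "0 < \<beta>" "\<beta> < a" "0 < \<beta>'" "\<beta>' < a"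
    and unit: "b * w = 1 - a * r" and d: "d = a * u - \<beta> * w" "d' = a * v - \<beta>' * w"
    and dvd: "2 * a dvd b * d - b * d' \<or> 2 * a dvd b * d + b * d'"
  shows "\<beta>' = \<beta> \<or> \<beta> + \<beta>' = a"
proof -
  have bd: "b * d = a * (b * u + \<beta> * r) - \<beta>" "b * d' = a * (b * v + \<beta>' * r) - \<beta>'"
  proof -
    have "b * d = a * b * u - \<beta> * (b * w)" "b * d' = a * b * v - \<beta>' * (b * w)"
      unfolding d by (simp_all add: algebra_simps)
    then show "b * d = a * (b * u + \<beta> * r) - \<beta>" "b * d' = a * (b * v + \<beta>' * r) - \<beta>'"
      unfolding unit by (simp_all add: algebra_simps)
  qed
  from dvd have "a dvd b * d - b * d' \<or> a dvd b * d + b * d'" by (metis dvd_mult_right)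
  then have "a dvd \<beta>' - \<beta> \<or> a dvd \<beta> + \<beta>'"
  proof
    assume "a dvd b * d - b * d'"
    then have "a dvd (b * d - b * d') - a * ((b * u + \<beta> * r) - (b * v + \<beta>' * r))" by simp
    also have "(b * d - b * d') - a * ((b * u + \<beta> * r) - (b * v + \<beta>' * r)) = \<beta>' - \<beta>"
      unfolding bd by (simp add: algebra_simps)
    finally show ?thesis ..
  next
    assume "a dvd b * d + b * d'"
    then have "a dvd a * ((b * u + \<beta> * r) + (b * v + \<beta>' * r)) - (b * d + b * d')" by simp
    also have "a * ((b * u + \<beta> * r) + (b * v + \<beta>' * r)) - (b * d + b * d') = \<beta> + \<beta>'"
      unfolding bd by (simp add: algebra_simps)
    finally show ?thesis ..
  qed
  then show ?thesis
  proof
    assume "a dvd \<beta>' - \<beta>"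
    moreover have "\<bar>\<beta>' - \<beta>\<bar> < a" using range by linarith
    ultimately have "\<beta>' - \<beta> = 0" using zdvd_imp_le[of a "\<bar>\<beta>' - \<beta>\<bar>"] by fastforce
    then show ?thesis by simp
  next
    assume "a dvd \<beta> + \<beta>'"
    then have "a dvd \<beta> + \<beta>' - a" by simp
    moreover have "\<bar>\<beta> + \<beta>' - a\<bar> < a" using range by linarith
    ultimately have "\<beta> + \<beta>' - a = 0" using zdvd_imp_le[of a "\<bar>\<beta> + \<beta>' - a\<bar>"] by fastforce
    then show ?thesis by simp
  qed
qed

text \<open>If \<open>a\<^sub>2\<close> is even, dividing \<open>d - d'\<close> by \<open>a\<^sub>2\<close> leaves an odd number, while divisibility of
  \<open>d + d'\<close> by \<open>a\<^sub>2\<close> is only possible for \<open>2 \<beta>\<^sub>2 = a\<^sub>2\<close>.\<close>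

lemma single_flip_other_even:
  fixes a1 a2 a3 b2 \<beta>1 \<beta>2 \<beta>3 d d' :: int
  assumes odd: "odd a1" "even a2" "odd a3" and r2: "0 < \<beta>2" "\<beta>2 < a2" "2 * \<beta>2 \<noteq> a2"
    and cop: "coprime a2 (a1 * a3)" "coprime b2 a2"
    and diff: "d - d' = (a1 - 2 * \<beta>1) * a2 * a3"
    and sum: "d + d' = a1 * a2 * a3 - 2 * \<beta>2 * a1 * a3 - 2 * \<beta>3 * a1 * a2"
    and dvd: "2 * a2 dvd b2 * d - b2 * d' \<or> 2 * a2 dvd b2 * d + b2 * d'"
  shows False
proof -
  have a2: "a2 \<noteq> 0" using r2 by simp
  have "coprime b2 2" using cop(2) odd(2) by (metis coprime_commute coprime_divisors dvd_refl)
  then have cb: "coprime (2 * a2) b2" using cop(2) by (simp add: coprime_commute)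
  from dvd have "2 * a2 dvd b2 * (d - d') \<or> 2 * a2 dvd b2 * (d + d')" by (simp add: algebra_simps)
  then have "2 * a2 dvd d - d' \<or> 2 * a2 dvd d + d'"
    using cb by (simp add: coprime_dvd_mult_right_iff)
  then show False
  proof
    assume "2 * a2 dvd d - d'"
    then have "a2 * 2 dvd a2 * ((a1 - 2 * \<beta>1) * a3)" unfolding diff by (simp add: mult_ac)
    then have "even ((a1 - 2 * \<beta>1) * a3)" using a2 by (simp only: dvd_mult_cancel_left) simp
    then show False using odd by simp
  next
    assume "2 * a2 dvd d + d'"
    then have "a2 dvd d + d'" by (rule dvd_mult_right)
    then have "a2 dvd a2 * (a1 * a3 - 2 * \<beta>3 * a1) - (d + d')" by simp
    also have "a2 * (a1 * a3 - 2 * \<beta>3 * a1) - (d + d') = (2 * \<beta>2) * (a1 * a3)"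
      unfolding sum by (simp add: algebra_simps)
    finally have "a2 dvd 2 * \<beta>2" using cop(1) by (simp add: coprime_dvd_mult_left_iff)
    then obtain k where k: "2 * \<beta>2 = a2 * k" by (elim dvdE)
    have "0 < a2 * k" "a2 * k < a2 * 2" using r2 k by linarith+
    then have "0 < k" "k < 2" using r2 by (simp_all add: zero_less_mult_iff)
    then have "k = 1" by simp
    then show False using k r2 by simp
  qed
qed

text \<open>The traces do not see a replacement of \<open>\<beta>\<^sub>1\<close> by \<open>a\<^sub>1 - \<beta>\<^sub>1\<close> modulo \<open>a\<^sub>1\<close>, but they do so modulo
  \<open>2\<close>: if all \<open>a\<^sub>i\<close> are odd, \<open>d\<close> changes parity; if some \<open>a\<^sub>i\<close> is even, the congruence modulo \<open>2 a\<^sub>i\<close>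
  fails.\<close>

lemma no_single_flip:
  fixes a1 a2 a3 b1 b2 b3 \<beta>1 \<beta>1' \<beta>2 \<beta>3 d d' :: int
  assumes cop: "coprime a1 (a2 * a3)" "coprime a2 (a1 * a3)" "coprime a3 (a1 * a2)"
      "coprime b1 a1" "coprime b2 a2" "coprime b3 a3"
    and range: "0 < \<beta>1" "\<beta>1 < a1" "0 < \<beta>2" "\<beta>2 < a2" "0 < \<beta>3" "\<beta>3 < a3"
    and flip: "\<beta>1 + \<beta>1' = a1" "\<beta>1' \<noteq> \<beta>1" "2 * \<beta>2 \<noteq> a2" "2 * \<beta>3 \<noteq> a3"
    and d: "d = a1 * a2 * a3 - \<beta>1 * a2 * a3 - \<beta>2 * a1 * a3 - \<beta>3 * a1 * a2"
      "d' = a1 * a2 * a3 - \<beta>1' * a2 * a3 - \<beta>2 * a1 * a3 - \<beta>3 * a1 * a2"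
    and parity: "2 dvd d - d'"
    and dvd: "2 * a1 dvd b1 * d - b1 * d' \<or> 2 * a1 dvd b1 * d + b1 * d'"
      "2 * a2 dvd b2 * d - b2 * d' \<or> 2 * a2 dvd b2 * d + b2 * d'"
      "2 * a3 dvd b3 * d - b3 * d' \<or> 2 * a3 dvd b3 * d + b3 * d'"
  shows False
proof -
  have \<beta>1': "\<beta>1' = a1 - \<beta>1" using flip by simp
  have diff: "d - d' = (a1 - 2 * \<beta>1) * a2 * a3" and
    sum: "d + d' = a1 * a2 * a3 - 2 * \<beta>2 * a1 * a3 - 2 * \<beta>3 * a1 * a2"
    unfolding d \<beta>1' by (simp_all add: algebra_simps)
  have ce: "odd v" if "coprime u v" "even u" for u v :: int
    using that by (metis coprime_common_divisor_int odd_one zdvd1_eq dvd_refl coprime_def)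
  have "even a1 \<or> even a2 \<or> even a3" using parity unfolding diff by auto
  then consider "even a1" | "odd a1" "even a2" | "odd a1" "odd a2" "even a3" by blast
  then show False
  proof cases
    case 1
    have o: "odd a2" "odd a3" using ce[OF cop(1) 1] by auto
    have "odd b1" using ce[of a1 b1] cop(4) 1 by (simp add: coprime_commute)
    then have cb: "coprime (2 * a1) b1" using cop(4) by (simp add: coprime_commute)
    have ca: "coprime (2 * a1) (a2 * a3)" using cop(1) o by simp
    from dvd(1) have "2 * a1 dvd b1 * (d - d') \<or> 2 * a1 dvd b1 * (d + d')"
        by (simp add: algebra_simps)
    then have "2 * a1 dvd d - d' \<or> 2 * a1 dvd d + d'"
      using cb by (simp add: coprime_dvd_mult_right_iff)
    then show False
    proof
      assume "2 * a1 dvd d - d'"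
      then have "2 * a1 dvd (a1 - 2 * \<beta>1) * (a2 * a3)" unfolding diff by (simp add: mult.assoc)
      then have "2 * a1 dvd a1 - 2 * \<beta>1" using ca by (simp add: coprime_dvd_mult_left_iff)
      moreover have "\<bar>a1 - 2 * \<beta>1\<bar> < 2 * a1" using range by linarith
      ultimately have "a1 - 2 * \<beta>1 = 0" using zdvd_imp_le[of "2 * a1" "\<bar>a1 - 2 * \<beta>1\<bar>"] by fastforce
      then show False using flip by simp
    next
      assume "2 * a1 dvd d + d'"
      then have "a1 * 2 dvd a1 * (a2 * a3 - 2 * (\<beta>2 * a3 + \<beta>3 * a2))"
        unfolding sum by (simp add: algebra_simps)
      then have "even (a2 * a3 - 2 * (\<beta>2 * a3 + \<beta>3 * a2))"
        using range by (simp only: dvd_mult_cancel_left) simp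
      then show False using o by simp
    qed
  next
    case 2
    have "odd a3" using ce[OF cop(2) 2(2)] by simp
    then show False
      using single_flip_other_even[of a1 a2 a3 \<beta>2 b2 d d' \<beta>1 \<beta>3] 2 range flip(3) cop(2,5) diff sum
          dvd(2)
      by blast
  next
    case 3
    have sum': "d + d' = a1 * a3 * a2 - 2 * \<beta>3 * a1 * a2 - 2 * \<beta>2 * a1 * a3"
      and diff': "d - d' = (a1 - 2 * \<beta>1) * a3 * a2"
      using sum diff by (simp_all add: algebra_simps)
    show False
      using single_flip_other_even[of a1 a3 a2 \<beta>3 b3 d d' \<beta>1 \<beta>2] 3 range flip(4) cop(3,6) diff'
          sum' dvd(3)
      by blast
  qed
qed

text \<open>If two of the fractions \<open>\<beta>\<^sub>i / a\<^sub>i\<close> are replaced by their complements to \<open>1\<close>, then the old and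
  the new sum of the fractions add up to more than \<open>2\<close>.\<close>

lemma two_flips_exceed:
  fixes a1 a2 a3 \<beta>1 \<beta>2 \<beta>3 \<beta>1' \<beta>2' \<beta>3' :: int
  assumes pos: "0 < a1" "0 < a2" "0 < a3" "0 < \<beta>3" "0 < \<beta>3'"
    and sum: "\<beta>1 * a2 * a3 + \<beta>2 * a1 * a3 + \<beta>3 * a1 * a2 < a1 * a2 * a3"
      "\<beta>1' * a2 * a3 + \<beta>2' * a1 * a3 + \<beta>3' * a1 * a2 < a1 * a2 * a3"
    and flip: "\<beta>1 + \<beta>1' = a1" "\<beta>2 + \<beta>2' = a2"
  shows False
proof -
  have "(\<beta>1 + \<beta>1') * (a2 * a3) + (\<beta>2 + \<beta>2') * (a1 * a3) + (\<beta>3 + \<beta>3') * (a1 * a2) < 2 * (a1 * a2 *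
      a3)"
    using sum by (simp add: algebra_simps)
  then have "(\<beta>3 + \<beta>3') * (a1 * a2) < 0" unfolding flip by (simp add: algebra_simps)
  moreover have "0 < (\<beta>3 + \<beta>3') * (a1 * a2)" using pos by simp
  ultimately show False by simp
qed

text \<open>The trace of a generator determines its \<open>\<beta>\<^sub>i\<close> up to the flip \<open>\<beta>\<^sub>i \<mapsto> a\<^sub>i - \<beta>\<^sub>i\<close>. Two flips are
  excluded by the size condition in the definition of \<open>E\<close>, a single one by parity.\<close>

lemma invariants_determined:
  fixes a1 a2 a3 b b1 b2 b3 \<beta>1 \<beta>2 \<beta>3 \<beta>1' \<beta>2' \<beta>3' d d' :: int
  assumes cop: "coprime a1 (a2 * a3)" "coprime a2 (a1 * a3)" "coprime a3 (a1 * a2)"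
    and unit: "b * a1 * a2 * a3 + b1 * a2 * a3 + b2 * a1 * a3 + b3 * a1 * a2 = 1"
    and range: "0 < \<beta>1" "\<beta>1 < a1" "0 < \<beta>2" "\<beta>2 < a2" "0 < \<beta>3" "\<beta>3 < a3"
      "0 < \<beta>1'" "\<beta>1' < a1" "0 < \<beta>2'" "\<beta>2' < a2" "0 < \<beta>3'" "\<beta>3' < a3"
    and sum: "\<beta>1 * a2 * a3 + \<beta>2 * a1 * a3 + \<beta>3 * a1 * a2 < a1 * a2 * a3"
      "\<beta>1' * a2 * a3 + \<beta>2' * a1 * a3 + \<beta>3' * a1 * a2 < a1 * a2 * a3"
    and d: "d = a1 * a2 * a3 - \<beta>1 * a2 * a3 - \<beta>2 * a1 * a3 - \<beta>3 * a1 * a2"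
      "d' = a1 * a2 * a3 - \<beta>1' * a2 * a3 - \<beta>2' * a1 * a3 - \<beta>3' * a1 * a2"
    and parity: "2 dvd d - d'"
    and dvd: "2 * a1 dvd b1 * d - b1 * d' \<or> 2 * a1 dvd b1 * d + b1 * d'"
      "2 * a2 dvd b2 * d - b2 * d' \<or> 2 * a2 dvd b2 * d + b2 * d'"
      "2 * a3 dvd b3 * d - b3 * d' \<or> 2 * a3 dvd b3 * d + b3 * d'"
  shows "\<beta>1 = \<beta>1' \<and> \<beta>2 = \<beta>2' \<and> \<beta>3 = \<beta>3'"
proof -
  have pos: "0 < a1" "0 < a2" "0 < a3" using range by linarith+
  have u: "b1 * (a2 * a3) = 1 - a1 * (b * a2 * a3 + b2 * a3 + b3 * a2)"
    "b2 * (a1 * a3) = 1 - a2 * (b * a1 * a3 + b1 * a3 + b3 * a1)"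
    "b3 * (a1 * a2) = 1 - a3 * (b * a1 * a2 + b1 * a2 + b2 * a1)"
    using unit by (simp_all add: algebra_simps)
  have cb: "coprime m n" if "m * k = 1 - n * r" for m n k r :: int
  proof (rule coprimeI)
    fix c assume "c dvd m" "c dvd n"
    then have "c dvd m * k + n * r" by simp
    then show "is_unit c" using that by simp
  qed
  note cbs = cb[OF u(1)] cb[OF u(2)] cb[OF u(3)]
  have s1: "\<beta>1' = \<beta>1 \<or> \<beta>1 + \<beta>1' = a1"
    by (rule seifert_invariant_up_to_sign[OF range(1,2,7,8) u(1) _ _ dvd(1),
          of "a2 * a3 - \<beta>2 * a3 - \<beta>3 * a2" "a2 * a3 - \<beta>2' * a3 - \<beta>3' * a2"])
      (simp_all add: d algebra_simps)
  have s2: "\<beta>2' = \<beta>2 \<or> \<beta>2 + \<beta>2' = a2"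
    by (rule seifert_invariant_up_to_sign[OF range(3,4,9,10) u(2) _ _ dvd(2),
          of "a1 * a3 - \<beta>1 * a3 - \<beta>3 * a1" "a1 * a3 - \<beta>1' * a3 - \<beta>3' * a1"])
      (simp_all add: d algebra_simps)
  have s3: "\<beta>3' = \<beta>3 \<or> \<beta>3 + \<beta>3' = a3"
    by (rule seifert_invariant_up_to_sign[OF range(5,6,11,12) u(3) _ _ dvd(3),
          of "a1 * a2 - \<beta>1 * a2 - \<beta>2 * a1" "a1 * a2 - \<beta>1' * a2 - \<beta>2' * a1"])
      (simp_all add: d algebra_simps)
  have n12: "\<not> (\<beta>1 + \<beta>1' = a1 \<and> \<beta>2 + \<beta>2' = a2)"
    using two_flips_exceed[OF pos range(5,11) sum] by blast
  have n13: "\<not> (\<beta>1 + \<beta>1' = a1 \<and> \<beta>3 + \<beta>3' = a3)"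
    using two_flips_exceed[of a1 a3 a2 \<beta>2 \<beta>2' \<beta>1 \<beta>3 \<beta>1' \<beta>3'] pos range(3,9) sum
        by (auto simp: algebra_simps)
  have n23: "\<not> (\<beta>2 + \<beta>2' = a2 \<and> \<beta>3 + \<beta>3' = a3)"
    using two_flips_exceed[of a2 a3 a1 \<beta>1 \<beta>1' \<beta>2 \<beta>3 \<beta>2' \<beta>3'] pos range(1,7) sum
        by (auto simp: algebra_simps)
  have cop': "coprime a1 (a3 * a2)" "coprime a2 (a3 * a1)" "coprime a3 (a2 * a1)"
    using cop by (simp_all add: mult.commute)
  have "\<beta>1 = \<beta>1'"
  proof (rule ccontr)
    assume neq: "\<beta>1 \<noteq> \<beta>1'"
    then have f: "\<beta>1 + \<beta>1' = a1" "\<beta>2' = \<beta>2" "\<beta>3' = \<beta>3" using s1 s2 s3 n12 n13 by auto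
    then show False
      using no_single_flip[OF cop cbs range(1-6) f(1) _ _ _ d(1) _ parity dvd] n12 n13 neq d(2)
          by auto
  qed
  moreover have "\<beta>2 = \<beta>2'"
  proof (rule ccontr)
    assume neq: "\<beta>2 \<noteq> \<beta>2'"
    then have f: "\<beta>2 + \<beta>2' = a2" "\<beta>1' = \<beta>1" "\<beta>3' = \<beta>3" using s1 s2 s3 n12 n23 by auto
    have "d = a2 * a1 * a3 - \<beta>2 * a1 * a3 - \<beta>1 * a2 * a3 - \<beta>3 * a2 * a1"
      "d' = a2 * a1 * a3 - \<beta>2' * a1 * a3 - \<beta>1 * a2 * a3 - \<beta>3 * a2 * a1"
      using d f by (simp_all add: algebra_simps)
    then show False
      using no_single_flip[OF cop(2,1) cop'(3) cbs(2,1,3) range(3,4,1,2,5,6) f(1) _ _ _ _ _ parity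
          dvd(2,1,3)]
        n12 n23 neq f by auto
  qed
  moreover have "\<beta>3 = \<beta>3'"
  proof (rule ccontr)
    assume neq: "\<beta>3 \<noteq> \<beta>3'"
    then have f: "\<beta>3 + \<beta>3' = a3" "\<beta>1' = \<beta>1" "\<beta>2' = \<beta>2" using s1 s2 s3 n13 n23 by auto
    have "d = a3 * a1 * a2 - \<beta>3 * a1 * a2 - \<beta>1 * a3 * a2 - \<beta>2 * a3 * a1"
      "d' = a3 * a1 * a2 - \<beta>3' * a1 * a2 - \<beta>1 * a3 * a2 - \<beta>2 * a3 * a1"
      using d f by (simp_all add: algebra_simps)
    then show False
      using no_single_flip[OF cop(3) cop'(1,2) cbs(3,1,2) range(5,6,1,2,3,4) f(1) _ _ _ _ _ parity
          dvd(3,1,2)]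
        n13 n23 neq f by auto
  qed
  ultimately show ?thesis by blast
qed

section \<open>Subgroups and conjugates used for representations\<close>

lemma seifert_generated_by_fibres:
  assumes K: "subgroup K (seifert_group a1 a2 a3 B)"
    and mem: "seif_elem a1 a2 a3 B Sx \<in> K" "seif_elem a1 a2 a3 B Sy \<in> K"
        "seif_elem a1 a2 a3 B Sh \<in> K"
    and A: "A \<in> carrier (seifert_group a1 a2 a3 B)"
  shows "A \<in> K"
proof (rule seifert_subgroup_top[OF K _ A])
  obtain \<beta> \<beta>1 \<beta>2 \<beta>3 where B: "B = (\<beta>, \<beta>1, \<beta>2, \<beta>3)" by (metis prod_cases4)
  interpret S: group "seifert_group a1 a2 a3 B" by (rule group_seifert)
  note rel = seifert_relations(4)[OF B, where ?a1.0 = a1 and ?a2.0 = a2 and ?a3.0 = a3]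
  have "seif_elem a1 a2 a3 B Sz = inv\<^bsub>seifert_group a1 a2 a3 B\<^esub>
      (seif_elem a1 a2 a3 B Sx \<otimes>\<^bsub>seifert_group a1 a2 a3 B\<^esub> seif_elem a1 a2 a3 B Sy)
      \<otimes>\<^bsub>seifert_group a1 a2 a3 B\<^esub> seif_elem a1 a2 a3 B Sh [^]\<^bsub>seifert_group a1 a2 a3 B\<^esub> \<beta>"
    using rel by (subst S.inv_solve_left) simp_all
  also have "\<dots> \<in> K"
    using mem by (intro subgroup.m_closed[OF K] subgroup.m_inv_closed[OF K]
        S.subgroup_int_pow_closed[OF K])
  finally show "seif_elem a1 a2 a3 B g \<in> K" for g using mem by (cases g) simp_all
qed

lemma subgroup_SU2: "subgroup SU2 SL2"
proof -
  interpret group "SL2 :: (complex ^ 2 ^ 2) monoid" by (rule group_SL2)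
  let ?s = "\<lambda>A :: complex ^ 2 ^ 2. map_matrix cnj (transpose A)"
  have mult: "?s (A ** B) = ?s B ** ?s A" for A B
    by (cases A; cases B) (simp add: mult.commute)
  have inv: "?s (?s A) = A" "det (?s A) = cnj (det A)" for A by (cases A, simp)+
  show ?thesis
  proof (rule subgroupI)
    show "SU2 \<subseteq> carrier SL2" by (auto simp: SU2_def)
    show "(SU2 :: (complex ^ 2 ^ 2) set) \<noteq> {}"
      by (auto simp: SU2_def mat22_one intro!: exI[of _ "mat22 1 0 0 1"])
    fix A :: "complex ^ 2 ^ 2" assume A: "A \<in> SU2"
    then have AA: "det A = 1" "A ** ?s A = mat 1" by (auto simp: SU2_def)
    then have "?s A ** A = mat 1" using matrix_left_right_inverse by blast
    then have "?s A \<in> SU2" using AA(1) by (simp add: SU2_def inv)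
    then show "inv\<^bsub>SL2\<^esub> A \<in> SU2" using inv_SL2[OF AA(1)] matrix_inv_eqI[OF AA(2)] by simp
    fix B :: "complex ^ 2 ^ 2" assume B: "B \<in> SU2"
    have "A ** B ** ?s (A ** B) = A ** (B ** ?s B) ** ?s A" unfolding mult
        by (simp add: matrix_mul_assoc)
    then have "A ** B ** ?s (A ** B) = mat 1" using AA B by (simp add: SU2_def)
    then show "A \<otimes>\<^bsub>SL2\<^esub> B \<in> SU2" using AA B by (simp add: SU2_def det_mul)
  qed
qed

lemma conj_hom:
  fixes P :: "'a::field ^ 2 ^ 2"
  assumes "det P = 1" "\<rho> \<in> hom G SL2"
  shows "(\<lambda>g. P ** \<rho> g ** matrix_inv P) \<in> hom G SL2"
proof (rule homI)
  note inv = SL2_matrix_inv[OF assms(1)]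
  show "P ** \<rho> g ** matrix_inv P \<in> carrier SL2" if "g \<in> carrier G" for g
    using hom_in_carrier[OF assms(2) that] inv assms(1) by (simp add: det_mul)
  show "P ** \<rho> (g \<otimes>\<^bsub>G\<^esub> h) ** matrix_inv P =
      (P ** \<rho> g ** matrix_inv P) \<otimes>\<^bsub>SL2\<^esub> (P ** \<rho> h ** matrix_inv P)"
    if "g \<in> carrier G" "h \<in> carrier G" for g h
  proof -
    have "(P ** \<rho> g ** matrix_inv P) ** (P ** \<rho> h ** matrix_inv P) =
        P ** \<rho> g ** (matrix_inv P ** P) ** \<rho> h ** matrix_inv P"
      by (simp only: matrix_mul_assoc)
    then show ?thesis using hom_mult[OF assms(2) that] inv(2) by (simp add: matrix_mul_assoc)
  qed
qed

section \<open>Irreducible representations\<close>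

lemma irreducible_no_eigenvector:
  fixes v :: "complex ^ 2"
  assumes irr: "irreducible_rep G \<rho>" and v: "v \<noteq> 0"
    and ev: "\<And>g. g \<in> carrier G \<Longrightarrow> \<exists>\<kappa>. \<rho> g *v v = \<kappa> *s v"
  shows False
proof -
  define L where "L = range (\<lambda>k. k *s v)"
  have "vec.subspace L"
    unfolding vec.subspace_def
  proof (intro conjI ballI allI)
    show "0 \<in> L" unfolding L_def by (rule image_eqI[of _ _ 0]) simp_all
    show "x + y \<in> L" if "x \<in> L" "y \<in> L" for x y
      using that unfolding L_def by (auto simp flip: vector_sadd_rdistrib)
    show "c *s x \<in> L" if "x \<in> L" for c x
      using that unfolding L_def by (auto simp: vector_smult_assoc)
  qed
  moreover have "\<rho> g *v x \<in> L" if gx: "g \<in> carrier G" "x \<in> L" for g x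
  proof -
    obtain k where "x = k *s v" using gx(2) by (auto simp: L_def)
    moreover obtain \<kappa> where "\<rho> g *v v = \<kappa> *s v" using ev[OF gx(1)] by blast
    ultimately have "\<rho> g *v x = (k * \<kappa>) *s v"
        by (simp add: vector_scalar_commute vector_smult_assoc)
    then show ?thesis unfolding L_def by (rule image_eqI) simp
  qed
  ultimately have "L = {0} \<or> L = UNIV" using irr unfolding irreducible_rep_def by blast
  moreover have "v \<in> L" unfolding L_def by (rule image_eqI[of _ _ 1]) simp_all
  ultimately have "L = UNIV" using v by blast
  obtain v1 v2 where v12: "v = vector [v1, v2]" by (rule vec2_cases)
  have "vector [1, 0] \<in> L" "vector [0, 1] \<in> L" using \<open>L = UNIV\<close> by simp_all
  then obtain k1 k2 where "vector [1, 0] = k1 *s v" "vector [0, 1] = k2 *s v"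
    unfolding L_def by (elim rangeE) (rule that)
  then have "1 = k1 * v1" "0 = k1 * v2" "1 = k2 * v2"
    unfolding v12 vec2_smult by (simp_all add: vec_eq_iff forall_2)
  then show False by auto
qed

text \<open>Schur's lemma; the scalar is a sign because the determinant is \<open>1\<close>.\<close>

lemma irreducible_central:
  fixes \<rho> :: "'g \<Rightarrow> complex ^ 2 ^ 2"
  assumes \<rho>: "\<rho> \<in> hom G SL2" and irr: "irreducible_rep G \<rho>"
    and h: "h \<in> carrier G" "\<And>g. g \<in> carrier G \<Longrightarrow> h \<otimes>\<^bsub>G\<^esub> g = g \<otimes>\<^bsub>G\<^esub> h"
  shows "\<rho> h \<in> {mat 1, - mat 1}"
proof -
  have det: "det (\<rho> h) = 1" using hom_in_carrier[OF \<rho> h(1)] by simp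
  obtain u where u: "u \<noteq> 0" "trace (\<rho> h) = u + 1 / u" by (rule complex_eigenvalue)
  obtain v where v: "v \<noteq> 0" "\<rho> h *v v = u *s v" using eigenvector_exists[OF det u(2,1)] .
  define V where "V = {w. \<rho> h *v w = u *s w}"
  have "vec.subspace V"
    unfolding vec.subspace_def V_def
    by (auto simp: matrix_vector_right_distrib vector_add_ldistrib vector_scalar_commute
        vector_smult_assoc mult.commute)
  moreover have "\<rho> g *v w \<in> V" if "g \<in> carrier G" "w \<in> V" for g w
  proof -
    have "\<rho> h ** \<rho> g = \<rho> g ** \<rho> h"
      using hom_mult[OF \<rho>] h that(1) by (metis SL2_simps(2))
    then have "\<rho> h *v (\<rho> g *v w) = \<rho> g *v (\<rho> h *v w)" by (simp add: matrix_vector_mul_assoc)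
    also have "\<dots> = u *s (\<rho> g *v w)" using that(2) by (simp add: V_def vector_scalar_commute)
    finally show ?thesis by (simp add: V_def)
  qed
  ultimately have "V = {0} \<or> V = UNIV" using irr unfolding irreducible_rep_def by blast
  then have all: "\<rho> h *v w = u *s w" for w using v unfolding V_def by blast
  obtain a b c d where H: "\<rho> h = mat22 a b c d" by (rule mat22_cases)
  have "a = u" "c = 0" "b = 0" "d = u"
    using all[of "vector [1, 0]"] all[of "vector [0, 1]"] unfolding H vec2_smult mat22_mult_vec
    by (simp_all add: vec_eq_iff forall_2)
  moreover from this have "u * u = 1" using det by (simp add: H)
  then have "u = 1 \<or> u = - 1" by (simp add: square_eq_1_iff)
  ultimately show ?thesis by (auto simp: H mat22_one)
qed

lemma neg_trace_cos:
  assumes "m \<le> n" "0 < n"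
  shows "cos (pi * real (n - m) / real n) = - cos (pi * real m / real n)"
proof -
  have "pi * real (n - m) / real n = pi - pi * real m / real n"
    using assms by (simp add: of_nat_diff field_simps)
  then show ?thesis by simp
qed

text \<open>The four cases of \<open>cosine_region\<close> are exchanged by changing the signs of \<open>X\<close> and \<open>Y\<close>, as a
  sign change of a matrix replaces its angle by the supplement.\<close>

lemma sign_normalization:
  fixes X Y :: "complex ^ 2 ^ 2" and n1 n2 n3 m1 m2 m3 :: nat
  assumes m: "0 < m1" "m1 < n1" "0 < m2" "m2 < n2" "0 < m3" "m3 < n3"
    and tr: "trace X = of_real (2 * cos (pi * real m1 / real n1))"
      "trace Y = of_real (2 * cos (pi * real m2 / real n2))"
      "trace (X ** Y) = of_real (- 2 * cos (pi * real m3 / real n3))"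
    and hyp: "(sin (pi * real m1 / real n1) * sin (pi * real m2 / real n2))\<^sup>2 <
      (cos (pi * real m1 / real n1) * cos (pi * real m2 / real n2) + cos (pi * real m3 / real n3))\<^sup>2"
  obtains X' Y' l1 l2 l3 where "X' \<in> {X, - X}" "Y' \<in> {Y, - Y}"
    "0 < l1" "l1 < n1" "0 < l2" "l2 < n2" "0 < l3" "l3 < n3"
    "real l1 / real n1 + real l2 / real n2 + real l3 / real n3 < 1"
    "trace X' = of_real (2 * cos (pi * real l1 / real n1))"
    "trace Y' = of_real (2 * cos (pi * real l2 / real n2))"
    "trace (X' ** Y') = of_real (- 2 * cos (pi * real l3 / real n3))"
proof -
  have n: "0 < n1" "0 < n2" "0 < n3" using m by simp_all
  have neg: "pi - pi * real k / real n = pi * real (n - k) / real n" if "k < n" for k n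
    using that by (simp add: of_nat_diff field_simps)
  have sum: "real k1 / real n1 + real k2 / real n2 + real k3 / real n3 < 1"
    if "pi * real k1 / real n1 + pi * real k2 / real n2 + pi * real k3 / real n3 < pi" for k1 k2 k3
  proof -
    have "pi * (real k1 / real n1 + real k2 / real n2 + real k3 / real n3) < pi * 1"
      using that by (simp add: algebra_simps)
    then show ?thesis by (simp only: mult_less_cancel_left_pos[OF pi_gt_zero])
  qed
  have range: "0 < pi * real k / real n" "pi * real k / real n < pi" if "0 < k" "k < n" for k n
    using that by (simp_all add: field_simps)
  note negc = neg_trace_cos[OF less_imp_le[OF m(2)] n(1)] neg_trace_cos[OF less_imp_le[OF m(4)]
      n(2)]
    neg_trace_cos[OF less_imp_le[OF m(6)] n(3)]
  from cosine_region[OF range[OF m(1,2)] range[OF m(3,4)] range[OF m(5,6)] hyp]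
  consider "pi * real m1 / real n1 + pi * real m2 / real n2 + pi * real m3 / real n3 < pi"
    | "pi * real (n1 - m1) / real n1 + pi * real (n2 - m2) / real n2 + pi * real m3 / real n3 < pi"
    | "pi * real (n1 - m1) / real n1 + pi * real m2 / real n2 + pi * real (n3 - m3) / real n3 < pi"
    | "pi * real m1 / real n1 + pi * real (n2 - m2) / real n2 + pi * real (n3 - m3) / real n3 < pi"
    unfolding neg[OF m(2)] neg[OF m(4)] neg[OF m(6)] by blast
  then show thesis
  proof cases
    case 1
    show thesis by (rule that[of X Y m1 m2 m3]) (use m tr sum[OF 1] in simp_all)
  next
    case 2
    show thesis by (rule that[of "- X" "- Y" "n1 - m1" "n2 - m2" m3])
        (use m tr sum[OF 2] negc in simp_all)
  next
    case 3
    show thesis by (rule that[of "- X" Y "n1 - m1" m2 "n3 - m3"])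
        (use m tr sum[OF 3] negc in simp_all)
  next
    case 4
    show thesis by (rule that[of X "- Y" m1 "n2 - m2" "n3 - m3"])
        (use m tr sum[OF 4] negc in simp_all)
  qed
qed

text \<open>The fibre acts as a sign, so the three generators are torsion modulo the centre and have
  real traces. None of them is central and there is no common eigenvector, by irreducibility; the
  unitary case is excluded by hypothesis. This leaves the traces of a hyperbolic triangle group,
  up to signs.\<close>

lemma irreducible_brieskorn_traces:
  fixes a1 a2 a3 :: nat and c :: "int \<times> int \<times> int \<times> int" and \<rho> ::
      "seif_gen word set \<Rightarrow> complex ^ 2 ^ 2"
  defines "G \<equiv> pi1_brieskorn a1 a2 a3 c" and "e \<equiv> seif_elem a1 a2 a3 c"
  assumes a: "0 < a1" "0 < a2" "0 < a3"
    and \<rho>: "\<rho> \<in> hom G SL2" and irr: "irreducible_rep G \<rho>"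
    and not_SU2: "\<not> (\<exists>\<sigma>\<in>hom G SL2. \<sigma> ` carrier G \<subseteq> SU2 \<and> conjugate_reps G \<rho> \<sigma>)"
  obtains X Y l1 l2 l3 where "\<rho> (e Sh) \<in> {mat 1, - mat 1}"
    "X \<in> {\<rho> (e Sx), - \<rho> (e Sx)}" "Y \<in> {\<rho> (e Sy), - \<rho> (e Sy)}"
    "0 < l1" "l1 < a1" "0 < l2" "l2 < a2" "0 < l3" "l3 < a3"
    "real l1 / real a1 + real l2 / real a2 + real l3 / real a3 < 1"
    "trace X = of_real (2 * cos (pi * real l1 / real a1))"
    "trace Y = of_real (2 * cos (pi * real l2 / real a2))"
    "trace (X ** Y) = of_real (- 2 * cos (pi * real l3 / real a3))"
proof -
  obtain b b1 b2 b3 where c: "c = (b, b1, b2, b3)" by (metis prod_cases4)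
  interpret G: group G unfolding G_def by (rule group_seifert)
  interpret L: group "SL2 :: (complex ^ 2 ^ 2) monoid" by (rule group_SL2)
  interpret \<rho>: group_hom G SL2 \<rho> by (rule group_homI[OF G.group_axioms L.group_axioms \<rho>])
  have mem [simp]: "e g \<in> carrier G" for g by (simp add: e_def G_def)
  note rels = seifert_relations[OF c, where ?a1.0 = a1 and ?a2.0 = a2
      and ?a3.0 = a3, folded G_def e_def]
  define X Y Z H where XYZ: "X = \<rho> (e Sx)" "Y = \<rho> (e Sy)" "Z = \<rho> (e Sz)" "H = \<rho> (e Sh)"
  have det: "det X = 1" "det Y = 1" "det Z = 1" "det H = 1"
    using \<rho>.hom_closed[OF mem] by (simp_all add: XYZ)
  have H: "H \<in> {mat 1, - mat 1}"
    unfolding XYZ using irreducible_central[OF \<rho> irr mem rels(5)] .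
  have sub: "subgroup {mat 1, - mat 1} (SL2 :: (complex ^ 2 ^ 2) monoid)"
    by (rule normal_imp_subgroup[OF signs_normal])
  have Hpow: "H [^]\<^bsub>SL2\<^esub> k \<in> {mat 1, - mat 1}" for k :: int
    by (rule L.subgroup_int_pow_closed[OF sub H])
  have pows: "X [^]\<^bsub>SL2\<^esub> a1 \<in> {mat 1, - mat 1}" "Y [^]\<^bsub>SL2\<^esub> a2 \<in> {mat 1, - mat 1}"
    "Z [^]\<^bsub>SL2\<^esub> a3 \<in> {mat 1, - mat 1}"
    using rels(1-3)[THEN arg_cong[of _ _ \<rho>]] Hpow by (simp_all add: \<rho>.hom_nat_pow \<rho>.hom_int_pow XYZ)
  have "X ** Y ** Z \<in> {mat 1, - mat 1}"
    using rels(4)[THEN arg_cong[of _ _ \<rho>]] Hpow[of b] by (simp add: \<rho>.hom_int_pow XYZ)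
  then obtain s where s: "s \<in> {1, - 1 :: complex}" and "X ** Y ** Z = mat22 s 0 0 s"
    unfolding mat22_one mat22_uminus by force
  then have XY: "X ** Y = mat22 s 0 0 s ** matrix_inv Z"
    by (metis SL2_matrix_inv(1)[OF det(3)] matrix_mul_assoc matrix_mul_rid)
  have scal: "\<exists>\<kappa>. W *v v = \<kappa> *s v" if W: "W = mat 1 \<or> W = - mat 1" for W :: "complex ^ 2 ^ 2" and v
    using W
  proof
    assume "W = mat 1"
    then show ?thesis by (intro exI[of _ 1]) simp
  next
    assume "W = - mat 1"
    then show ?thesis
      by (intro exI[of _ "- 1"]) (simp add: matrix_vector_uminus_left flip: vector_sneg_minus1)
  qed
  have no_ev: "False" if v: "v \<noteq> 0" "X *v v = \<kappa> *s v" "Y *v v = \<mu> *s v" for v \<kappa> \<mu>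
  proof (rule irreducible_no_eigenvector[OF irr v(1)])
    define K where "K = {g \<in> carrier G. \<exists>\<kappa>. \<rho> g *v v = \<kappa> *s v}"
    have "subgroup K G"
    proof (rule G.subgroupI)
      show "K \<subseteq> carrier G" by (auto simp: K_def)
      have "\<one>\<^bsub>G\<^esub> \<in> K" by (auto simp: K_def intro!: exI[of _ 1])
      then show "K \<noteq> {}" by blast
      fix g assume "g \<in> K"
      then obtain \<kappa> where g: "g \<in> carrier G" "\<rho> g *v v = \<kappa> *s v" by (auto simp: K_def)
      have dg: "det (\<rho> g) = 1" using \<rho>.hom_closed[OF g(1)] by simp
      have "v = matrix_inv (\<rho> g) *v (\<kappa> *s v)"
        unfolding g(2)[symmetric] by (simp add: matrix_vector_mul_assoc SL2_matrix_inv(2)[OF dg])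
      then have pull: "v = \<kappa> *s (matrix_inv (\<rho> g) *v v)" by (simp add: vector_scalar_commute)
      then have "\<kappa> \<noteq> 0" using v(1) by auto
      then have "matrix_inv (\<rho> g) *v v = (1 / \<kappa>) *s v"
        using arg_cong[OF pull, of "\<lambda>w. (1 / \<kappa>) *s w"] by (simp add: vector_smult_assoc)
      then show "inv\<^bsub>G\<^esub> g \<in> K" using g(1) dg by (auto simp: K_def inv_SL2)
      fix g' assume "g' \<in> K"
      then obtain \<kappa>' where g': "g' \<in> carrier G" "\<rho> g' *v v = \<kappa>' *s v" by (auto simp: K_def)
      have "(\<rho> g ** \<rho> g') *v v = (\<kappa> * \<kappa>') *s v"
        by (simp add: g' g vector_scalar_commute vector_smult_assoc mult.commute flip:
            matrix_vector_mul_assoc)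
      then show "g \<otimes>\<^bsub>G\<^esub> g' \<in> K" using g(1) g'(1) by (auto simp: K_def)
    qed
    moreover have "e Sx \<in> K" "e Sy \<in> K" using v by (auto simp: K_def XYZ)
    moreover have "e Sh \<in> K"
      using scal[of H v] H by (simp add: K_def XYZ(4))
    ultimately show "\<exists>\<kappa>. \<rho> g *v v = \<kappa> *s v" if "g \<in> carrier G" for g
      using seifert_generated_by_fibres[of K a1 a2 a3 c g] that unfolding G_def e_def K_def by blast
  qed
  have ev: "\<exists>v \<kappa>. v \<noteq> 0 \<and> W *v v = \<kappa> *s v" if "det W = 1" for W :: "complex ^ 2 ^ 2"
    using complex_eigenvalue[of "trace W"] eigenvector_exists[OF that] by metis
  have X1: "X \<noteq> mat 1" "X \<noteq> - mat 1" using scal[of X] ev[OF det(2)] no_ev by metis+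
  have Y1: "Y \<noteq> mat 1" "Y \<noteq> - mat 1" using scal[of Y] ev[OF det(1)] no_ev by metis+
  have Z1: "Z \<noteq> mat 1 \<and> Z \<noteq> - mat 1"
  proof (rule ccontr)
    assume "\<not> (Z \<noteq> mat 1 \<and> Z \<noteq> - mat 1)"
    then have "matrix_inv Z = mat22 1 0 0 1 \<or> matrix_inv Z = mat22 (- 1) 0 0 (- 1)"
      by (auto intro!: matrix_inv_eqI simp: mat22_one)
    then obtain t where "X ** Y = mat22 t 0 0 t" unfolding XY by auto
    moreover obtain v \<kappa> where v: "v \<noteq> 0" "Y *v v = \<kappa> *s v" using ev[OF det(2)] by blast
    moreover have "\<kappa> \<noteq> 0"
    proof
      assume "\<kappa> = 0"
      then have "matrix_inv Y *v (Y *v v) = 0" using v(2) by simp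
      then show False using v(1) by (simp add: matrix_vector_mul_assoc SL2_matrix_inv(2)[OF det(2)])
    qed
    moreover have "mat22 t 0 0 t *v v = t *s v" by (rule vec2_cases[of v]) (simp add: vec2_smult)
    ultimately have "\<kappa> *s (X *v v) = t *s v" "\<kappa> \<noteq> 0"
      by (metis matrix_vector_mul_assoc vector_scalar_commute)+
    then have "(1 / \<kappa>) *s (\<kappa> *s (X *v v)) = (1 / \<kappa>) *s (t *s v)" by (simp only:)
    then have "X *v v = (t / \<kappa>) *s v"
      using \<open>\<kappa> \<noteq> 0\<close> by (simp add: vector_smult_assoc)
    then show False using no_ev v by blast
  qed
  obtain m1 where m1: "0 < m1" "m1 < a1" "trace X = of_real (2 * cos (pi * real m1 / real a1))"
    using torsion_trace[OF det(1) a(1) pows(1) X1] by metis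
  obtain m2 where m2: "0 < m2" "m2 < a2" "trace Y = of_real (2 * cos (pi * real m2 / real a2))"
    using torsion_trace[OF det(2) a(2) pows(2) Y1] by metis
  obtain m where m: "0 < m" "m < a3" "trace Z = of_real (2 * cos (pi * real m / real a3))"
    using torsion_trace[OF det(3) a(3) pows(3)] Z1 by metis
  have "trace (X ** Y) = s * trace Z"
    unfolding XY trace_inv[OF det(3), symmetric] by (cases "matrix_inv Z") (simp add: algebra_simps)
  moreover obtain m3 where m3: "0 < m3" "m3 < a3"
      "s * trace Z = of_real (- 2 * cos (pi * real m3 / real a3))"
  proof (cases "s = 1")
    case True
    show thesis using m True neg_trace_cos[of m a3] by (intro that[of "a3 - m"]) simp_all
  next
    case False
    then show thesis using m s by (intro that[of m]) simp_all
  qed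
  ultimately have trXY: "trace (X ** Y) = of_real (- 2 * cos (pi * real m3 / real a3))" by simp
  have range: "0 < pi * real k / real n" "pi * real k / real n < pi" if "0 < k" "k < n" for k n
    using that by (simp_all add: field_simps)
  have not_conj: "\<not> (\<exists>P. det P = 1 \<and> P ** X ** matrix_inv P \<in> SU2 \<and> P ** Y ** matrix_inv P \<in> SU2)"
  proof
    assume "\<exists>P. det P = 1 \<and> P ** X ** matrix_inv P \<in> SU2 \<and> P ** Y ** matrix_inv P \<in> SU2"
    then obtain P where P: "det P = 1" "P ** X ** matrix_inv P \<in> SU2"
        "P ** Y ** matrix_inv P \<in> SU2" by blast
    define \<sigma> where "\<sigma> g = P ** \<rho> g ** matrix_inv P" for g
    have \<sigma>: "\<sigma> \<in> hom G SL2" unfolding \<sigma>_def using conj_hom[OF P(1) \<rho>] .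
    interpret \<sigma>: group_hom G SL2 \<sigma> by (rule group_homI[OF G.group_axioms L.group_axioms \<sigma>])
    have "subgroup {g \<in> carrier G. \<sigma> g \<in> SU2} G"
      by (rule G.subgroupI)
        (auto simp del: SL2_simps intro: subgroup.m_closed[OF subgroup_SU2]
            subgroup.m_inv_closed[OF subgroup_SU2]
          subgroup.one_closed[OF subgroup_SU2] intro!: exI[of _ "\<one>\<^bsub>G\<^esub>"])
    moreover have "\<sigma> (e Sh) \<in> SU2"
    proof -
      have "\<sigma> (e Sh) = H" using H by (auto simp: \<sigma>_def SL2_matrix_inv(1)[OF P(1)] simp flip: XYZ)
      moreover have "mat 1 \<in> SU2" "- mat 1 \<in> SU2" by (simp_all add: SU2_def mat22_one)
      ultimately show ?thesis using H by auto
    qed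
    ultimately have "\<sigma> ` carrier G \<subseteq> SU2"
      using seifert_generated_by_fibres[of "{g \<in> carrier G. \<sigma> g \<in> SU2}" a1 a2 a3 c] P(2,3) mem
      unfolding G_def e_def \<sigma>_def XYZ by blast
    moreover have "conjugate_reps G \<rho> \<sigma>"
      unfolding conjugate_reps_def using P(1) by (auto simp: \<sigma>_def)
    ultimately show False using not_SU2 \<sigma> by blast
  qed
  have "\<not> (\<exists>v \<kappa> \<mu>. v \<noteq> 0 \<and> X *v v = \<kappa> *s v \<and> Y *v v = \<mu> *s v)" using no_ev by blast
  with real_traces_cases[OF range[OF m1(1,2)] range[OF m2(1,2)] range[OF m3(1,2)] det(1) m1(3)
      det(2) m2(3) trXY]
    not_conj
  have hyp: "(sin (pi * real m1 / real a1) * sin (pi * real m2 / real a2))\<^sup>2 <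
      (cos (pi * real m1 / real a1) * cos (pi * real m2 / real a2) + cos (pi * real m3 / real a3))\<^sup>2"
    by blast
  show thesis
    by (rule sign_normalization[OF m1(1,2) m2(1,2) m3(1,2) m1(3) m2(3) trXY hyp])
      (rule that[OF H[unfolded XYZ]], simp_all add: XYZ)
qed

section \<open>Uniqueness and existence of the Euler class\<close>

lemma sum_less_one_iff:
  fixes a1 a2 a3 :: nat and \<beta>1 \<beta>2 \<beta>3 :: int
  assumes "0 < a1" "0 < a2" "0 < a3"
  shows "of_int \<beta>1 / of_nat a1 + of_int \<beta>2 / of_nat a2 + of_int \<beta>3 / of_nat a3 < (1 ::
      'a::linordered_field) \<longleftrightarrow>
    \<beta>1 * int a2 * int a3 + \<beta>2 * int a1 * int a3 + \<beta>3 * int a1 * int a2 < int a1 * int a2 * int a3"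
proof -
  let ?q = "of_int \<beta>1 / of_nat a1 + of_int \<beta>2 / of_nat a2 + of_int \<beta>3 / of_nat a3 :: 'a"
  have pos: "(of_nat a1 * of_nat a2 * of_nat a3 :: 'a) > 0" using assms by simp
  have "of_nat a1 * of_nat a2 * of_nat a3 * ?q =
      of_int (\<beta>1 * int a2 * int a3 + \<beta>2 * int a1 * int a3 + \<beta>3 * int a1 * int a2)"
    using clear_denominators[of "of_nat a1 :: 'a" "of_nat a2" "of_nat a3" 0] assms by simp
  then have "?q < 1 \<longleftrightarrow> of_int (\<beta>1 * int a2 * int a3 + \<beta>2 * int a1 * int a3 + \<beta>3 * int a1 * int a2) <
      (of_int (int a1 * int a2 * int a3) :: 'a)"
    using mult_less_cancel_left_pos[OF pos, of ?q 1] by simp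
  then show ?thesis by (simp only: of_int_less_iff)
qed

lemma H2_class_in_E:
  assumes a: "0 < a1" "0 < a2" "0 < a3"
    and "0 < \<beta>1" "\<beta>1 < int a1" "0 < \<beta>2" "\<beta>2 < int a2" "0 < \<beta>3" "\<beta>3 < int a3"
    and "\<beta>1 * int a2 * int a3 + \<beta>2 * int a1 * int a3 + \<beta>3 * int a1 * int a2 < int a1 * int a2 *
        int a3"
  shows "H2_class a1 a2 a3 (- 1, \<beta>1, \<beta>2, \<beta>3) \<in> E_classes a1 a2 a3"
proof -
  let ?v = "frag_cmul (- 1) (frag_of 0) + frag_cmul \<beta>1 (frag_of 1) + frag_cmul \<beta>2 (frag_of 2) +
      frag_cmul \<beta>3 (frag_of (3::nat))"
  have "?v \<in> carrier (free_Abelian_group {0..3})"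
  proof -
    interpret F: group "free_Abelian_group {0..3::nat}" by simp
    have k: "frag_cmul k (frag_of i) \<in> carrier (free_Abelian_group {0..3})" if "i \<le> 3" for k
        and i :: nat
      using keys_cmul[of k "frag_of i"] that by (auto simp: keys_single)
    show ?thesis
      using F.m_closed[OF F.m_closed[OF F.m_closed[OF k[of 0
          "- 1"] k[of 1 \<beta>1]] k[of 2 \<beta>2]] k[of 3 \<beta>3]] by simp
  qed
  then have "H2_class a1 a2 a3 (- 1, \<beta>1, \<beta>2, \<beta>3) \<in> carrier (H2 a1 a2 a3)"
    unfolding H2_def carrier_FactGroup H2_class.simps by (rule imageI)
  then show ?thesis
    unfolding E_classes_def using assms(4-) sum_less_one_iff[OF a, of \<beta>1 \<beta>2 \<beta>3, where ?'a = rat]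
        by blast
qed

text \<open>The traces of the representation at the generators and at the fibre determine the Seifert
  invariants. At the fibre they give the parity of the degree of the covering.\<close>

lemma euler_class_unique:
  fixes a1 a2 a3 :: nat and b b1 b2 b3 :: int
  assumes a: "0 < a1" "0 < a2" "0 < a3"
    and cop: "coprime a1 a2" "coprime a1 a3" "coprime a2 a3"
    and data: "brieskorn_data a1 a2 a3 c" and c: "c = (b, b1, b2, b3)"
    and eu: "eu \<in> E_classes a1 a2 a3" "induced_rep a1 a2 a3 c eu \<rho>1"
        "conjugate_reps (pi1_brieskorn a1 a2 a3 c) \<rho>1 \<rho>"
    and eu': "eu' \<in> E_classes a1 a2 a3" "induced_rep a1 a2 a3 c eu' \<rho>2"
        "conjugate_reps (pi1_brieskorn a1 a2 a3 c) \<rho>2 \<rho>"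
  shows "eu = eu'"
proof -
  define G where "G = pi1_brieskorn a1 a2 a3 c"
  interpret G: group G unfolding G_def by (rule group_seifert)
  note rels = seifert_relations[OF c, where ?a1.0 = a1 and ?a2.0 = a2 and ?a3.0 = a3, folded G_def]
  have params: "\<exists>\<beta>1 \<beta>2 \<beta>3. eu = H2_class a1 a2 a3 (- 1, \<beta>1, \<beta>2, \<beta>3) \<and> 0 < \<beta>1 \<and> \<beta>1 < int a1 \<and>
      0 < \<beta>2 \<and> \<beta>2 < int a2 \<and> 0 < \<beta>3 \<and> \<beta>3 < int a3 \<and>
      \<beta>1 * int a2 * int a3 + \<beta>2 * int a1 * int a3 + \<beta>3 * int a1 * int a2 < int a1 * int a2 * int a3"
    if "eu \<in> E_classes a1 a2 a3" for eu
    using that unfolding E_classes_def sum_less_one_iff[OF a] by blast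
  have same: "trace (\<rho>1 g) = trace (\<rho>2 g)" if "g \<in> carrier G" for g
    using eu(3) eu'(3) that unfolding conjugate_reps_def G_def[symmetric]
        by (metis SL2_simps(1) trace_conj)
  obtain \<beta>1 \<beta>2 \<beta>3 where \<beta>: "eu = H2_class a1 a2 a3 (- 1, \<beta>1, \<beta>2, \<beta>3)" "0 < \<beta>1" "\<beta>1 < int a1"
      "0 < \<beta>2" "\<beta>2 < int a2" "0 < \<beta>3" "\<beta>3 < int a3"
      "\<beta>1 * int a2 * int a3 + \<beta>2 * int a1 * int a3 + \<beta>3 * int a1 * int a2 < int a1 * int a2 * int
          a3"
    using params[OF eu(1)] by metis
  obtain \<beta>1' \<beta>2' \<beta>3' where \<beta>': "eu' = H2_class a1 a2 a3 (- 1, \<beta>1', \<beta>2', \<beta>3')" "0 < \<beta>1'"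
      "\<beta>1' < int a1"
      "0 < \<beta>2'" "\<beta>2' < int a2" "0 < \<beta>3'" "\<beta>3' < int a3"
      "\<beta>1' * int a2 * int a3 + \<beta>2' * int a1 * int a3 + \<beta>3' * int a1 * int a2 < int a1 * int a2 *
          int a3"
    using params[OF eu'(1)] by metis
  define d where "d = int a1 * int a2 * int a3 - \<beta>1 * int a2 * int a3 - \<beta>2 * int a1 * int a3 - \<beta>3
      * int a1 * int a2"
  define d' where "d' = int a1 * int a2 * int a3 - \<beta>1' * int a2 * int a3 - \<beta>2' * int a1 * int a3 -
      \<beta>3' * int a1 * int a2"
  have "d > 0" "d' > 0" using \<beta>(8) \<beta>'(8) by (simp_all add: d_def d'_def)
  note fl = euler_degree_floor[OF a this(1) d_def] euler_degree_floor[OF a this(2) d'_def]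
  have key: "2 * int n dvd m * d - m * d' \<or> 2 * int n dvd m * d + m * d'"
    if g: "g \<in> carrier G" "0 < n" "g [^]\<^bsub>G\<^esub> n = seif_elem a1 a2 a3 c Sh [^]\<^bsub>G\<^esub> (- m)" for g n m
  proof -
    have "2 * cos (pi * of_int (d * (- m)) / of_nat n) = 2 * cos (pi * of_int (d' * (- m)) /
        of_nat n)"
      using same[OF g(1)] induced_rep_trace[OF eu(2) \<beta>(1) a, of g n
          "- m"] induced_rep_trace[OF eu'(2) \<beta>'(1) a, of g n "- m"]
        g unfolding fl G_def by (metis of_real_eq_iff)
    then have "2 * int n dvd d * (- m) - d' * (- m) \<or> 2 * int n dvd d * (- m) + d' * (- m)"
      using cos_fraction_eq[OF g(2), of "d * (- m)" "d' * (- m)"] by simp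
    then show ?thesis
      using dvd_minus_iff[of "2 * int n" "m * d - m * d'"] dvd_minus_iff[of "2 * int n"
          "m * d + m * d'"]
      by (auto simp: algebra_simps)
  qed
  have "seif_elem a1 a2 a3 c Sh [^]\<^bsub>G\<^esub> (1::nat) = seif_elem a1 a2 a3 c Sh [^]\<^bsub>G\<^esub> (- (- 1) :: int)"
    using G.int_pow_1[of "seif_elem a1 a2 a3 c Sh"] G.l_one[of "seif_elem a1 a2 a3 c Sh"]
    unfolding G_def by simp
  from key[OF _ _ this] have "2 dvd d - d' \<or> 2 dvd d + d'"
    using dvd_minus_iff[of 2 "d - d'"] dvd_minus_iff[of 2 "d + d'"] by (auto simp: G_def)
  then have parity: "2 dvd d - d'" by auto
  have cop': "coprime (int a1) (int a2 * int a3)" "coprime (int a2) (int a1 * int a3)"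
    "coprime (int a3) (int a1 * int a2)"
    using cop by (simp_all add: coprime_commute)
  have "\<beta>1 = \<beta>1' \<and> \<beta>2 = \<beta>2' \<and> \<beta>3 = \<beta>3'"
    by (rule invariants_determined[OF cop' brieskorn_data_int[OF a data[unfolded c]] \<beta>(2-7)
        \<beta>'(2-7) \<beta>(8) \<beta>'(8)
          d_def d'_def parity key[OF _ a(1) rels(1)] key[OF _ a(2) rels(2)] key[OF _ a(3) rels(3)]])
      (simp_all add: G_def)
  then show ?thesis using \<beta>(1) \<beta>'(1) by simp
qed

theorem theorem3p1:
  fixes a1 a2 a3 :: nat and b b1 b2 b3 :: int
    and \<rho> :: "seif_gen word set \<Rightarrow> complex ^ 2 ^ 2"
  assumes "0 < a1" "0 < a2" "0 < a3"
    and "coprime a1 a2" "coprime a1 a3" "coprime a2 a3"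
    and "brieskorn_data a1 a2 a3 (b, b1, b2, b3)"
    and "\<rho> \<in> hom (pi1_brieskorn a1 a2 a3 (b, b1, b2, b3)) SL2"
    and "irreducible_rep (pi1_brieskorn a1 a2 a3 (b, b1, b2, b3)) \<rho>"
    and "\<not> (\<exists>\<sigma> \<in> hom (pi1_brieskorn a1 a2 a3 (b, b1, b2, b3)) SL2.
              \<sigma> ` carrier (pi1_brieskorn a1 a2 a3 (b, b1, b2, b3)) \<subseteq> SU2 \<and>
              conjugate_reps (pi1_brieskorn a1 a2 a3 (b, b1, b2, b3)) \<rho> \<sigma>)"
  shows "\<exists>!eu. eu \<in> E_classes a1 a2 a3 \<and>
           (\<exists>\<rho>'. induced_rep a1 a2 a3 (b, b1, b2, b3) eu \<rho>' \<and>
                 conjugate_reps (pi1_brieskorn a1 a2 a3 (b, b1, b2, b3)) \<rho>' \<rho>)"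
proof -
  define c where "c = (b, b1, b2, b3)"
  define G where "G = pi1_brieskorn a1 a2 a3 c"
  define e where "e = seif_elem a1 a2 a3 c"
  note a = assms(1-3) and cop = assms(4-6) and data = assms(7)[folded c_def]
  note \<rho> = assms(8)[folded c_def G_def] and irr = assms(9)[folded c_def G_def]
    and not_SU2 = assms(10)[folded c_def G_def]
  interpret G: group G unfolding G_def by (rule group_seifert)
  interpret L: group "SL2 :: (complex ^ 2 ^ 2) monoid" by (rule group_SL2)
  have mem [simp]: "e g \<in> carrier G" for g by (simp add: e_def G_def)
  obtain X Y l1 l2 l3 where H: "\<rho> (e Sh) \<in> {mat 1, - mat 1}"
    and X: "X \<in> {\<rho> (e Sx), - \<rho> (e Sx)}" and Y: "Y \<in> {\<rho> (e Sy), - \<rho> (e Sy)}"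
    and l: "0 < l1" "l1 < a1" "0 < l2" "l2 < a2" "0 < l3" "l3 < a3"
      "real l1 / real a1 + real l2 / real a2 + real l3 / real a3 < 1"
    and tr: "trace X = of_real (2 * cos (pi * real l1 / real a1))"
      "trace Y = of_real (2 * cos (pi * real l2 / real a2))"
      "trace (X ** Y) = of_real (- 2 * cos (pi * real l3 / real a3))"
    by (rule irreducible_brieskorn_traces[OF a \<rho>[unfolded G_def] irr[unfolded G_def]
        not_SU2[unfolded G_def],
          folded G_def e_def]) (rule that)
  have det: "det X = 1" "det Y = 1"
    using X Y hom_in_carrier[OF \<rho> mem] by auto
  define A B C where ABC: "A = pi * real l1 / real a1" "B = pi * real l2 / real a2"
      "C = pi * real l3 / real a3"
  have range: "0 < A" "A < pi" "0 < B" "B < pi" "0 < C" "C < pi"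
    using l unfolding ABC by (simp_all add: field_simps)
  have "A + B + C = pi * (real l1 / real a1 + real l2 / real a2 + real l3 / real a3)"
    by (simp add: ABC algebra_simps)
  also have "\<dots> < pi" using l(7) by simp
  finally have "sin A * sin B < cos A * cos B + cos C"
    using range by (intro angle_sum_less_pi) simp_all
  moreover have sin: "sin A > 0" "sin B > 0" using range by (auto intro: sin_gt_zero)
  ultimately have hyp: "(sin A * sin B)\<^sup>2 < (cos A * cos B + cos C)\<^sup>2"
    by (intro power_strict_mono) simp_all
  have sum: "of_int (int l1) / of_nat a1 + of_int (int l2) / of_nat a2 + of_int (int l3) / of_nat
      a3 < (1 :: real)"
    using l(7) by simp
  have lpos: "0 < int l1" "0 < int l2" "0 < int l3" using l by simp_all
  obtain \<sigma> U V where \<sigma>: "\<sigma> \<in> hom G SL2"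
    and ind: "induced_rep a1 a2 a3 c (H2_class a1 a2 a3 (- 1, int l1, int l2, int l3)) (\<lambda>g.
        map_matrix complex_of_real (\<sigma> g))"
    and \<sigma>gen: "\<sigma> (e Sx) \<in> {U, - U}" "\<sigma> (e Sy) \<in> {V, - V}" "\<sigma> (e Sh) \<in> {mat 1, - mat 1}"
    and U: "det U = 1" "trace U = 2 * cos (pi * of_int (int l1) / of_nat a1)"
    and V: "det V = 1" "trace V = 2 * cos (pi * of_int (int l2) / of_nat a2)"
      "trace (U ** V) = - 2 * cos (pi * of_int (int l3) / of_nat a3)"
    by (rule induced_rep_exists[OF a cop data c_def lpos sum, folded G_def e_def]) (rule that)
  let ?c = "map_matrix complex_of_real"
  obtain P where P: "det P = 1" "X = P ** ?c U ** matrix_inv P" "Y = P ** ?c V ** matrix_inv P"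
  proof (rule conj_by_real_traces[of A B C "?c U" "?c V" X Y])
    show "trace (?c U ** ?c V) = of_real (- 2 * cos C)"
      unfolding complexify(1)[symmetric] complexify(3) V(3) by (simp add: ABC)
  qed (use sin hyp U V det tr in \<open>simp_all add: complexify ABC\<close>)
  define \<rho>' where "\<rho>' g = ?c (\<sigma> g)" for g
  have "?c \<circ> \<sigma> \<in> hom G SL2" by (rule Group.hom_compose[OF \<sigma> complexify_hom])
  then have \<rho>': "\<rho>' \<in> hom G SL2" by (simp add: \<rho>'_def[abs_def] comp_def)
  define \<tau> where "\<tau> g = P ** \<rho>' g ** matrix_inv P" for g
  have \<tau>: "\<tau> \<in> hom G SL2" unfolding \<tau>_def using conj_hom[OF P(1) \<rho>'] .
  interpret \<rho>: group_hom G SL2 \<rho> by (rule group_homI[OF G.group_axioms L.group_axioms \<rho>])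
  interpret \<tau>: group_hom G SL2 \<tau> by (rule group_homI[OF G.group_axioms L.group_axioms \<tau>])
  define K where "K = {g \<in> carrier G. \<tau> g \<in> {\<rho> g, - \<rho> g}}"
  have subK: "subgroup K G"
  proof (rule G.subgroupI)
    show "K \<subseteq> carrier G" by (auto simp: K_def)
    have "\<one>\<^bsub>G\<^esub> \<in> K" by (simp add: K_def)
    then show "K \<noteq> {}" by blast
    fix g assume "g \<in> K"
    then have g: "g \<in> carrier G" "\<tau> g = \<rho> g \<or> \<tau> g = - \<rho> g" by (auto simp: K_def)
    have dg: "det (\<rho> g) = 1" "det (\<tau> g) = 1" using \<rho>.hom_closed[OF g(1)] \<tau>.hom_closed[OF g(1)]
        by simp_all
    have "matrix_inv (- \<rho> g) = - matrix_inv (\<rho> g)"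
      by (rule matrix_inv_eqI) (simp add: SL2_matrix_inv(1)[OF dg(1)])
    then show "inv\<^bsub>G\<^esub> g \<in> K" using g dg by (auto simp: K_def inv_SL2)
    fix g' assume "g' \<in> K"
    then show "g \<otimes>\<^bsub>G\<^esub> g' \<in> K" using g by (auto simp: K_def)
  qed
  have "e Sx \<in> K"
    using X \<sigma>gen(1) P(2) by (auto simp: K_def \<tau>_def \<rho>'_def complexify(4))
  moreover have "e Sy \<in> K"
    using Y \<sigma>gen(2) P(3) by (auto simp: K_def \<tau>_def \<rho>'_def complexify(4))
  moreover have "e Sh \<in> K"
    using H \<sigma>gen(3) by (auto simp: K_def \<tau>_def \<rho>'_def complexify(4,5) SL2_matrix_inv(1)[OF P(1)])
  ultimately have K: "g \<in> K" if "g \<in> carrier G" for g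
    using seifert_generated_by_fibres[of K a1 a2 a3 c g] subK that unfolding G_def e_def by blast
  have "\<tau> g = \<rho> g" if g: "g \<in> carrier G" for g
  proof (rule perfect_hom_eqI[OF G.group_axioms group_SL2 \<tau> \<rho> _ _ g])
    show "derived G (carrier G) = carrier G"
      using brieskorn_perfect[OF a cop assms(7)] by (simp add: G_def c_def)
    show "\<exists>z\<in>carrier SL2. \<tau> u = \<rho> u \<otimes>\<^bsub>SL2\<^esub> z \<and> (\<forall>w\<in>carrier SL2. z \<otimes>\<^bsub>SL2\<^esub> w = w \<otimes>\<^bsub>SL2\<^esub> z)"
      if "u \<in> carrier G" for u
    proof (cases "\<tau> u = \<rho> u")
      case True
      then show ?thesis by (intro bexI[of _ "mat 1"]) simp_all
    next
      case False
      then have "\<tau> u = - \<rho> u" using K[OF that] by (auto simp: K_def)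
      then show ?thesis by (intro bexI[of _ "- mat 1"]) simp_all
    qed
  qed
  then have conj: "conjugate_reps G \<rho>' \<rho>"
    unfolding conjugate_reps_def \<tau>_def using P(1) by (metis SL2_simps(1))
  have E: "H2_class a1 a2 a3 (- 1, int l1, int l2, int l3) \<in> E_classes a1 a2 a3"
    using l sum unfolding sum_less_one_iff[OF a] by (intro H2_class_in_E[OF a]) simp_all
  show ?thesis
    unfolding c_def[symmetric] G_def[symmetric]
  proof (rule ex1I)
    show "H2_class a1 a2 a3 (- 1, int l1, int l2, int l3) \<in> E_classes a1 a2 a3 \<and>
      (\<exists>\<rho>'. induced_rep a1 a2 a3 c (H2_class a1 a2 a3 (- 1, int l1, int l2, int l3)) \<rho>' \<and>
          conjugate_reps G \<rho>' \<rho>)"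
      using E ind conj unfolding \<rho>'_def[symmetric] by blast
    fix eu
    assume "eu \<in> E_classes a1 a2 a3 \<and> (\<exists>\<rho>'. induced_rep a1 a2 a3 c eu \<rho>' \<and> conjugate_reps G \<rho>' \<rho>)"
    then show "eu = H2_class a1 a2 a3 (- 1, int l1, int l2, int l3)"
      using euler_class_unique[OF a cop data c_def _ _ _ E ind] conj
      unfolding G_def \<rho>'_def[symmetric] by blast
  qed
qed

end
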